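(* Let $\Omega=\{A,T',U',R,Q\}$ be a lifting data set with $U'$ the Sz.-Nagy–Schäffer isometric lifting of $T'$, where $A:\mathcal H\to\mathcal H'$ and $R,Q:\mathcal H_0\to\mathcal H$. Assume that $A$ is a strict contraction ($\|A\|<1$) and that $R$ has a left inverse. Then an operator $B$ mapping $\mathcal H$ into $\mathcal H'\oplus H^2(\mathcal D_{T'})$ is a contractive interpolant for $\Omega$ if and only if $B$ admits a representation of the form $$B=\begin{bmatrix}A\\ \Gamma\end{bmatrix}:\mathcal H\to\begin{bmatrix}\mathcal H'\\ H^2(\mathcal D_{T'})\end{bmatrix},$$ where $\Gamma$ is the operator mapping $\mathcal H$ into $H^2(\mathcal D_{T'})$ given by $$(\Gamma h)(\lambda)=\Phi_{22}(\lambda)h+\Phi_{21}(\lambda)V(\lambda)(I-\Phi_{11}(\lambda)V(\lambda))^{-1}\Phi_{12}(\lambda)h\qquad(h\in\mathcal H,\ \lambda\in\mathbb D)\qquad( * )$$ for some Schur class function $V\in\mathbf S(\ker Q^*,\mathcal D_\circ\oplus\mathcal D_{T'}\oplus\ker R^* )$. Moreover, any such function $V$ defines an operator $\Gamma$ mapping $\mathcal H$ into $H^2(\mathcal D_{T'})$ via $( * )$. Here $\Phi_{11}\in\mathbf S(\mathcal D_\circ\oplus\mathcal D_{T'}\oplus\ker R^*,\ker Q^* )$, $\Phi_{21}\in\mathbf S(\mathcal D_\circ\oplus\mathcal D_{T'}\oplus\ker R^*,\mathcal D_{T'})$, $\Phi_{12}\in\mathbf H^2(\mathcal H,\ker Q^*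 )$ and $\Phi_{22}\in\mathbf H^2(\mathcal H,\mathcal D_{T'})$, and these functions are given for $\lambda\in\mathbb D$ by $$\Phi_{11}(\lambda)=\lambda X_3(I-\lambda X_1)^{-1}X_2,\qquad \Phi_{12}(\lambda)=X_3(I-\lambda X_1)^{-1},$$ $$\Phi_{21}(\lambda)=X_5+\lambda X_4(I-\lambda X_1)^{-1}X_2,\qquad \Phi_{22}(\lambda)=X_4(I-\lambda X_1)^{-1},$$ where $$X_1=R(Q^*D_A^2Q)^{-1}Q^*D_A^2 \text{ on }\mathcal H,$$ $$X_2=-R(R^*D_A^2R)^{-1}J^*\Delta_\Omega^{-1/2}\Pi_{\mathcal D_\circ\oplus\mathcal D_{T'}}-D_A^{-2}\Pi_{\ker R^*}^*\Delta_R^{-1/2}\Pi_{\ker R^*}:\mathcal D_\circ\oplus\mathcal D_{T'}\oplus\ker R^*\to\mathcal H,$$ $$X_3=\Delta_Q^{-1/2}\Pi_{\ker Q^*}:\mathcal H\to\ker Q^*,\qquad X_4=D_{T'}AR(Q^*D_A^2Q)^{-1}Q^*D_A^2:\mathcal H\to\mathcal D_{T'},$$ $$X_5=\Pi_{\mathcal D_{T'}}\Delta_\Omega^{-1/2}\Pi_{\mathcal D_\circ\oplus\mathcal D_{T'}}:\mathcal D_\circ\oplus\mathcal D_{T'}\oplus\ker R^*\to\mathcal D_{T'},$$ and $\Delta_Q$ on $\ker Q^*$, $\Delta_R$ on $\ker R^*$ and $\Delta_\Omega$ on $\mathcal D_\circ\oplus\mathcal D_{T'}$ are the positive definite operators $$\Delta_Q=\Pi_{\ker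 Q^*}D_A^{-2}\Pi_{\ker Q^*}^*,\quad \Delta_R=\Pi_{\ker R^*}D_A^{-2}\Pi_{\ker R^*}^*,\quad \Delta_\Omega=I+J(R^*D_A^2R)^{-1}J^*,$$ with $$J=\begin{bmatrix}D_\circ\\ D_{T'}AR\end{bmatrix}:\mathcal H_0\to\begin{bmatrix}\mathcal D_\circ\\ \mathcal D_{T'}\end{bmatrix}.$$
   Context: All spaces are Hilbert spaces; "operator" means bounded linear operator; $\mathbb D$ is the open unit disc. For a closed subspace $\mathcal M$ of $\mathcal U$, $\Pi_{\mathcal M}$ is the orthogonal projection viewed as an operator $\mathcal U\to\mathcal M$, so $\Pi_{\mathcal M}^*$ is the canonical embedding $\mathcal M\to\mathcal U$. In $X_2$, the symbol $\Pi_{\ker R^*}$ on the right denotes the projection of $\mathcal D_\circ\oplus\mathcal D_{T'}\oplus\ker R^*$ onto its summand $\ker R^*$, while $\Pi_{\ker R^*}^*$ is the embedding $\ker R^*\to\mathcal H$. An operator is positive definite if it is positive and (boundedly) invertible. For a contraction $C$, $D_C=(I-C^*C)^{1/2}$ is the defect operator and $\mathcal D_C=\overline{\operatorname{Im} D_C}$ the defect space. Lifting data set: $\Omega=\{A,T',U',R,Q\}$ where $A:\mathcal H\to\mathcal H'$ is a contraction, $T'$ is a contraction on $\mathcal H'$, $U'$ on $\mathcal K'\supset\mathcal H'$ is a minimal isometric lifting of $T'$ (i.e. $U'$ is an isometry, $\Pi_{\mathcal H'}U'=T'\Pi_{\mathcal H'}$, and $\mathcal K'$ is the closed span of $U'^n\mathcal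 H'$, $n\ge0$), and $R,Q:\mathcal H_0\to\mathcal H$ are operators with $T'AR=AQ$ and $R^*R\le Q^*Q$. A contractive interpolant for $\Omega$ is a contraction $B:\mathcal H\to\mathcal K'$ with $\Pi_{\mathcal H'}B=A$ and $U'BR=BQ$. The Sz.-Nagy–Schäffer isometric lifting of $T'$ is the operator $U'$ on $\mathcal K'=\mathcal H'\oplus H^2(\mathcal D_{T'})$ given by $U'(h\oplus f)=T'h\oplus g$ with $g(\lambda)=D_{T'}h+\lambda f(\lambda)$, where $H^2(\mathcal Y)$ is the $\mathcal Y$-valued Hardy space on $\mathbb D$. Put $D_\circ=(Q^*Q-R^*R)^{1/2}$ and $\mathcal D_\circ=\overline{D_\circ\mathcal H_0}$. $\mathbf S(\mathcal U,\mathcal Y)$ (Schur class) is the set of analytic functions on $\mathbb D$ whose values are contractions from $\mathcal U$ to $\mathcal Y$. $\mathbf H^2(\mathcal U,\mathcal Y)$ is the set of functions $F$ on $\mathbb D$ with values operators from $\mathcal U$ to $\mathcal Y$ such that $\lambda\mapsto F(\lambda)u$ is in $H^2(\mathcal Y)$ for each $u\in\mathcal U$. Under the hypotheses, $D_A$, $R^*D_A^2R$ and $Q^*D_A^2Q$ are positive definite, so the inverses in the claim exist. *)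

theory Defs
  imports "HOL-Complex_Analysis.Complex_Analysis"
begin

section \<open>Complex Hilbert spaces\<close>

text \<open>
  A complex Hilbert space is a complete real inner product space carrying a compatible complex
  structure; the underlying real inner product is the real part of the complex one.
\<close>

class complex_inner = real_inner +
  fixes scaleC :: "complex \<Rightarrow> 'a \<Rightarrow> 'a" (infixr \<open>*\<^sub>C\<close> 75)
    and cinner :: "'a \<Rightarrow> 'a \<Rightarrow> complex"
  assumes scaleC_add_right: "a *\<^sub>C (x + y) = a *\<^sub>C x + a *\<^sub>C y"
    and scaleC_add_left: "(a + b) *\<^sub>C x = a *\<^sub>C x + b *\<^sub>C x"
    and scaleC_scaleC: "a *\<^sub>C (b *\<^sub>C x) = (a * b) *\<^sub>C x"
    and scaleC_complex_of_real: "complex_of_real r *\<^sub>C x = r *\<^sub>R x"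
    and cinner_commute: "cinner x y = cnj (cinner y x)"
    and cinner_add_left: "cinner (x + y) z = cinner x z + cinner y z"
    and cinner_scaleC_left: "cinner (a *\<^sub>C x) y = a * cinner x y"
    and Re_cinner: "Re (cinner x y) = x \<bullet> y"

class chilbert_space = complex_inner + complete_space
begin
subclass banach ..
end

lemma cinner_self: "cinner x x = complex_of_real ((norm x)\<^sup>2)"
proof -
  have "Im (cinner x x) = 0"
    using arg_cong[OF cinner_commute[of x x], of Im] by simp
  then show ?thesis
    by (simp add: complex_eq_iff Re_cinner power2_norm_eq_inner)
qed

lemma norm_scaleC: "norm (a *\<^sub>C x) = cmod a * norm (x :: 'a :: complex_inner)"
proof -
  have "cinner (a *\<^sub>C x) (a *\<^sub>C x) = a * cnj a * cinner x x"
    by (metis (no_types, opaque_lifting) cinner_commute cinner_scaleC_left complex_cnj_mult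
        mult.assoc mult.left_commute)
  also have "\<dots> = complex_of_real ((cmod a * norm x)\<^sup>2)"
    by (simp add: cinner_self complex_mult_cnj cmod_power2 power_mult_distrib)
  finally have "(norm (a *\<^sub>C x))\<^sup>2 = (cmod a * norm x)\<^sup>2"
    by (simp only: cinner_self of_real_eq_iff)
  then show ?thesis by (simp add: power2_eq_iff_nonneg)
qed

lemma cmod_cinner_le: "cmod (cinner x y) \<le> norm x * norm (y :: 'a :: complex_inner)"
proof (cases "cinner x y = 0")
  case False
  define u where "u = cnj (sgn (cinner x y))"
  have u: "cmod u = 1" using False by (simp add: u_def norm_sgn)
  have "u * cinner x y = complex_of_real (cmod (cinner x y))"
    using False unfolding u_def sgn_eq
    by (simp add: complex_norm_square[symmetric] mult.commute power2_eq_square field_simps)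
  then have "cmod (cinner x y) = (u *\<^sub>C x) \<bullet> y"
    by (metis Re_cinner Re_complex_of_real cinner_scaleC_left)
  also have "\<dots> \<le> norm (u *\<^sub>C x) * norm y" by (rule norm_cauchy_schwarz)
  finally show ?thesis by (simp add: norm_scaleC u)
qed simp

lemma scaleC_zero_right: "a *\<^sub>C (0 :: 'a :: complex_inner) = 0"
  by (metis add_cancel_right_right scaleC_add_right)

lemma scaleC_minus_right: "a *\<^sub>C (- x) = - (a *\<^sub>C (x :: 'a :: complex_inner))"
  by (metis add_eq_0_iff scaleC_add_right scaleC_zero_right add.right_inverse)

lemma scaleC_diff_right: "a *\<^sub>C (x - y) = a *\<^sub>C x - a *\<^sub>C (y :: 'a :: complex_inner)"
  by (metis scaleC_add_right scaleC_minus_right uminus_add_conv_diff add.commute)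

lemma scaleC_scaleR_commute:
  "a *\<^sub>C (r *\<^sub>R x) = r *\<^sub>R (a *\<^sub>C (x :: 'a :: complex_inner))"
  by (metis mult.commute scaleC_complex_of_real scaleC_scaleC)

lemma bounded_linear_scaleC: "bounded_linear (\<lambda>x :: 'a :: complex_inner. a *\<^sub>C x)"
  by (rule bounded_linear_intro[where K = "cmod a"])
    (simp_all add: scaleC_add_right scaleC_scaleR_commute norm_scaleC mult.commute)

lemma bounded_linear_cinner_left: "bounded_linear (\<lambda>x :: 'a :: complex_inner. cinner x y)"
proof (rule bounded_linear_intro[where K = "norm y"])
  show "cinner (r *\<^sub>R x) y = r *\<^sub>R cinner x y" for r x
    by (metis cinner_scaleC_left scaleC_complex_of_real scaleR_conv_of_real)
qed (simp_all add: cinner_add_left cmod_cinner_le)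

lemma cinner_add_right: "cinner x (y + z) = cinner x y + cinner x z"
  by (metis cinner_add_left cinner_commute complex_cnj_add)

instantiation prod :: (complex_inner, complex_inner) complex_inner
begin

definition scaleC_prod :: "complex \<Rightarrow> 'a \<times> 'b \<Rightarrow> 'a \<times> 'b"
  where "scaleC_prod a p = (a *\<^sub>C fst p, a *\<^sub>C snd p)"

definition cinner_prod :: "'a \<times> 'b \<Rightarrow> 'a \<times> 'b \<Rightarrow> complex"
  where "cinner_prod p q = cinner (fst p) (fst q) + cinner (snd p) (snd q)"

instance
proof
  fix a b :: complex and r :: real and x y z :: "'a \<times> 'b"
  show "a *\<^sub>C (x + y) = a *\<^sub>C x + a *\<^sub>C y"
    by (simp add: scaleC_prod_def scaleC_add_right)
  show "(a + b) *\<^sub>C x = a *\<^sub>C x + b *\<^sub>C x"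
    by (simp add: scaleC_prod_def scaleC_add_left)
  show "a *\<^sub>C b *\<^sub>C x = (a * b) *\<^sub>C x"
    by (simp add: scaleC_prod_def scaleC_scaleC)
  show "complex_of_real r *\<^sub>C x = r *\<^sub>R x"
    by (simp add: scaleC_prod_def scaleC_complex_of_real scaleR_prod_def)
  show "cinner x y = cnj (cinner y x)"
    by (simp add: cinner_prod_def cinner_commute[of "fst x"] cinner_commute[of "snd x"])
  show "cinner (x + y) z = cinner x z + cinner y z"
    by (simp add: cinner_prod_def cinner_add_left)
  show "cinner (a *\<^sub>C x) y = a * cinner x y"
    by (simp add: cinner_prod_def scaleC_prod_def cinner_scaleC_left distrib_left)
  show "Re (cinner x y) = x \<bullet> y"
    by (simp add: cinner_prod_def inner_prod_def Re_cinner)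
qed

end

instance prod :: (chilbert_space, chilbert_space) chilbert_space ..


section \<open>The vector-valued Hardy space\<close>

definition square_summable :: "(nat \<Rightarrow> 'a::real_normed_vector) \<Rightarrow> bool"
  where "square_summable c \<longleftrightarrow> summable (\<lambda>n. (norm (c n))\<^sup>2)"

text \<open>
  Elements of the Hardy space are functions on the unit disc with square summable Taylor
  coefficients; since HOL functions are total they are extended by zero outside the disc.
\<close>

typedef (overloaded) 'a hardy =
  "{f :: complex \<Rightarrow> 'a::chilbert_space.
      (\<exists>c. square_summable c \<and> (\<forall>z\<in>ball 0 1. (\<lambda>n. z ^ n *\<^sub>C c n) sums f z)) \<and>
      (\<forall>z. z \<notin> ball 0 1 \<longrightarrow> f z = 0)}"
  morphisms hardy_fun Abs_hardy
proof
  show "(\<lambda>z. 0) \<in> {f :: complex \<Rightarrow> 'a::chilbert_space.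
      (\<exists>c. square_summable c \<and> (\<forall>z\<in>ball 0 1. (\<lambda>n. z ^ n *\<^sub>C c n) sums f z)) \<and>
      (\<forall>z. z \<notin> ball 0 1 \<longrightarrow> f z = 0)}"
    by (auto intro!: exI[of _ "\<lambda>n. 0"] simp: square_summable_def scaleC_zero_right)
qed

definition hardy_coeff :: "'a::chilbert_space hardy \<Rightarrow> nat \<Rightarrow> 'a"
  where "hardy_coeff f = (THE c. square_summable c \<and>
    (\<forall>z\<in>ball 0 1. (\<lambda>n. z ^ n *\<^sub>C c n) sums hardy_fun f z))"

lemma complex_powser_zero_coeff:
  fixes a :: "nat \<Rightarrow> complex"
  assumes "\<And>z. z \<in> ball 0 1 \<Longrightarrow> (\<lambda>n. a n * z ^ n) sums 0"
  shows "a n = 0"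
proof (cases n)
  case 0
  have "(\<lambda>n. a n * 0 ^ n) sums 0" using assms[of 0] by simp
  then show ?thesis using 0 by (metis powser_sums_zero_iff)
next
  case (Suc m)
  show ?thesis
  proof (rule ccontr)
    assume "a n \<noteq> 0"
    have "\<And>x. norm (x - 0) < 1 \<Longrightarrow> (\<lambda>n. a n * (x - 0) ^ n) sums (\<lambda>x. 0) x"
      using assms by simp
    then obtain s :: real where "0 < s"
      "\<And>z. z \<in> cball 0 s - {0::complex} \<Longrightarrow> (\<lambda>x. 0 :: complex) z \<noteq> 0"
      using powser_0_nonzero[of 1 0 a "\<lambda>x. 0" n] \<open>a n \<noteq> 0\<close> Suc by auto
    moreover have "complex_of_real s \<in> cball 0 s - {0}" using \<open>0 < s\<close> by simp
    ultimately show False by blast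
  qed
qed

lemma powser_coeff_unique:
  fixes c d :: "nat \<Rightarrow> 'a::complex_inner"
  assumes "\<And>z. z \<in> ball 0 1 \<Longrightarrow> (\<lambda>n. z ^ n *\<^sub>C c n) sums F z"
    and "\<And>z. z \<in> ball 0 1 \<Longrightarrow> (\<lambda>n. z ^ n *\<^sub>C d n) sums F z"
  shows "c = d"
proof
  fix n
  define e where "e n = c n - d n" for n
  have e: "(\<lambda>n. z ^ n *\<^sub>C e n) sums 0" if "z \<in> ball 0 1" for z
    using sums_diff[OF assms(1)[OF that] assms(2)[OF that]]
    by (simp add: e_def scaleC_diff_right)
  have "cinner (e n) (e n) = 0"
  proof (rule complex_powser_zero_coeff[where a = "\<lambda>k. cinner (e k) (e n)"])
    fix z :: complex assume "z \<in> ball 0 1"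
    from bounded_linear.sums[OF bounded_linear_cinner_left e[OF this], of "e n"]
    show "(\<lambda>k. cinner (e k) (e n) * z ^ k) sums 0"
      by (simp add: cinner_scaleC_left mult.commute
          linear_0[OF bounded_linear.linear[OF bounded_linear_cinner_left]])
  qed
  then have "e n = 0" by (simp add: cinner_self)
  then show "c n = d n" by (simp add: e_def)
qed

lemma
  shows square_summable_hardy_coeff: "square_summable (hardy_coeff f)"
    and hardy_coeff_sums:
      "z \<in> ball 0 1 \<Longrightarrow> (\<lambda>n. z ^ n *\<^sub>C hardy_coeff f n) sums hardy_fun f z"
proof -
  let ?P = "\<lambda>c. square_summable c \<and>
    (\<forall>z\<in>ball 0 1. (\<lambda>n. z ^ n *\<^sub>C c n) sums hardy_fun f z)"
  have "\<exists>c. ?P c" using hardy_fun[of f] by blast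
  moreover have "c = d" if "?P c" "?P d" for c d
    using powser_coeff_unique[of c "hardy_fun f" d] that by blast
  ultimately have "\<exists>!c. ?P c" by blast
  from theI'[OF this] have "?P (hardy_coeff f)"
    unfolding hardy_coeff_def .
  then show "square_summable (hardy_coeff f)"
    "z \<in> ball 0 1 \<Longrightarrow> (\<lambda>n. z ^ n *\<^sub>C hardy_coeff f n) sums hardy_fun f z"
    by blast+
qed

lemma hardy_fun_outside: "z \<notin> ball 0 1 \<Longrightarrow> hardy_fun f z = 0"
  using hardy_fun[of f] by blast

lemma hardy_coeff_eqI:
  assumes "\<And>z. z \<in> ball 0 1 \<Longrightarrow> (\<lambda>n. z ^ n *\<^sub>C c n) sums hardy_fun f z"
  shows "hardy_coeff f = c"
  using powser_coeff_unique[OF hardy_coeff_sums assms] by blast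

lemma hardy_eqI:
  assumes "\<And>z. z \<in> ball 0 1 \<Longrightarrow> hardy_fun f z = hardy_fun g z"
  shows "f = g"
proof -
  have "hardy_fun f z = hardy_fun g z" for z
    using assms by (cases "z \<in> ball 0 1") (simp_all add: hardy_fun_outside)
  then show ?thesis by (simp add: hardy_fun_inject[symmetric] fun_eq_iff)
qed

lemma hardy_eqI_coeff:
  assumes "hardy_coeff f = hardy_coeff g"
  shows "f = g"
proof (rule hardy_eqI)
  fix z :: complex assume "z \<in> ball 0 1"
  then show "hardy_fun f z = hardy_fun g z"
    using hardy_coeff_sums[of z f] hardy_coeff_sums[of z g] sums_unique2
    unfolding assms by blast
qed

lemma hardy_fun_Abs:
  assumes "square_summable c" "\<And>z. z \<in> ball 0 1 \<Longrightarrow> (\<lambda>n. z ^ n *\<^sub>C c n) sums F z"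
    "\<And>z. z \<notin> ball 0 1 \<Longrightarrow> F z = 0"
  shows "hardy_fun (Abs_hardy F) = F"
  using assms by (intro Abs_hardy_inverse) blast

lemma square_summable_add:
  assumes "square_summable c" "square_summable d"
  shows "square_summable (\<lambda>n. c n + d n)"
  unfolding square_summable_def
proof (rule summable_comparison_test')
  show "summable (\<lambda>n. 2 * ((norm (c n))\<^sup>2 + (norm (d n))\<^sup>2))"
    using assms unfolding square_summable_def by (intro summable_mult summable_add)
  fix n :: nat
  have "(norm (c n + d n))\<^sup>2 \<le> (norm (c n) + norm (d n))\<^sup>2"
    by (intro power_mono norm_triangle_ineq) simp
  also have "\<dots> \<le> 2 * ((norm (c n))\<^sup>2 + (norm (d n))\<^sup>2)"
    using sum_squares_bound[of "norm (c n)" "norm (d n)"] by (simp add: power2_sum)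
  finally show "norm ((norm (c n + d n))\<^sup>2) \<le> 2 * ((norm (c n))\<^sup>2 + (norm (d n))\<^sup>2)" by simp
qed

lemma square_summable_scaleC:
  fixes c :: "nat \<Rightarrow> 'a::complex_inner"
  assumes "square_summable c" shows "square_summable (\<lambda>n. a *\<^sub>C c n)"
  using assms summable_mult[of _ "(cmod a)\<^sup>2"]
  by (simp add: square_summable_def norm_scaleC power_mult_distrib)

lemma square_summable_norm_mult:
  assumes "square_summable c" "square_summable d"
  shows "summable (\<lambda>n. norm (c n) * norm (d n))"
proof (rule summable_comparison_test')
  show "summable (\<lambda>n. (norm (c n))\<^sup>2 + (norm (d n))\<^sup>2)"
    using assms unfolding square_summable_def by (intro summable_add)
  fix n :: nat
  have "norm (c n) * norm (d n) \<le> (norm (c n))\<^sup>2 + (norm (d n))\<^sup>2"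
    using sum_squares_bound[of "norm (c n)" "norm (d n)"]
      mult_nonneg_nonneg[OF norm_ge_zero[of "c n"] norm_ge_zero[of "d n"]] by linarith
  then show "norm (norm (c n) * norm (d n)) \<le> (norm (c n))\<^sup>2 + (norm (d n))\<^sup>2"
    by simp
qed

lemma ex_hardy_with_coeff:
  fixes c :: "nat \<Rightarrow> 'a::chilbert_space"
  assumes "square_summable c"
  shows "\<exists>f. hardy_coeff f = c"
proof -
  define F where "F z = (if z \<in> ball 0 1 then \<Sum>n. z ^ n *\<^sub>C c n else 0)" for z
  have F: "(\<lambda>n. z ^ n *\<^sub>C c n) sums F z" if "z \<in> ball 0 1" for z
  proof -
    have "(\<lambda>n. (norm (z ^ n))\<^sup>2) = (\<lambda>n. ((cmod z)\<^sup>2) ^ n)"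
      by (simp add: norm_power flip: power_mult) (simp add: mult.commute)
    moreover have "norm ((cmod z)\<^sup>2) < 1"
      using that by (simp add: abs_square_less_1)
    ultimately have "square_summable (\<lambda>n. z ^ n)"
      unfolding square_summable_def by (simp only: summable_geometric)
    then have "summable (\<lambda>n. norm (z ^ n *\<^sub>C c n))"
      using square_summable_norm_mult[OF _ assms] by (simp add: norm_scaleC)
    then show ?thesis
      using that by (simp add: F_def summable_norm_cancel summable_sums)
  qed
  have "hardy_fun (Abs_hardy F) = F"
    by (rule hardy_fun_Abs[OF assms F]) (simp_all add: F_def)
  then have "hardy_coeff (Abs_hardy F) = c"
    by (intro hardy_coeff_eqI) (simp add: F)
  then show ?thesis ..
qed

instantiation hardy :: (chilbert_space) complex_inner
begin

definition zero_hardy :: "'a hardy" where "zero_hardy = Abs_hardy (\<lambda>z. 0)"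

definition plus_hardy :: "'a hardy \<Rightarrow> 'a hardy \<Rightarrow> 'a hardy"
  where "plus_hardy f g = Abs_hardy (\<lambda>z. hardy_fun f z + hardy_fun g z)"

definition scaleC_hardy :: "complex \<Rightarrow> 'a hardy \<Rightarrow> 'a hardy"
  where "scaleC_hardy a f = Abs_hardy (\<lambda>z. a *\<^sub>C hardy_fun f z)"

definition scaleR_hardy :: "real \<Rightarrow> 'a hardy \<Rightarrow> 'a hardy"
  where "scaleR_hardy r f = complex_of_real r *\<^sub>C f"

definition uminus_hardy :: "'a hardy \<Rightarrow> 'a hardy"
  where "uminus_hardy f = (-1) *\<^sub>C f"

definition minus_hardy :: "'a hardy \<Rightarrow> 'a hardy \<Rightarrow> 'a hardy"
  where "minus_hardy f g = f + (- g)"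

definition cinner_hardy :: "'a hardy \<Rightarrow> 'a hardy \<Rightarrow> complex"
  where "cinner_hardy f g = (\<Sum>n. cinner (hardy_coeff f n) (hardy_coeff g n))"

definition inner_hardy :: "'a hardy \<Rightarrow> 'a hardy \<Rightarrow> real"
  where "inner_hardy f g = (\<Sum>n. hardy_coeff f n \<bullet> hardy_coeff g n)"

definition norm_hardy :: "'a hardy \<Rightarrow> real"
  where "norm_hardy f = sqrt (f \<bullet> f)"

definition sgn_hardy :: "'a hardy \<Rightarrow> 'a hardy"
  where "sgn_hardy f = inverse (norm f) *\<^sub>R f"

definition dist_hardy :: "'a hardy \<Rightarrow> 'a hardy \<Rightarrow> real"
  where "dist_hardy f g = norm (f - g)"

definition uniformity_hardy :: "('a hardy \<times> 'a hardy) filter"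
  where "uniformity_hardy = (INF e\<in>{0<..}. principal {(f, g). dist f g < e})"

definition open_hardy :: "'a hardy set \<Rightarrow> bool"
  where "open_hardy U \<longleftrightarrow> (\<forall>x\<in>U. \<forall>\<^sub>F (x', y) in uniformity. x' = x \<longrightarrow> y \<in> U)"

lemma hardy_fun_add: "hardy_fun (f + g) z = hardy_fun f z + hardy_fun (g :: 'a hardy) z"
proof -
  have "hardy_fun (f + g) = (\<lambda>z. hardy_fun f z + hardy_fun g z)"
    unfolding plus_hardy_def
  proof (rule hardy_fun_Abs[OF square_summable_add
        [OF square_summable_hardy_coeff[of f] square_summable_hardy_coeff[of g]]])
    fix z :: complex assume "z \<in> ball 0 1"
    then show "(\<lambda>n. z ^ n *\<^sub>C (hardy_coeff f n + hardy_coeff g n)) sums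
        (hardy_fun f z + hardy_fun g z)"
      using sums_add[OF hardy_coeff_sums hardy_coeff_sums] by (simp add: scaleC_add_right)
  qed (simp add: hardy_fun_outside)
  then show ?thesis by simp
qed

lemma hardy_fun_scaleC: "hardy_fun (a *\<^sub>C f) z = a *\<^sub>C hardy_fun (f :: 'a hardy) z"
proof -
  have "hardy_fun (a *\<^sub>C f) = (\<lambda>z. a *\<^sub>C hardy_fun f z)"
    unfolding scaleC_hardy_def
  proof (rule hardy_fun_Abs[OF square_summable_scaleC[OF square_summable_hardy_coeff[of f]]])
    fix z :: complex assume "z \<in> ball 0 1"
    from bounded_linear.sums[OF bounded_linear_scaleC hardy_coeff_sums[OF this]]
    show "(\<lambda>n. z ^ n *\<^sub>C (a *\<^sub>C hardy_coeff f n)) sums (a *\<^sub>C hardy_fun f z)"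
      by (simp add: scaleC_scaleC mult.commute)
  qed (simp add: hardy_fun_outside scaleC_zero_right)
  then show ?thesis by simp
qed

lemma hardy_coeff_add:
  "hardy_coeff (f + g) = (\<lambda>n. hardy_coeff f n + hardy_coeff (g :: 'a hardy) n)"
  using sums_add[OF hardy_coeff_sums hardy_coeff_sums]
  by (intro hardy_coeff_eqI) (simp add: hardy_fun_add scaleC_add_right)

lemma hardy_coeff_scaleC:
  "hardy_coeff (a *\<^sub>C f) = (\<lambda>n. a *\<^sub>C hardy_coeff (f :: 'a hardy) n)"
proof (rule hardy_coeff_eqI)
  fix z :: complex assume "z \<in> ball 0 1"
  from bounded_linear.sums[OF bounded_linear_scaleC hardy_coeff_sums[OF this]]
  show "(\<lambda>n. z ^ n *\<^sub>C (a *\<^sub>C hardy_coeff f n)) sums hardy_fun (a *\<^sub>C f) z"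
    by (simp add: scaleC_scaleC mult.commute hardy_fun_scaleC)
qed

lemma hardy_fun_zero: "hardy_fun (0 :: 'a hardy) z = 0"
proof -
  have "hardy_fun (0 :: 'a hardy) = (\<lambda>z. 0)"
    unfolding zero_hardy_def
    by (rule hardy_fun_Abs[of "\<lambda>n. 0"]) (simp_all add: square_summable_def scaleC_zero_right)
  then show ?thesis by simp
qed

lemma hardy_coeff_zero: "hardy_coeff (0 :: 'a hardy) = (\<lambda>n. 0)"
  by (intro hardy_coeff_eqI) (simp add: hardy_fun_zero scaleC_zero_right)

lemma hardy_coeff_scaleR:
  "hardy_coeff (r *\<^sub>R f) = (\<lambda>n. r *\<^sub>R hardy_coeff (f :: 'a hardy) n)"
  by (simp add: scaleR_hardy_def hardy_coeff_scaleC scaleC_complex_of_real)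

lemma hardy_coeff_uminus:
  "hardy_coeff (- f) = (\<lambda>n. - hardy_coeff (f :: 'a hardy) n)"
proof -
  have "(- 1) *\<^sub>C x = - x" for x :: 'a
    using scaleC_complex_of_real[of "-1" x] by simp
  then show ?thesis by (simp add: uminus_hardy_def hardy_coeff_scaleC)
qed

lemma hardy_coeff_minus:
  "hardy_coeff (f - g) = (\<lambda>n. hardy_coeff f n - hardy_coeff (g :: 'a hardy) n)"
  by (simp add: minus_hardy_def hardy_coeff_add hardy_coeff_uminus)

lemma summable_inner_hardy: "summable (\<lambda>n. hardy_coeff f n \<bullet> hardy_coeff (g :: 'a hardy) n)"
  by (rule summable_comparison_test'[OF square_summable_norm_mult
        [OF square_summable_hardy_coeff[of f] square_summable_hardy_coeff[of g]]])
    (simp add: Cauchy_Schwarz_ineq2)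

lemma summable_cinner_hardy:
  "summable (\<lambda>n. cinner (hardy_coeff f n) (hardy_coeff (g :: 'a hardy) n))"
  by (rule summable_comparison_test'[OF square_summable_norm_mult
        [OF square_summable_hardy_coeff[of f] square_summable_hardy_coeff[of g]]])
    (simp add: cmod_cinner_le)

instance
proof
  fix a b :: complex and r s :: real and x y z :: "'a hardy"
  note coeff = hardy_coeff_add hardy_coeff_scaleC hardy_coeff_zero hardy_coeff_scaleR
    hardy_coeff_uminus hardy_coeff_minus
  show "x + y + z = x + (y + z)"
    by (rule hardy_eqI_coeff) (simp add: coeff algebra_simps)
  show "x + y = y + x"
    by (rule hardy_eqI_coeff) (simp add: coeff algebra_simps)
  show "0 + x = x"
    by (rule hardy_eqI_coeff) (simp add: coeff)
  show "- x + x = 0"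
    by (rule hardy_eqI_coeff) (simp add: coeff)
  show "x - y = x + - y" by (simp add: minus_hardy_def)
  show "r *\<^sub>R (x + y) = r *\<^sub>R x + r *\<^sub>R y"
    by (rule hardy_eqI_coeff) (simp add: coeff algebra_simps)
  show "(r + s) *\<^sub>R x = r *\<^sub>R x + s *\<^sub>R x"
    by (rule hardy_eqI_coeff) (simp add: coeff algebra_simps)
  show "r *\<^sub>R s *\<^sub>R x = (r * s) *\<^sub>R x"
    by (rule hardy_eqI_coeff) (simp add: coeff)
  show "1 *\<^sub>R x = x"
    by (rule hardy_eqI_coeff) (simp add: coeff)
  show "sgn x = inverse (norm x) *\<^sub>R x" by (simp add: sgn_hardy_def)
  show "dist x y = norm (x - y)" by (simp add: dist_hardy_def)
  show "uniformity = (INF e\<in>{0<..}. principal {(f :: 'a hardy, g). dist f g < e})"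
    by (simp add: uniformity_hardy_def)
  show "open U \<longleftrightarrow> (\<forall>x\<in>U. \<forall>\<^sub>F (x', y) in uniformity. x' = x \<longrightarrow> y \<in> U)"
    for U :: "'a hardy set"
    by (simp add: open_hardy_def)
  show "x \<bullet> y = y \<bullet> x" by (simp add: inner_hardy_def inner_commute)
  show "(x + y) \<bullet> z = x \<bullet> z + y \<bullet> z"
    by (simp add: inner_hardy_def coeff inner_add_left suminf_add summable_inner_hardy)
  show "(r *\<^sub>R x) \<bullet> y = r * (x \<bullet> y)"
    by (simp add: inner_hardy_def coeff suminf_mult summable_inner_hardy)
  show "0 \<le> x \<bullet> x"
    by (simp add: inner_hardy_def suminf_nonneg summable_inner_hardy)
  show "x \<bullet> x = 0 \<longleftrightarrow> x = 0"
  proof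
    assume "x \<bullet> x = 0"
    then have "hardy_coeff x = (\<lambda>n. 0)"
      by (auto simp: inner_hardy_def suminf_eq_zero_iff summable_inner_hardy fun_eq_iff)
    then show "x = 0" by (intro hardy_eqI_coeff) (simp add: coeff)
  qed (simp add: inner_hardy_def coeff)
  show "norm x = sqrt (x \<bullet> x)" by (simp add: norm_hardy_def)
  show "a *\<^sub>C (x + y) = a *\<^sub>C x + a *\<^sub>C y"
    by (rule hardy_eqI_coeff) (simp add: coeff scaleC_add_right)
  show "(a + b) *\<^sub>C x = a *\<^sub>C x + b *\<^sub>C x"
    by (rule hardy_eqI_coeff) (simp add: coeff scaleC_add_left)
  show "a *\<^sub>C b *\<^sub>C x = (a * b) *\<^sub>C x"
    by (rule hardy_eqI_coeff) (simp add: coeff scaleC_scaleC)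
  show "complex_of_real r *\<^sub>C x = r *\<^sub>R x" by (simp add: scaleR_hardy_def)
  show "cinner x y = cnj (cinner y x)"
  proof -
    have "(\<lambda>n. cnj (cinner (hardy_coeff y n) (hardy_coeff x n))) sums cnj (cinner y x)"
      unfolding cinner_hardy_def
      by (intro bounded_linear.sums[OF bounded_linear_cnj] summable_sums summable_cinner_hardy)
    moreover have "cnj (cinner (hardy_coeff y n) (hardy_coeff x n)) =
        cinner (hardy_coeff x n) (hardy_coeff y n)" for n
      by (rule cinner_commute[symmetric])
    ultimately show ?thesis
      unfolding cinner_hardy_def by (simp add: sums_iff)
  qed
  show "cinner (x + y) z = cinner x z + cinner y z"
    by (simp add: cinner_hardy_def coeff cinner_add_left suminf_add summable_cinner_hardy)
  show "cinner (a *\<^sub>C x) y = a * cinner x y"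
    by (simp add: cinner_hardy_def coeff cinner_scaleC_left suminf_mult summable_cinner_hardy)
  show "Re (cinner x y) = x \<bullet> y"
  proof -
    have "(\<lambda>n. Re (cinner (hardy_coeff x n) (hardy_coeff y n))) sums Re (cinner x y)"
      unfolding cinner_hardy_def
      by (intro bounded_linear.sums[OF bounded_linear_Re] summable_sums summable_cinner_hardy)
    then show ?thesis
      by (simp add: inner_hardy_def Re_cinner sums_iff)
  qed
qed

end

lemma norm_hardy_sums:
  "(\<lambda>n. (norm (hardy_coeff f n))\<^sup>2) sums (norm (f :: 'a::chilbert_space hardy))\<^sup>2"
proof -
  have "(norm f)\<^sup>2 = (\<Sum>n. hardy_coeff f n \<bullet> hardy_coeff f n)"
    by (simp add: power2_norm_eq_inner inner_hardy_def)
  then show ?thesis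
    using summable_inner_hardy[of f f] by (simp add: power2_norm_eq_inner summable_sums)
qed

lemma sum_coeff_le_norm:
  "(\<Sum>n<N. (norm (hardy_coeff f n))\<^sup>2) \<le> (norm (f :: 'a::chilbert_space hardy))\<^sup>2"
  unfolding sums_unique[OF norm_hardy_sums]
  by (rule sum_le_suminf[OF sums_summable[OF norm_hardy_sums]]) simp_all

lemma norm_hardy_coeff_le: "norm (hardy_coeff f n) \<le> norm (f :: 'a::chilbert_space hardy)"
proof -
  have "(norm (hardy_coeff f n))\<^sup>2 \<le> (\<Sum>k<Suc n. (norm (hardy_coeff f k))\<^sup>2)"
    by (rule member_le_sum) auto
  also have "\<dots> \<le> (norm f)\<^sup>2" by (rule sum_coeff_le_norm)
  finally show ?thesis by (simp add: power2_le_iff_abs_le)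
qed

instance hardy :: (chilbert_space) chilbert_space
proof
  fix X :: "nat \<Rightarrow> 'a hardy" assume X: "Cauchy X"
  define c where "c n = lim (\<lambda>k. hardy_coeff (X k) n)" for n
  have "Cauchy (\<lambda>k. hardy_coeff (X k) n)" for n
    unfolding Cauchy_def
  proof (intro allI impI)
    fix e :: real assume "e > 0"
    then obtain M where M: "\<forall>m\<ge>M. \<forall>k\<ge>M. dist (X m) (X k) < e" using X unfolding Cauchy_def by blast
    have "dist (hardy_coeff (X m) n) (hardy_coeff (X k) n) \<le> dist (X m) (X k)" for m k
      using norm_hardy_coeff_le[of "X m - X k" n] by (simp add: dist_norm hardy_coeff_minus)
    then show "\<exists>M. \<forall>m\<ge>M. \<forall>k\<ge>M. dist (hardy_coeff (X m) n) (hardy_coeff (X k) n) < e"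
      using M by (meson le_less_trans)
  qed
  then have c: "(\<lambda>k. hardy_coeff (X k) n) \<longlonglongrightarrow> c n" for n
    unfolding c_def by (intro convergent_LIMSEQ_iff[THEN iffD1] Cauchy_convergent)
  have key: "\<exists>M. \<forall>k\<ge>M. \<forall>N. (\<Sum>n<N. (norm (hardy_coeff (X k) n - c n))\<^sup>2) \<le> e\<^sup>2"
    if "e > 0" for e :: real
  proof -
    obtain M where M: "\<forall>m\<ge>M. \<forall>k\<ge>M. dist (X m) (X k) < e"
      using X \<open>e > 0\<close> unfolding Cauchy_def by blast
    have "(\<Sum>n<N. (norm (hardy_coeff (X k) n - c n))\<^sup>2) \<le> e\<^sup>2" if "k \<ge> M" for k N
    proof (rule tendsto_upperbound)
      show "(\<lambda>m. \<Sum>n<N. (norm (hardy_coeff (X k) n - hardy_coeff (X m) n))\<^sup>2)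
          \<longlonglongrightarrow> (\<Sum>n<N. (norm (hardy_coeff (X k) n - c n))\<^sup>2)"
        by (intro tendsto_intros c)
      have "(\<Sum>n<N. (norm (hardy_coeff (X k) n - hardy_coeff (X m) n))\<^sup>2) \<le> e\<^sup>2" if "m \<ge> M" for m
      proof -
        have "norm (X k - X m) < e" using M \<open>k \<ge> M\<close> that by (simp add: dist_norm)
        then have "(norm (X k - X m))\<^sup>2 \<le> e\<^sup>2" by (intro power_mono) auto
        then show ?thesis
          using sum_coeff_le_norm[of "X k - X m" N] by (simp add: hardy_coeff_minus)
      qed
      then show "\<forall>\<^sub>F m in sequentially.
          (\<Sum>n<N. (norm (hardy_coeff (X k) n - hardy_coeff (X m) n))\<^sup>2) \<le> e\<^sup>2"
        unfolding eventually_sequentially by blast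
    qed simp
    then show ?thesis by blast
  qed
  have "square_summable c"
  proof -
    obtain k where k: "\<And>N. (\<Sum>n<N. (norm (hardy_coeff (X k) n - c n))\<^sup>2) \<le> 1\<^sup>2"
      using key[of 1] by auto
    have "square_summable (\<lambda>n. hardy_coeff (X k) n - c n)"
      unfolding square_summable_def by (rule bounded_imp_summable[of _ 1]) (use k[of "Suc _"] in \<open>simp_all add: lessThan_Suc_atMost\<close>)
    then have "square_summable (\<lambda>n. hardy_coeff (X k) n + (-1) *\<^sub>C (hardy_coeff (X k) n - c n))"
      by (intro square_summable_add square_summable_scaleC square_summable_hardy_coeff)
    moreover have "(- 1) *\<^sub>C x = - x" for x :: 'a
      using scaleC_complex_of_real[of "-1" x] by simp
    ultimately show ?thesis by simp
  qed
  then obtain f where f: "hardy_coeff f = c" using ex_hardy_with_coeff by blast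
  have "X \<longlonglongrightarrow> f"
  proof (rule LIMSEQ_I)
    fix e :: real assume "e > 0"
    then obtain M where M: "\<And>k N. k \<ge> M \<Longrightarrow>
        (\<Sum>n<N. (norm (hardy_coeff (X k) n - c n))\<^sup>2) \<le> (e/2)\<^sup>2"
      using key[of "e/2"] by auto
    have "norm (X k - f) < e" if "k \<ge> M" for k
    proof -
      have "(norm (X k - f))\<^sup>2 \<le> (e/2)\<^sup>2"
        using norm_hardy_sums[of "X k - f"] M[OF that]
          suminf_le_const[of "\<lambda>n. (norm (hardy_coeff (X k - f) n))\<^sup>2" "(e/2)\<^sup>2"]
        by (simp add: hardy_coeff_minus f sums_iff)
      then have "norm (X k - f) \<le> e/2" using \<open>e > 0\<close> by (simp add: power2_le_iff_abs_le)
      then show ?thesis using \<open>e > 0\<close> by simp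
    qed
    then show "\<exists>M. \<forall>k\<ge>M. norm (X k - f) < e" by blast
  qed
  then show "convergent X" by (rule convergentI)
qed


definition hardy_space :: "'a::chilbert_space set \<Rightarrow> 'a hardy set"
  where "hardy_space Y = {f. \<forall>z\<in>ball 0 1. hardy_fun f z \<in> Y}"


section \<open>Operators between closed subspaces\<close>

text \<open>
  The spaces that depend on operators (defect spaces, kernels, their direct sums and Hardy spaces)
  are closed subspaces \<open>M\<close>, \<open>N\<close>, \dots of ambient types; a Hilbert space that is given outright
  is \<open>UNIV\<close>. An operator from \<open>M\<close> to \<open>N\<close> is a function between the ambient types of which
  only the values on \<open>M\<close> matter; accordingly the canonical embedding of \<open>M\<close> into the ambient
  space is not written. Operators that are characterised by a property and hence obtained by
  \<open>THE\<close> are made unique by requiring them to be \<open>extensional\<close>, which is no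
  restriction if the domain is \<open>UNIV\<close>.
\<close>

definition closed_csubspace :: "'a::chilbert_space set \<Rightarrow> bool"
  where "closed_csubspace M \<longleftrightarrow> subspace M \<and> (\<forall>a. \<forall>x\<in>M. a *\<^sub>C x \<in> M) \<and> closed M"

definition bounded_operator ::
    "'a::chilbert_space set \<Rightarrow> 'b::chilbert_space set \<Rightarrow> ('a \<Rightarrow> 'b) \<Rightarrow> bool"
  where "bounded_operator M N F \<longleftrightarrow> F \<in> M \<rightarrow> N \<and>
    (\<forall>x\<in>M. \<forall>y\<in>M. F (x + y) = F x + F y) \<and>
    (\<forall>a. \<forall>x\<in>M. F (a *\<^sub>C x) = a *\<^sub>C F x) \<and>
    (\<exists>c. \<forall>x\<in>M. norm (F x) \<le> c * norm x)"

definition contraction ::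
    "'a::chilbert_space set \<Rightarrow> 'b::chilbert_space set \<Rightarrow> ('a \<Rightarrow> 'b) \<Rightarrow> bool"
  where "contraction M N F \<longleftrightarrow> bounded_operator M N F \<and> (\<forall>x\<in>M. norm (F x) \<le> norm x)"

definition orth_proj :: "'a::chilbert_space set \<Rightarrow> 'a \<Rightarrow> 'a"
  where "orth_proj M x = (THE y. y \<in> M \<and> (\<forall>z\<in>M. cinner (x - y) z = 0))"

definition adjoint_on ::
    "'a::chilbert_space set \<Rightarrow> 'b::chilbert_space set \<Rightarrow> ('a \<Rightarrow> 'b) \<Rightarrow> 'b \<Rightarrow> 'a"
  where "adjoint_on M N F = (THE G. bounded_operator N M G \<and> G \<in> extensional N \<and>
    (\<forall>x\<in>M. \<forall>y\<in>N. cinner (F x) y = cinner x (G y)))"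

abbreviation adj :: "('a::chilbert_space \<Rightarrow> 'b::chilbert_space) \<Rightarrow> 'b \<Rightarrow> 'a"
    (\<open>_\<^sup>\<dagger>\<close> [1000] 1000)
  where "F\<^sup>\<dagger> \<equiv> adjoint_on UNIV UNIV F"

definition positive_on :: "'a::chilbert_space set \<Rightarrow> ('a \<Rightarrow> 'a) \<Rightarrow> bool"
  where "positive_on M F \<longleftrightarrow> bounded_operator M M F \<and> (\<forall>x\<in>M. cinner (F x) x \<in> \<real>\<^sub>\<ge>\<^sub>0)"

definition sqrt_on :: "'a::chilbert_space set \<Rightarrow> ('a \<Rightarrow> 'a) \<Rightarrow> 'a \<Rightarrow> 'a"
  where "sqrt_on M F =
    (THE S. positive_on M S \<and> S \<in> extensional M \<and> (\<forall>x\<in>M. S (S x) = F x))"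

definition invertible_on :: "'a::chilbert_space set \<Rightarrow> ('a \<Rightarrow> 'a) \<Rightarrow> bool"
  where "invertible_on M F \<longleftrightarrow> bounded_operator M M F \<and> bij_betw F M M \<and>
    bounded_operator M M (inv_into M F)"

definition positive_definite_on :: "'a::chilbert_space set \<Rightarrow> ('a \<Rightarrow> 'a) \<Rightarrow> bool"
  where "positive_definite_on M F \<longleftrightarrow> positive_on M F \<and> invertible_on M F"

definition inv_sqrt_on :: "'a::chilbert_space set \<Rightarrow> ('a \<Rightarrow> 'a) \<Rightarrow> 'a \<Rightarrow> 'a"
  where "inv_sqrt_on M F = inv_into M (sqrt_on M F)"

definition defect :: "('a::chilbert_space \<Rightarrow> 'b::chilbert_space) \<Rightarrow> 'a \<Rightarrow> 'a"
  where "defect C = sqrt_on UNIV (\<lambda>x. x - C\<^sup>\<dagger> (C x))"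

definition defect_space :: "('a::chilbert_space \<Rightarrow> 'b::chilbert_space) \<Rightarrow> 'a set"
  where "defect_space C = closure (range (defect C))"

definition ker_adj :: "('a::chilbert_space \<Rightarrow> 'b::chilbert_space) \<Rightarrow> 'b set"
  where "ker_adj F = {x. F\<^sup>\<dagger> x = 0}"


section \<open>Operator-valued functions on the disc\<close>

text \<open>
  Analyticity is complex differentiability in the operator norm. Operator-valued functions are
  total on the complex numbers, and only their values on the unit disc matter.
\<close>

definition operator_analytic :: "'a::chilbert_space set \<Rightarrow> 'b::chilbert_space set \<Rightarrow>
    (complex \<Rightarrow> 'a \<Rightarrow> 'b) \<Rightarrow> bool"
  where "operator_analytic U Y V \<longleftrightarrow>
    (\<forall>z\<in>ball 0 1. \<exists>L. bounded_operator U Y L \<and>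
      (\<forall>e>0. \<exists>d>0. \<forall>w\<in>ball 0 1. w \<noteq> z \<and> cmod (w - z) < d \<longrightarrow>
        (\<forall>u\<in>U. norm ((1 / (w - z)) *\<^sub>C (V w u - V z u) - L u) \<le> e * norm u)))"

definition schur_class :: "'a::chilbert_space set \<Rightarrow> 'b::chilbert_space set \<Rightarrow>
    (complex \<Rightarrow> 'a \<Rightarrow> 'b) set"
  where "schur_class U Y =
    {V. operator_analytic U Y V \<and> (\<forall>z\<in>ball 0 1. contraction U Y (V z))}"

definition operator_hardy_class :: "'a::chilbert_space set \<Rightarrow> 'b::chilbert_space set \<Rightarrow>
    (complex \<Rightarrow> 'a \<Rightarrow> 'b) set"
  where "operator_hardy_class U Y =
    {F. (\<forall>z\<in>ball 0 1. bounded_operator U Y (F z)) \<and>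
        (\<forall>u\<in>U. \<exists>f\<in>hardy_space Y. \<forall>z\<in>ball 0 1. hardy_fun f z = F z u)}"


section \<open>Lifting data sets and interpolants\<close>

text \<open>
  The inclusion of \<open>H'\<close> in \<open>K'\<close> is an isometric embedding \<open>i\<close> into the closed subspace \<open>K\<close> of an
  ambient type; its adjoint is the orthogonal projection of \<open>K'\<close> onto \<open>H'\<close>.
\<close>

definition minimal_isometric_lifting :: "'c::chilbert_space set \<Rightarrow> ('k::chilbert_space \<Rightarrow> 'c) \<Rightarrow>
    ('k \<Rightarrow> 'k) \<Rightarrow> ('c \<Rightarrow> 'c) \<Rightarrow> bool"
  where "minimal_isometric_lifting K i T' U' \<longleftrightarrow>
    closed_csubspace K \<and>
    bounded_operator UNIV K i \<and> (\<forall>h. norm (i h) = norm h) \<and>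
    bounded_operator K K U' \<and> (\<forall>x\<in>K. norm (U' x) = norm x) \<and>
    (\<forall>x\<in>K. adjoint_on UNIV K i (U' x) = T' (adjoint_on UNIV K i x)) \<and>
    K = closed_csubspace hull (\<Union>n. (U' ^^ n) ` range i)"

definition lifting_data_set :: "'c::chilbert_space set \<Rightarrow> ('k::chilbert_space \<Rightarrow> 'c) \<Rightarrow>
    ('h::chilbert_space \<Rightarrow> 'k) \<Rightarrow> ('k \<Rightarrow> 'k) \<Rightarrow> ('c \<Rightarrow> 'c) \<Rightarrow>
    ('z::chilbert_space \<Rightarrow> 'h) \<Rightarrow> ('z \<Rightarrow> 'h) \<Rightarrow> bool"
  where "lifting_data_set K i A T' U' R Q \<longleftrightarrow>
    contraction UNIV UNIV A \<and> contraction UNIV UNIV T' \<and>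
    minimal_isometric_lifting K i T' U' \<and>
    bounded_operator UNIV UNIV R \<and> bounded_operator UNIV UNIV Q \<and>
    (\<forall>x. T' (A (R x)) = A (Q x)) \<and>
    positive_on UNIV (\<lambda>x. Q\<^sup>\<dagger> (Q x) - R\<^sup>\<dagger> (R x))"

definition contractive_interpolant :: "'c::chilbert_space set \<Rightarrow> ('k::chilbert_space \<Rightarrow> 'c) \<Rightarrow>
    ('h::chilbert_space \<Rightarrow> 'k) \<Rightarrow> ('c \<Rightarrow> 'c) \<Rightarrow>
    ('z::chilbert_space \<Rightarrow> 'h) \<Rightarrow> ('z \<Rightarrow> 'h) \<Rightarrow> ('h \<Rightarrow> 'c) \<Rightarrow> bool"
  where "contractive_interpolant K i A U' R Q B \<longleftrightarrow>
    contraction UNIV K B \<and>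
    (\<forall>h. adjoint_on UNIV K i (B h) = A h) \<and>
    (\<forall>x. U' (B (R x)) = B (Q x))"

definition sz_nagy_schaeffer_space :: "('k::chilbert_space \<Rightarrow> 'k) \<Rightarrow> ('k \<times> 'k hardy) set"
  where "sz_nagy_schaeffer_space T' = UNIV \<times> hardy_space (defect_space T')"

definition sz_nagy_schaeffer_embedding :: "'k::chilbert_space \<Rightarrow> 'k \<times> 'k hardy"
  where "sz_nagy_schaeffer_embedding h = (h, 0)"

definition sz_nagy_schaeffer ::
    "('k::chilbert_space \<Rightarrow> 'k) \<Rightarrow> 'k \<times> 'k hardy \<Rightarrow> 'k \<times> 'k hardy"
  where "sz_nagy_schaeffer T' = (\<lambda>(h, f).
    (T' h, THE g. \<forall>z\<in>ball 0 1. hardy_fun g z = defect T' h + z *\<^sub>C hardy_fun f z))"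


section \<open>The coefficient functions\<close>

definition D_circ :: "('z::chilbert_space \<Rightarrow> 'h::chilbert_space) \<Rightarrow> ('z \<Rightarrow> 'h) \<Rightarrow> 'z \<Rightarrow> 'z"
  where "D_circ R Q = sqrt_on UNIV (\<lambda>x. Q\<^sup>\<dagger> (Q x) - R\<^sup>\<dagger> (R x))"

definition D_circ_space :: "('z::chilbert_space \<Rightarrow> 'h::chilbert_space) \<Rightarrow> ('z \<Rightarrow> 'h) \<Rightarrow> 'z set"
  where "D_circ_space R Q = closure (range (D_circ R Q))"

definition D2 :: "('h::chilbert_space \<Rightarrow> 'k::chilbert_space) \<Rightarrow> 'h \<Rightarrow> 'h"
  where "D2 A = defect A \<circ> defect A"

text \<open>\<open>S\<^sup>* D\<^sub>A\<^sup>2 S\<close>, needed for \<open>S = R\<close> and for \<open>S = Q\<close>.\<close>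

definition D2_conj :: "('h::chilbert_space \<Rightarrow> 'k::chilbert_space) \<Rightarrow>
    ('z::chilbert_space \<Rightarrow> 'h) \<Rightarrow> 'z \<Rightarrow> 'z"
  where "D2_conj A S = (\<lambda>x. S\<^sup>\<dagger> (D2 A (S x)))"

text \<open>\<open>\<Delta>\<^sub>S\<close> on \<open>ker S\<^sup>*\<close>, needed for \<open>S = R\<close> and for \<open>S = Q\<close>.\<close>

definition Delta :: "('h::chilbert_space \<Rightarrow> 'k::chilbert_space) \<Rightarrow>
    ('z::chilbert_space \<Rightarrow> 'h) \<Rightarrow> 'h \<Rightarrow> 'h"
  where "Delta A S = (\<lambda>x. orth_proj (ker_adj S) (inv (D2 A) x))"

definition defect_sum :: "('k::chilbert_space \<Rightarrow> 'k) \<Rightarrow>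
    ('z::chilbert_space \<Rightarrow> 'h::chilbert_space) \<Rightarrow> ('z \<Rightarrow> 'h) \<Rightarrow> ('z \<times> 'k) set"
  where "defect_sum T' R Q = D_circ_space R Q \<times> defect_space T'"

definition parameter_space :: "('k::chilbert_space \<Rightarrow> 'k) \<Rightarrow>
    ('z::chilbert_space \<Rightarrow> 'h::chilbert_space) \<Rightarrow> ('z \<Rightarrow> 'h) \<Rightarrow> ('z \<times> 'k \<times> 'h) set"
  where "parameter_space T' R Q = D_circ_space R Q \<times> defect_space T' \<times> ker_adj R"

definition J_op :: "('h::chilbert_space \<Rightarrow> 'k::chilbert_space) \<Rightarrow> ('k \<Rightarrow> 'k) \<Rightarrow>
    ('z::chilbert_space \<Rightarrow> 'h) \<Rightarrow> ('z \<Rightarrow> 'h) \<Rightarrow> 'z \<Rightarrow> 'z \<times> 'k"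
  where "J_op A T' R Q = (\<lambda>x. (D_circ R Q x, defect T' (A (R x))))"

definition J_adj :: "('h::chilbert_space \<Rightarrow> 'k::chilbert_space) \<Rightarrow> ('k \<Rightarrow> 'k) \<Rightarrow>
    ('z::chilbert_space \<Rightarrow> 'h) \<Rightarrow> ('z \<Rightarrow> 'h) \<Rightarrow> 'z \<times> 'k \<Rightarrow> 'z"
  where "J_adj A T' R Q = adjoint_on UNIV (defect_sum T' R Q) (J_op A T' R Q)"

definition Delta_Omega :: "('h::chilbert_space \<Rightarrow> 'k::chilbert_space) \<Rightarrow> ('k \<Rightarrow> 'k) \<Rightarrow>
    ('z::chilbert_space \<Rightarrow> 'h) \<Rightarrow> ('z \<Rightarrow> 'h) \<Rightarrow> 'z \<times> 'k \<Rightarrow> 'z \<times> 'k"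
  where "Delta_Omega A T' R Q =
    (\<lambda>p. p + J_op A T' R Q (inv (D2_conj A R) (J_adj A T' R Q p)))"

definition X1 :: "('h::chilbert_space \<Rightarrow> 'k::chilbert_space) \<Rightarrow>
    ('z::chilbert_space \<Rightarrow> 'h) \<Rightarrow> ('z \<Rightarrow> 'h) \<Rightarrow> 'h \<Rightarrow> 'h"
  where "X1 A R Q = (\<lambda>h. R (inv (D2_conj A Q) (Q\<^sup>\<dagger> (D2 A h))))"

definition X2 :: "('h::chilbert_space \<Rightarrow> 'k::chilbert_space) \<Rightarrow> ('k \<Rightarrow> 'k) \<Rightarrow>
    ('z::chilbert_space \<Rightarrow> 'h) \<Rightarrow> ('z \<Rightarrow> 'h) \<Rightarrow> 'z \<times> 'k \<times> 'h \<Rightarrow> 'h"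
  where "X2 A T' R Q = (\<lambda>(d, t, k).
    - R (inv (D2_conj A R)
        (J_adj A T' R Q (inv_sqrt_on (defect_sum T' R Q) (Delta_Omega A T' R Q) (d, t))))
    - inv (D2 A) (inv_sqrt_on (ker_adj R) (Delta A R) k))"

definition X3 :: "('h::chilbert_space \<Rightarrow> 'k::chilbert_space) \<Rightarrow>
    ('z::chilbert_space \<Rightarrow> 'h) \<Rightarrow> 'h \<Rightarrow> 'h"
  where "X3 A Q = (\<lambda>h. inv_sqrt_on (ker_adj Q) (Delta A Q) (orth_proj (ker_adj Q) h))"

definition X4 :: "('h::chilbert_space \<Rightarrow> 'k::chilbert_space) \<Rightarrow> ('k \<Rightarrow> 'k) \<Rightarrow>
    ('z::chilbert_space \<Rightarrow> 'h) \<Rightarrow> ('z \<Rightarrow> 'h) \<Rightarrow> 'h \<Rightarrow> 'k"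
  where "X4 A T' R Q =
    (\<lambda>h. defect T' (A (R (inv (D2_conj A Q) (Q\<^sup>\<dagger> (D2 A h))))))"

definition X5 :: "('h::chilbert_space \<Rightarrow> 'k::chilbert_space) \<Rightarrow> ('k \<Rightarrow> 'k) \<Rightarrow>
    ('z::chilbert_space \<Rightarrow> 'h) \<Rightarrow> ('z \<Rightarrow> 'h) \<Rightarrow> 'z \<times> 'k \<times> 'h \<Rightarrow> 'k"
  where "X5 A T' R Q = (\<lambda>(d, t, k).
    snd (inv_sqrt_on (defect_sum T' R Q) (Delta_Omega A T' R Q) (d, t)))"

definition I_minus_zX1 :: "('h::chilbert_space \<Rightarrow> 'k::chilbert_space) \<Rightarrow>
    ('z::chilbert_space \<Rightarrow> 'h) \<Rightarrow> ('z \<Rightarrow> 'h) \<Rightarrow> complex \<Rightarrow> 'h \<Rightarrow> 'h"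
  where "I_minus_zX1 A R Q z = (\<lambda>h. h - z *\<^sub>C X1 A R Q h)"

definition Phi11 :: "('h::chilbert_space \<Rightarrow> 'k::chilbert_space) \<Rightarrow> ('k \<Rightarrow> 'k) \<Rightarrow>
    ('z::chilbert_space \<Rightarrow> 'h) \<Rightarrow> ('z \<Rightarrow> 'h) \<Rightarrow> complex \<Rightarrow> 'z \<times> 'k \<times> 'h \<Rightarrow> 'h"
  where "Phi11 A T' R Q z = (\<lambda>p. z *\<^sub>C X3 A Q (inv (I_minus_zX1 A R Q z) (X2 A T' R Q p)))"

definition Phi12 :: "('h::chilbert_space \<Rightarrow> 'k::chilbert_space) \<Rightarrow>
    ('z::chilbert_space \<Rightarrow> 'h) \<Rightarrow> ('z \<Rightarrow> 'h) \<Rightarrow> complex \<Rightarrow> 'h \<Rightarrow> 'h"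
  where "Phi12 A R Q z = (\<lambda>h. X3 A Q (inv (I_minus_zX1 A R Q z) h))"

definition Phi21 :: "('h::chilbert_space \<Rightarrow> 'k::chilbert_space) \<Rightarrow> ('k \<Rightarrow> 'k) \<Rightarrow>
    ('z::chilbert_space \<Rightarrow> 'h) \<Rightarrow> ('z \<Rightarrow> 'h) \<Rightarrow> complex \<Rightarrow> 'z \<times> 'k \<times> 'h \<Rightarrow> 'k"
  where "Phi21 A T' R Q z = (\<lambda>p. X5 A T' R Q p +
    z *\<^sub>C X4 A T' R Q (inv (I_minus_zX1 A R Q z) (X2 A T' R Q p)))"

definition Phi22 :: "('h::chilbert_space \<Rightarrow> 'k::chilbert_space) \<Rightarrow> ('k \<Rightarrow> 'k) \<Rightarrow>
    ('z::chilbert_space \<Rightarrow> 'h) \<Rightarrow> ('z \<Rightarrow> 'h) \<Rightarrow> complex \<Rightarrow> 'h \<Rightarrow> 'k"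
  where "Phi22 A T' R Q z = (\<lambda>h. X4 A T' R Q (inv (I_minus_zX1 A R Q z) h))"

definition I_minus_Phi11_V :: "('h::chilbert_space \<Rightarrow> 'k::chilbert_space) \<Rightarrow> ('k \<Rightarrow> 'k) \<Rightarrow>
    ('z::chilbert_space \<Rightarrow> 'h) \<Rightarrow> ('z \<Rightarrow> 'h) \<Rightarrow> (complex \<Rightarrow> 'h \<Rightarrow> 'z \<times> 'k \<times> 'h) \<Rightarrow>
    complex \<Rightarrow> 'h \<Rightarrow> 'h"
  where "I_minus_Phi11_V A T' R Q V z = (\<lambda>x. x - Phi11 A T' R Q z (V z x))"

definition gamma_formula :: "('h::chilbert_space \<Rightarrow> 'k::chilbert_space) \<Rightarrow> ('k \<Rightarrow> 'k) \<Rightarrow>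
    ('z::chilbert_space \<Rightarrow> 'h) \<Rightarrow> ('z \<Rightarrow> 'h) \<Rightarrow> (complex \<Rightarrow> 'h \<Rightarrow> 'z \<times> 'k \<times> 'h) \<Rightarrow>
    ('h \<Rightarrow> 'k hardy) \<Rightarrow> bool"
  where "gamma_formula A T' R Q V \<Gamma> \<longleftrightarrow> (\<forall>h. \<forall>z\<in>ball 0 1.
    hardy_fun (\<Gamma> h) z = Phi22 A T' R Q z h +
      Phi21 A T' R Q z (V z
        (inv_into (ker_adj Q) (I_minus_Phi11_V A T' R Q V z) (Phi12 A R Q z h))))"

end

theory Submission
  imports Defs
begin

text \<open>
  Give \<open>H\<close> the equivalent norm \<open>norm (D h)\<close> with \<open>D\<close> the defect operator of \<open>A\<close>. In this norm
  \<open>Q x \<mapsto> (J x, R x)\<close> is isometric, and \<open>X1, \<dots>, X5\<close> complete it to a unitary operator which maps a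
  state \<open>h\<close> and an input \<open>u\<close> to the new state \<open>X1 h + X2 u\<close>, the outputs \<open>X3 h\<close> and \<open>X4 h + X5 u\<close>, and a
  component in the closed range of \<open>D_circ\<close>. The functions \<open>Phi11, \<dots>, Phi22\<close> are the transfer functions of
  this linear system, and \<open>(\<Gamma> h)(z)\<close> is its output for the initial state \<open>h\<close> under the feedback \<open>u = V e\<close>,
  \<open>e = X3 h\<close>.

  For a Schur function \<open>V\<close>, the pointwise energy balance is integrated over circles; this gives
  \<open>norm (\<Gamma> h) \<le> norm (D h)\<close>, so that \<open>(A, \<Gamma>)\<close> is a contraction, and the interpolation condition holds because
  a state trajectory started at \<open>Q x\<close> is the delayed trajectory started at \<open>R x\<close>. Conversely, an interpolant
  embeds \<open>H\<close> isometrically into the state space of a contractive realisation built from the backward shift,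
  and the orthogonal complement of the embedded copy of \<open>H\<close> is the state space of a realisation of \<open>V\<close>.
\<close>

section \<open>Complex inner products and closed subspaces\<close>

text \<open>The weight \<open>D\<close> comes from subtracting balances: the excess of
  \<open>norm (Q x)\<close> over \<open>norm (R x)\<close> is carried by \<open>D_circ\<close>, the
  difference between \<open>A (R x)\<close> and \<open>A (Q x)\<close> by the defect of
  \<open>T'\<close>. Strictness of \<open>A\<close> makes the weighted norm equivalent to the given
  one, but \<open>X1\<close>, a contraction for the former, is only power bounded for the latter.
  The inverse square roots normalise the remaining rows and columns of the coupling.

  For a given \<open>V\<close> the obstacle is that the energy balance contains a state of unknown
  size. Replacing the next state, multiplied by \<open>z\<close>, by the difference of state and
  initial value cancels the squares of the state; the mean value property and Bessel's inequality on
  circles inside the disc then suffice, without boundary values.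

  For the converse the input has to be reconstructed from observed outputs. This works because a
  contraction preserves orthogonality to any vector at which it is isometric: states orthogonal to
  the copy of the range of \<open>Q\<close> give data orthogonal to all \<open>(J x, R x)\<close>,
  and such data are exactly those produced by an input.\<close>

lemma scaleC_one [simp]: "1 *\<^sub>C (x :: 'a::complex_inner) = x"
  using scaleC_complex_of_real[of 1 x] by simp

lemma scaleC_zero_left [simp]: "0 *\<^sub>C (x :: 'a::complex_inner) = 0"
  using scaleC_complex_of_real[of 0 x] by simp

lemma scaleC_minus_left: "(- a) *\<^sub>C (x :: 'a::complex_inner) = - (a *\<^sub>C x)"
  by (metis add.right_inverse eq_neg_iff_add_eq_0 scaleC_add_left scaleC_zero_left)

lemma scaleC_diff_left: "(a - b) *\<^sub>C (x :: 'a::complex_inner) = a *\<^sub>C x - b *\<^sub>C x"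
  using scaleC_add_left[of a "- b" x] by (simp add: scaleC_minus_left)

declare scaleC_zero_right [simp]

lemma cinner_scaleC_right: "cinner x (a *\<^sub>C y) = cnj a * cinner x (y :: 'a::complex_inner)"
  by (metis cinner_commute cinner_scaleC_left complex_cnj_mult)

lemma cinner_zero_left [simp]: "cinner 0 (x :: 'a::complex_inner) = 0"
  using cinner_scaleC_left[of 0 0 x] by simp

lemma cinner_zero_right [simp]: "cinner (x :: 'a::complex_inner) 0 = 0"
  using cinner_scaleC_right[of x 0 0] by simp

lemma cinner_minus_left: "cinner (- x) (y :: 'a::complex_inner) = - cinner x y"
  using cinner_scaleC_left[of "-1" x y] by (simp add: scaleC_minus_left)

lemma cinner_minus_right: "cinner (x :: 'a::complex_inner) (- y) = - cinner x y"
  using cinner_scaleC_right[of x "-1" y] by (simp add: scaleC_minus_left)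

lemma cinner_diff_left: "cinner (x - y) (z :: 'a::complex_inner) = cinner x z - cinner y z"
  using cinner_add_left[of x "- y" z] by (simp add: cinner_minus_left)

lemma cinner_diff_right: "cinner (x :: 'a::complex_inner) (y - z) = cinner x y - cinner x z"
  using cinner_add_right[of x y "- z"] by (simp add: cinner_minus_right)

lemma cinner_eqI:
  assumes "\<And>z. cinner x z = cinner (y :: 'a::complex_inner) z"
  shows "x = y"
proof -
  have "cinner (x - y) (x - y) = 0" using assms[of "x - y"] by (simp add: cinner_diff_left)
  then show ?thesis by (simp add: cinner_self)
qed

lemma closed_csubspaceD:
  assumes "closed_csubspace M"
  shows "subspace M" "closed M" "0 \<in> M"
    "\<And>x y. x \<in> M \<Longrightarrow> y \<in> M \<Longrightarrow> x + y \<in> M"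
    "\<And>x y. x \<in> M \<Longrightarrow> y \<in> M \<Longrightarrow> x - y \<in> M"
    "\<And>x. x \<in> M \<Longrightarrow> - x \<in> M"
    "\<And>r x. x \<in> M \<Longrightarrow> r *\<^sub>R x \<in> M"
    "\<And>a x. x \<in> M \<Longrightarrow> a *\<^sub>C x \<in> M"
  using assms unfolding closed_csubspace_def
  by (auto intro: subspace_0 subspace_add subspace_diff subspace_neg subspace_scale)

lemma closed_csubspace_UNIV [simp]: "closed_csubspace UNIV"
  by (simp add: closed_csubspace_def)

lemma closed_csubspace_Times:
  assumes "closed_csubspace M" "closed_csubspace N"
  shows "closed_csubspace (M \<times> N)"
  using assms unfolding closed_csubspace_def
  by (auto simp: subspace_Times closed_Times scaleC_prod_def)

lemma closed_csubspace_closure: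
  assumes "subspace M" "\<And>a x. x \<in> M \<Longrightarrow> a *\<^sub>C x \<in> (M :: 'a::chilbert_space set)"
  shows "closed_csubspace (closure M)"
proof -
  have scale: "a *\<^sub>C x \<in> closure M" if x: "x \<in> closure M" for a x
  proof -
    obtain s where s: "\<And>n. s n \<in> M" "s \<longlonglongrightarrow> x"
      using x unfolding closure_sequential by blast
    have "(\<lambda>n. a *\<^sub>C s n) \<longlonglongrightarrow> a *\<^sub>C x"
      by (rule bounded_linear.tendsto[OF bounded_linear_scaleC s(2)])
    then show ?thesis using assms(2) s(1) unfolding closure_sequential by metis
  qed
  moreover have "x + y \<in> closure M" if xy: "x \<in> closure M" "y \<in> closure M" for x y
  proof -
    obtain s where s: "\<And>n. s n \<in> M" "s \<longlonglongrightarrow> x"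
      using xy(1) unfolding closure_sequential by blast
    obtain t where t: "\<And>n. t n \<in> M" "t \<longlonglongrightarrow> y"
      using xy(2) unfolding closure_sequential by blast
    have "(\<lambda>n. s n + t n) \<longlonglongrightarrow> x + y" by (intro tendsto_add s(2) t(2))
    then show ?thesis using subspace_add[OF assms(1) s(1) t(1)] unfolding closure_sequential by metis
  qed
  moreover have "r *\<^sub>R x \<in> closure M" if "x \<in> closure M" for r x
    using scale[OF that, of "complex_of_real r"] by (simp add: scaleC_complex_of_real)
  moreover have "0 \<in> closure M" using subspace_0[OF assms(1)] closure_subset by blast
  ultimately show ?thesis unfolding closed_csubspace_def subspace_def by auto
qed

section \<open>Bounded operators between closed subspaces\<close>

lemma bounded_operatorD:
  assumes "bounded_operator M N F"
  shows "\<And>x. x \<in> M \<Longrightarrow> F x \<in> N"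
    "\<And>x y. x \<in> M \<Longrightarrow> y \<in> M \<Longrightarrow> F (x + y) = F x + F y"
    "\<And>a x. x \<in> M \<Longrightarrow> F (a *\<^sub>C x) = a *\<^sub>C F x"
  using assms unfolding bounded_operator_def by auto

lemma bounded_operator_bound:
  assumes "bounded_operator M N F"
  obtains c where "c > 0" "\<And>x. x \<in> M \<Longrightarrow> norm (F x) \<le> c * norm x"
proof -
  obtain c where c: "\<forall>x\<in>M. norm (F x) \<le> c * norm x"
    using assms unfolding bounded_operator_def by blast
  show ?thesis
  proof (rule that[of "max c 1"])
    fix x assume "x \<in> M"
    then have "norm (F x) \<le> c * norm x" using c by blast
    also have "\<dots> \<le> max c 1 * norm x" by (intro mult_right_mono) auto
    finally show "norm (F x) \<le> max c 1 * norm x" .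
  qed simp
qed

lemma bounded_operatorI:
  assumes "\<And>x. x \<in> M \<Longrightarrow> F x \<in> N"
    "\<And>x y. x \<in> M \<Longrightarrow> y \<in> M \<Longrightarrow> F (x + y) = F x + F y"
    "\<And>a x. x \<in> M \<Longrightarrow> F (a *\<^sub>C x) = a *\<^sub>C F x"
    "\<And>x. x \<in> M \<Longrightarrow> norm (F x) \<le> c * norm x"
  shows "bounded_operator M N F"
  using assms unfolding bounded_operator_def by blast

lemma bounded_operator_scaleR:
  assumes "bounded_operator M N F" "x \<in> M"
  shows "F (r *\<^sub>R x) = r *\<^sub>R F x"
  using bounded_operatorD(3)[OF assms, of "complex_of_real r"] by (simp add: scaleC_complex_of_real)

lemma bounded_operator_minus:
  assumes "bounded_operator M N F" "x \<in> M"
  shows "F (- x) = - F x"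
  using bounded_operatorD(3)[OF assms, of "- 1"] by (simp add: scaleC_minus_left)

lemma bounded_operator_zero:
  assumes "bounded_operator M N F" "closed_csubspace M"
  shows "F 0 = 0"
  using bounded_operatorD(3)[OF assms(1) closed_csubspaceD(3)[OF assms(2)], of 0] by simp

lemma bounded_operator_diff:
  assumes "bounded_operator M N F" "closed_csubspace M" "x \<in> M" "y \<in> M"
  shows "F (x - y) = F x - F y"
  using bounded_operatorD(2)[OF assms(1) assms(3) closed_csubspaceD(6)[OF assms(2,4)]]
    bounded_operator_minus[OF assms(1,4)] by simp

lemma bounded_operator_comp:
  assumes "bounded_operator M N F" "bounded_operator N L G"
  shows "bounded_operator M L (\<lambda>x. G (F x))"
proof -
  note F = bounded_operatorD[OF assms(1)] and G = bounded_operatorD[OF assms(2)]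
  obtain c where c: "\<And>x. x \<in> M \<Longrightarrow> norm (F x) \<le> c * norm x"
    by (rule bounded_operator_bound[OF assms(1)]) blast
  obtain d where d: "d > 0" "\<And>x. x \<in> N \<Longrightarrow> norm (G x) \<le> d * norm x"
    by (rule bounded_operator_bound[OF assms(2)]) blast
  have "norm (G (F x)) \<le> d * c * norm x" if "x \<in> M" for x
  proof -
    have "norm (G (F x)) \<le> d * norm (F x)" using d(2) F(1) that by blast
    also have "\<dots> \<le> d * (c * norm x)" using c[OF that] d(1) by (intro mult_left_mono) auto
    finally show ?thesis by (simp add: mult.assoc)
  qed
  then show ?thesis
    using F G by (intro bounded_operatorI[where c = "d * c"]) auto
qed

lemma bounded_operator_plus:
  assumes "bounded_operator M N F" "bounded_operator M N G" "closed_csubspace N"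
  shows "bounded_operator M N (\<lambda>x. F x + G x)"
proof -
  obtain c where c: "\<And>x. x \<in> M \<Longrightarrow> norm (F x) \<le> c * norm x"
    by (rule bounded_operator_bound[OF assms(1)]) blast
  obtain d where d: "\<And>x. x \<in> M \<Longrightarrow> norm (G x) \<le> d * norm x"
    by (rule bounded_operator_bound[OF assms(2)]) blast
  show ?thesis
  proof (rule bounded_operatorI[where c = "c + d"])
    show "norm (F x + G x) \<le> (c + d) * norm x" if "x \<in> M" for x
      using norm_triangle_ineq[of "F x" "G x"] c[OF that] d[OF that] by (simp add: distrib_right)
  qed (use bounded_operatorD[OF assms(1)] bounded_operatorD[OF assms(2)] closed_csubspaceD[OF assms(3)]
      in \<open>auto simp: scaleC_add_right\<close>)
qed

lemma bounded_operator_scale: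
  assumes "bounded_operator M N F" "closed_csubspace N"
  shows "bounded_operator M N (\<lambda>x. a *\<^sub>C F x)"
proof -
  obtain c where c: "\<And>x. x \<in> M \<Longrightarrow> norm (F x) \<le> c * norm x"
    by (rule bounded_operator_bound[OF assms(1)]) blast
  show ?thesis
  proof (rule bounded_operatorI[where c = "cmod a * c"])
    show "norm (a *\<^sub>C F x) \<le> cmod a * c * norm x" if "x \<in> M" for x
      using mult_left_mono[OF c[OF that], of "cmod a"] by (simp add: norm_scaleC mult.assoc)
  qed (use bounded_operatorD[OF assms(1)] closed_csubspaceD[OF assms(2)]
      in \<open>auto simp: scaleC_add_right scaleC_scaleC mult.commute\<close>)
qed

lemma bounded_operator_uminus:
  assumes "bounded_operator M N F" "closed_csubspace N"
  shows "bounded_operator M N (\<lambda>x. - F x)"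
  using bounded_operator_scale[OF assms, of "-1"] by (simp add: scaleC_minus_left)

lemma bounded_operator_minus_op:
  assumes "bounded_operator M N F" "bounded_operator M N G" "closed_csubspace N"
  shows "bounded_operator M N (\<lambda>x. F x - G x)"
  using bounded_operator_plus[OF assms(1) bounded_operator_uminus[OF assms(2,3)] assms(3)] by simp

lemma bounded_operator_id: "M \<subseteq> N \<Longrightarrow> bounded_operator M N (\<lambda>x. x)"
  by (rule bounded_operatorI[where c = 1]) auto

lemma bounded_operator_mono:
  assumes "bounded_operator M N F" "M' \<subseteq> M" "N \<subseteq> N'"
  shows "bounded_operator M' N' F"
  using assms unfolding bounded_operator_def Pi_iff by (meson subsetD)

lemma bounded_operator_codomain:
  assumes "bounded_operator M N F" "\<And>x. x \<in> M \<Longrightarrow> F x \<in> N'"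
  shows "bounded_operator M N' F"
  using assms unfolding bounded_operator_def by auto

lemma bounded_operator_cong:
  assumes "bounded_operator M N F" "closed_csubspace M" "\<And>x. x \<in> M \<Longrightarrow> F x = G x"
  shows "bounded_operator M N G"
  using assms closed_csubspaceD(4,8)[OF assms(2)] unfolding bounded_operator_def
  by (auto simp: Pi_iff)

lemma bounded_operator_Pair:
  assumes "bounded_operator M N F" "bounded_operator M N' G"
  shows "bounded_operator M (N \<times> N') (\<lambda>x. (F x, G x))"
proof -
  obtain c where c: "\<And>x. x \<in> M \<Longrightarrow> norm (F x) \<le> c * norm x"
    by (rule bounded_operator_bound[OF assms(1)]) blast
  obtain d where d: "\<And>x. x \<in> M \<Longrightarrow> norm (G x) \<le> d * norm x"
    by (rule bounded_operator_bound[OF assms(2)]) blast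
  show ?thesis
  proof (rule bounded_operatorI[where c = "c + d"])
    show "norm (F x, G x) \<le> (c + d) * norm x" if "x \<in> M" for x
      using norm_Pair_le[of "F x" "G x"] c[OF that] d[OF that] by (simp add: distrib_right)
  qed (use bounded_operatorD[OF assms(1)] bounded_operatorD[OF assms(2)]
      in \<open>auto simp: scaleC_prod_def\<close>)
qed

lemma bounded_operator_fst: "bounded_operator (M \<times> N) M fst"
  by (rule bounded_operatorI[where c = 1]) (auto simp: scaleC_prod_def norm_fst_le)

lemma bounded_operator_snd: "bounded_operator (M \<times> N) N snd"
  by (rule bounded_operatorI[where c = 1]) (auto simp: scaleC_prod_def norm_snd_le)

lemma bounded_operator_imp_bounded_linear:
  assumes "bounded_operator UNIV N F"
  shows "bounded_linear F"
proof -
  obtain c where "\<And>x. norm (F x) \<le> c * norm x"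
    by (rule bounded_operator_bound[OF assms]) blast
  then show ?thesis
    using bounded_operatorD(2)[OF assms] bounded_operator_scaleR[OF assms]
    by (intro bounded_linear_intro[where K = c]) (auto simp: mult.commute)
qed

lemma closed_csubspace_closure_range:
  assumes "bounded_operator UNIV N F"
  shows "closed_csubspace (closure (range F))"
proof (rule closed_csubspace_closure)
  show "subspace (range F)"
    using bounded_operator_imp_bounded_linear[OF assms]
    by (simp add: bounded_linear.linear linear_subspace_image)
  fix a x assume "x \<in> range F"
  then show "a *\<^sub>C x \<in> range F"
    using bounded_operatorD(3)[OF assms UNIV_I] by (metis rangeE rangeI)
qed

lemma closed_csubspace_kernel:
  assumes "bounded_operator UNIV N F"
  shows "closed_csubspace {x. F x = 0}"
proof -
  interpret bounded_linear F by (rule bounded_operator_imp_bounded_linear[OF assms])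
  have "closed {x. F x = 0}"
    by (intro closed_Collect_eq continuous_intros continuous_on_const) (simp add: continuous_on)
  then show ?thesis
    unfolding closed_csubspace_def subspace_def
    using bounded_operatorD(3)[OF assms UNIV_I] by (auto simp: add scaleR zero)
qed

section \<open>The Riesz representation theorem, projections and adjoints\<close>

text \<open>The representing vector minimises \<open>norm x ^ 2 - 2 f x\<close>.\<close>

lemma real_riesz_on:
  fixes M :: "'a::{real_inner, complete_space} set"
  assumes M: "subspace M" "closed M"
    and add: "\<And>x y. x \<in> M \<Longrightarrow> y \<in> M \<Longrightarrow> f (x + y) = f x + f y"
    and scale: "\<And>r x. x \<in> M \<Longrightarrow> f (r *\<^sub>R x) = r * f x"
    and bound: "\<And>x. x \<in> M \<Longrightarrow> \<bar>f x\<bar> \<le> c * norm x"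
  obtains y where "y \<in> M" "\<And>x. x \<in> M \<Longrightarrow> f x = x \<bullet> y"
proof -
  define J where "J x = (norm x)\<^sup>2 - 2 * f x" for x
  define m where "m = Inf (J ` M)"
  have zero: "0 \<in> M" using M(1) by (rule subspace_0)
  \<comment> \<open>Completing the square: \<open>J x\<close> is at least
    \<open>(norm x - c)\<^sup>2 - c\<^sup>2\<close>.\<close>
  have "J x \<ge> - c\<^sup>2" if "x \<in> M" for x
  proof -
    have "0 \<le> (norm x - c)\<^sup>2" by simp
    moreover have "f x \<le> c * norm x" using bound[OF that] by simp
    ultimately show ?thesis by (simp add: J_def power2_diff mult.commute[of c])
  qed
  then have bdd: "bdd_below (J ` M)" by (intro bdd_belowI2)
  then have m_le: "m \<le> J x" if "x \<in> M" for x
    using that unfolding m_def by (intro cInf_lower) auto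
  \<comment> \<open>Parallelogram law. The linear terms of \<open>J\<close> cancel at the midpoint,
    so vectors that nearly minimise \<open>J\<close> are close to each other.\<close>
  have par: "(norm (x - y))\<^sup>2 \<le> 2 * J x + 2 * J y - 4 * m" if "x \<in> M" "y \<in> M" for x y
  proof -
    have mid: "(1/2) *\<^sub>R (x + y) \<in> M" using M(1) that by (simp add: subspace_add subspace_scale)
    have "J ((1/2) *\<^sub>R (x + y)) = (norm (x + y))\<^sup>2 / 4 - (f x + f y)"
    proof -
      have "f ((1/2) *\<^sub>R (x + y)) = 1/2 * (f x + f y)"
        using that M(1) by (simp only: scale add subspace_add)
      then show ?thesis by (simp add: J_def power_divide)
    qed
    moreover have "(norm (x - y))\<^sup>2 + (norm (x + y))\<^sup>2 = 2 * (norm x)\<^sup>2 + 2 * (norm y)\<^sup>2"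
      by (simp add: power2_norm_eq_inner inner_diff_left inner_diff_right inner_add_left
          inner_add_right inner_commute)
    ultimately show ?thesis using m_le[OF mid] by (simp add: J_def)
  qed
  have "\<exists>x\<in>M. J x < m + 1 / real (Suc n)" for n
  proof -
    have "Inf (J ` M) < m + 1 / real (Suc n)" by (simp add: m_def)
    then show ?thesis using zero bdd by (subst (asm) cInf_less_iff) auto
  qed
  then obtain s where s: "\<And>n. s n \<in> M" "\<And>n. J (s n) < m + 1 / real (Suc n)" by metis
  have dist_s: "(norm (s n - s k))\<^sup>2 \<le> 2 / real (Suc n) + 2 / real (Suc k)" for n k
    using par[OF s(1)[of n] s(1)[of k]] s(2)[of n] s(2)[of k] by simp
  have "Cauchy s"
    unfolding Cauchy_iff
  proof (intro allI impI)
    fix e :: real assume "e > 0"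
    obtain N where N: "4 / e\<^sup>2 < real N" using reals_Archimedean2 by blast
    have "norm (s n - s k) < e" if "n \<ge> N" "k \<ge> N" for n k
    proof -
      have "real N > 0" using N \<open>e > 0\<close> by (smt (verit) divide_nonneg_nonneg zero_le_power2)
      have "2 / real (Suc n) \<le> 2 / real N" "2 / real (Suc k) \<le> 2 / real N"
        using that \<open>real N > 0\<close> by (auto intro!: divide_left_mono)
      then have "(norm (s n - s k))\<^sup>2 \<le> 4 / real N" using dist_s[of n k] by simp
      also have "\<dots> < e\<^sup>2" using N \<open>e > 0\<close> \<open>real N > 0\<close> by (simp add: field_simps)
      finally show ?thesis using \<open>e > 0\<close> by (simp add: power2_less_imp_less)
    qed
    then show "\<exists>N. \<forall>m\<ge>N. \<forall>n\<ge>N. norm (s m - s n) < e" by blast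
  qed
  then obtain y where y: "s \<longlonglongrightarrow> y" using Cauchy_convergent convergentD by blast
  have yM: "y \<in> M" using M(2) s(1) y by (metis closed_sequentially)
  have "(\<lambda>n. f (s n)) \<longlonglongrightarrow> f y"
  proof (rule LIM_zero_cancel, rule Lim_null_comparison)
    have "(\<lambda>n. c * norm (s n - y)) \<longlonglongrightarrow> c * norm (y - y)" by (intro tendsto_intros y)
    then show "(\<lambda>n. c * norm (s n - y)) \<longlonglongrightarrow> 0" by simp
    have "norm (f (s n) - f y) \<le> c * norm (s n - y)" for n
      using bound[of "s n - y"] add[of "s n - y" y] M(1) s(1)[of n] yM by (simp add: subspace_diff)
    then show "\<forall>\<^sub>F n in sequentially. norm (f (s n) - f y) \<le> c * norm (s n - y)" by simp
  qed
  then have "(\<lambda>n. J (s n)) \<longlonglongrightarrow> J y" unfolding J_def by (intro tendsto_intros y)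
  moreover have "(\<lambda>n. m + 1 / real (Suc n)) \<longlonglongrightarrow> m + 0"
    by (intro tendsto_intros LIMSEQ_Suc[OF lim_const_over_n])
  ultimately have Jy: "J y \<le> m"
    using s(2) by (intro LIMSEQ_le[of "\<lambda>n. J (s n)" _ "\<lambda>n. m + 1 / real (Suc n)"])
      (auto intro: less_imp_le)
  have "f x = x \<bullet> y" if "x \<in> M" for x
  proof (cases "x = 0")
    case True then show ?thesis using scale[OF zero, of 0] by simp
  next
    case False
    define a where "a = f x - x \<bullet> y"
    \<comment> \<open>The minimiser of \<open>J (y + t *\<^sub>R x)\<close> over real
      \<open>t\<close>; the minimum lies \<open>a\<^sup>2 / (norm x)\<^sup>2\<close> below
      \<open>J y\<close>, so minimality of \<open>y\<close> forces \<open>a = 0\<close>.\<close>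
    define t where "t = a / (norm x)\<^sup>2"
    have "y + t *\<^sub>R x \<in> M" using M(1) yM that by (simp add: subspace_add subspace_scale)
    then have "J y \<le> J (y + t *\<^sub>R x)" using Jy m_le by (meson order_trans)
    moreover have "J (y + t *\<^sub>R x) = J y - 2 * t * a + t\<^sup>2 * (norm x)\<^sup>2"
    proof -
      have "(norm (y + t *\<^sub>R x))\<^sup>2 = (norm y)\<^sup>2 + 2 * t * (x \<bullet> y) + t\<^sup>2 * (norm x)\<^sup>2"
        by (simp add: power2_norm_eq_inner inner_add_left inner_add_right inner_commute[of y x])
          (simp add: power2_eq_square algebra_simps)
      moreover have "f (y + t *\<^sub>R x) = f y + t * f x"
        using yM that M(1) by (simp add: add scale subspace_scale)
      ultimately show ?thesis by (simp add: J_def a_def algebra_simps)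
    qed
    moreover have "t\<^sup>2 * (norm x)\<^sup>2 = t * a" using False by (simp add: t_def power2_eq_square)
    ultimately have "t * a \<le> 0" by (simp add: mult.commute)
    moreover have "0 < (norm x)\<^sup>2" using False by simp
    ultimately have "a\<^sup>2 \<le> 0" by (simp add: t_def divide_le_0_iff flip: power2_eq_square)
    then show ?thesis by (simp add: a_def)
  qed
  then show ?thesis using that yM by blast
qed

text \<open>The real theorem represents \<open>Re f\<close>. Evaluation at
  \<open>\<i> *\<^sub>C x\<close> recovers the imaginary part, so the same vector represents
  \<open>f\<close>.\<close>

lemma riesz_on:
  assumes M: "closed_csubspace M"
    and add: "\<And>x y. x \<in> M \<Longrightarrow> y \<in> M \<Longrightarrow> f (x + y) = f x + f y"
    and scale: "\<And>a x. x \<in> M \<Longrightarrow> f (a *\<^sub>C x) = a * f x"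
    and bound: "\<And>x. x \<in> M \<Longrightarrow> cmod (f x) \<le> c * norm x"
  obtains y where "y \<in> M" "\<And>x. x \<in> M \<Longrightarrow> f x = cinner x y"
proof (rule real_riesz_on[of M "\<lambda>x. Re (f x)" c])
  show "Re (f (r *\<^sub>R x)) = r * Re (f x)" if "x \<in> M" for r x
    using scale[OF that, of "complex_of_real r"] by (simp add: scaleC_complex_of_real)
  fix y assume y: "y \<in> M" "\<And>x. x \<in> M \<Longrightarrow> Re (f x) = x \<bullet> y"
  have "f x = cinner x y" if "x \<in> M" for x
  proof (rule complex_eqI)
    show "Re (f x) = Re (cinner x y)" using y(2)[OF that] by (simp add: Re_cinner)
    have "Re (f (\<i> *\<^sub>C x)) = Re (cinner (\<i> *\<^sub>C x) y)"
      using y(2) that closed_csubspaceD(8)[OF M] by (simp add: Re_cinner)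
    then show "Im (f x) = Im (cinner x y)" using scale[OF that] by (simp add: cinner_scaleC_left)
  qed
  then show ?thesis using that y(1) by blast
next
  show "\<bar>Re (f x)\<bar> \<le> c * norm x" if "x \<in> M" for x
    using bound[OF that] abs_Re_le_cmod[of "f x"] by linarith
qed (use closed_csubspaceD[OF M] add in auto)

lemma cinner_eqI_on:
  assumes "closed_csubspace M" "x \<in> M" "y \<in> M" "\<And>z. z \<in> M \<Longrightarrow> cinner z x = cinner z y"
  shows "x = y"
proof -
  have "cinner (x - y) (x - y) = 0"
    using assms(4)[of "x - y"] closed_csubspaceD(5)[OF assms(1-3)] by (simp add: cinner_diff_right)
  then show ?thesis by (simp add: cinner_self)
qed

text \<open>The projection of \<open>x\<close> is the Riesz vector of the functional
  \<open>cinner z x\<close> of \<open>z\<close> on \<open>M\<close>. Its uniqueness turns the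
  \<open>THE\<close> in \<open>orth_proj\<close> into two usable rules.\<close>

lemma
  assumes M: "closed_csubspace M"
  shows orth_proj_in: "orth_proj M x \<in> M"
    and cinner_orth_proj_left: "z \<in> M \<Longrightarrow> cinner (orth_proj M x) z = cinner x z"
proof -
  have bd: "cmod (cinner z x) \<le> norm x * norm z" for z
    using cmod_cinner_le[of z x] by (simp add: mult.commute)
  obtain y where y: "y \<in> M" "\<And>z. z \<in> M \<Longrightarrow> cinner z x = cinner z y"
    by (rule riesz_on[OF M, of "\<lambda>z. cinner z x", OF cinner_add_left cinner_scaleC_left bd]) blast
  have y': "cinner (x - y) z = 0" if "z \<in> M" for z
    using y(2)[OF that] by (simp add: cinner_diff_left cinner_commute[of x z] cinner_commute[of y z])
  have "\<exists>!y. y \<in> M \<and> (\<forall>z\<in>M. cinner (x - y) z = 0)"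
  proof (rule ex1I[of _ y])
    fix w assume w: "w \<in> M \<and> (\<forall>z\<in>M. cinner (x - w) z = 0)"
    show "w = y"
    proof (rule cinner_eqI_on[OF M])
      fix z assume "z \<in> M"
      then have "cinner w z = cinner y z" using w y' by (simp add: cinner_diff_left)
      then show "cinner z w = cinner z y" by (metis cinner_commute)
    qed (use w y in auto)
  qed (use y y' in auto)
  from theI'[OF this, folded orth_proj_def]
  have *: "orth_proj M x \<in> M \<and> (\<forall>z\<in>M. cinner (x - orth_proj M x) z = 0)" .
  then show "orth_proj M x \<in> M" by blast
  show "z \<in> M \<Longrightarrow> cinner (orth_proj M x) z = cinner x z" using * by (simp add: cinner_diff_left)
qed

lemma orth_proj_eqI:
  assumes "closed_csubspace M" "y \<in> M" "\<And>z. z \<in> M \<Longrightarrow> cinner x z = cinner y z"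
  shows "orth_proj M x = y"
proof (rule cinner_eqI_on[OF assms(1) orth_proj_in[OF assms(1)] assms(2)])
  fix z assume "z \<in> M"
  then have "cinner (orth_proj M x) z = cinner y z"
    using assms by (simp add: cinner_orth_proj_left)
  then show "cinner z (orth_proj M x) = cinner z y" by (metis cinner_commute)
qed

lemma orth_proj_ident: "closed_csubspace M \<Longrightarrow> x \<in> M \<Longrightarrow> orth_proj M x = x"
  by (rule orth_proj_eqI) auto

text \<open>Cancels a factor \<open>a\<close> that may vanish. It concludes estimates in which the
  square of a norm is bounded by means of Cauchy-Schwarz.\<close>

lemma le_if_power2_le_mult:
  fixes a b :: real
  assumes "a\<^sup>2 \<le> b * a" "0 \<le> b"
  shows "a \<le> b"
proof (rule ccontr)
  assume "\<not> a \<le> b"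
  then have "b * a < a * a" using assms(2) by (intro mult_strict_right_mono) auto
  then show False using assms(1) by (simp add: power2_eq_square)
qed

lemma norm_orth_proj_le:
  assumes "closed_csubspace M"
  shows "norm (orth_proj M x) \<le> norm x"
proof -
  have "(norm (orth_proj M x))\<^sup>2 = x \<bullet> orth_proj M x"
    using cinner_orth_proj_left[OF assms orth_proj_in[OF assms], of x x]
    by (metis Re_cinner power2_norm_eq_inner)
  also have "\<dots> \<le> norm x * norm (orth_proj M x)" by (rule norm_cauchy_schwarz)
  finally show ?thesis
    by (rule le_if_power2_le_mult) simp
qed

lemma bounded_operator_orth_proj:
  assumes M: "closed_csubspace M"
  shows "bounded_operator UNIV M (orth_proj M)"
proof (rule bounded_operatorI[where c = 1])
  show "orth_proj M (x + y) = orth_proj M x + orth_proj M y" for x y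
    by (rule orth_proj_eqI[OF M])
      (auto simp: closed_csubspaceD[OF M] orth_proj_in[OF M] cinner_add_left cinner_orth_proj_left[OF M])
  show "orth_proj M (a *\<^sub>C x) = a *\<^sub>C orth_proj M x" for a x
    by (rule orth_proj_eqI[OF M])
      (auto simp: closed_csubspaceD[OF M] orth_proj_in[OF M] cinner_scaleC_left cinner_orth_proj_left[OF M])
qed (simp_all add: orth_proj_in[OF M] norm_orth_proj_le[OF M])

text \<open>For fixed \<open>y\<close> the Riesz theorem represents \<open>cinner (F x) y\<close> as
  a functional of \<open>x\<close> on \<open>M\<close>; the bound of \<open>F\<close> carries over
  to the adjoint.\<close>

lemma
  assumes M: "closed_csubspace M" and N: "closed_csubspace N" and F: "bounded_operator M N F"
  shows bounded_operator_adjoint_on: "bounded_operator N M (adjoint_on M N F)"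
    and cinner_adjoint_on:
      "x \<in> M \<Longrightarrow> y \<in> N \<Longrightarrow> cinner (F x) y = cinner x (adjoint_on M N F y)"
proof -
  note FD = bounded_operatorD[OF F]
  obtain c where c: "c > 0" "\<And>x. x \<in> M \<Longrightarrow> norm (F x) \<le> c * norm x"
    by (rule bounded_operator_bound[OF F]) blast
  have "\<exists>g\<in>M. \<forall>x\<in>M. cinner (F x) y = cinner x g" for y
  proof -
    have bd: "cmod (cinner (F x) y) \<le> c * norm y * norm x" if "x \<in> M" for x
    proof -
      have "cmod (cinner (F x) y) \<le> norm (F x) * norm y" by (rule cmod_cinner_le)
      also have "\<dots> \<le> (c * norm x) * norm y" by (intro mult_right_mono c(2)[OF that]) simp
      finally show ?thesis by (simp add: mult.commute mult.left_commute)
    qed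
    show ?thesis
      by (rule riesz_on[OF M, of "\<lambda>x. cinner (F x) y", OF _ _ bd])
        (auto simp: FD cinner_add_left cinner_scaleC_left)
  qed
  then obtain G where G: "\<And>y. G y \<in> M" "\<And>x y. x \<in> M \<Longrightarrow> cinner (F x) y = cinner x (G y)"
    by metis
  have "bounded_operator N M G"
  proof (rule bounded_operatorI[where c = c])
    show "G (x + y) = G x + G y" for x y
    proof (rule cinner_eqI_on[OF M])
      show "cinner z (G (x + y)) = cinner z (G x + G y)" if "z \<in> M" for z
        by (simp add: cinner_add_right G(2)[OF that, symmetric])
    qed (use G(1) closed_csubspaceD[OF M] in auto)
    show "G (a *\<^sub>C x) = a *\<^sub>C G x" for a x
    proof (rule cinner_eqI_on[OF M])
      show "cinner z (G (a *\<^sub>C x)) = cinner z (a *\<^sub>C G x)" if "z \<in> M" for z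
        by (simp add: cinner_scaleC_right G(2)[OF that, symmetric])
    qed (use G(1) closed_csubspaceD[OF M] in auto)
    show "norm (G y) \<le> c * norm y" for y
    proof -
      have "(norm (G y))\<^sup>2 = F (G y) \<bullet> y" using G(2)[OF G(1), of y y]
        by (metis Re_cinner power2_norm_eq_inner)
      also have "\<dots> \<le> norm (F (G y)) * norm y" by (rule norm_cauchy_schwarz)
      also have "\<dots> \<le> c * norm (G y) * norm y" by (intro mult_right_mono c(2) G(1)) simp
      also have "\<dots> = (c * norm y) * norm (G y)" by (simp add: ac_simps)
      finally show ?thesis by (rule le_if_power2_le_mult) (use c(1) in simp)
    qed
  qed (use G(1) in auto)
  \<comment> \<open>Restricting to \<open>N\<close> selects the one representative that the
    definition by \<open>THE\<close> admits; values off \<open>N\<close> would otherwise be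
    free.\<close>
  then have R: "bounded_operator N M (restrict G N)"
    by (rule bounded_operator_cong[OF _ N]) simp
  let ?P = "\<lambda>G. bounded_operator N M G \<and> G \<in> extensional N \<and>
    (\<forall>x\<in>M. \<forall>y\<in>N. cinner (F x) y = cinner x (G y))"
  have "\<exists>!G. ?P G"
  proof (rule ex1I[of _ "restrict G N"])
    fix G' assume G': "?P G'"
    show "G' = restrict G N"
    proof (rule extensionalityI[of _ N])
      fix y assume "y \<in> N"
      then show "G' y = restrict G N y"
        using G' bounded_operatorD(1)[of N M G' y] G
        by (intro cinner_eqI_on[OF M]) auto
    qed (use G' in auto)
  qed (use R G in auto)
  from theI'[OF this, folded adjoint_on_def] have "?P (adjoint_on M N F)" .
  then show "bounded_operator N M (adjoint_on M N F)"
    "x \<in> M \<Longrightarrow> y \<in> N \<Longrightarrow> cinner (F x) y = cinner x (adjoint_on M N F y)"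
    by blast+
qed

lemma adjoint_on_eqI:
  assumes "closed_csubspace M" "closed_csubspace N" "bounded_operator M N F" "y \<in> N" "g \<in> M"
    "\<And>x. x \<in> M \<Longrightarrow> cinner (F x) y = cinner x g"
  shows "adjoint_on M N F y = g"
  using assms cinner_adjoint_on[OF assms(1-3)] bounded_operatorD(1)[OF bounded_operator_adjoint_on[OF assms(1-3)]]
  by (intro cinner_eqI_on[OF assms(1)]) auto

lemma inner_adjoint_on:
  assumes "closed_csubspace M" "closed_csubspace N" "bounded_operator M N F" "x \<in> M" "y \<in> N"
  shows "F x \<bullet> y = x \<bullet> adjoint_on M N F y"
  using cinner_adjoint_on[OF assms] by (metis Re_cinner)

section \<open>Invertible and positive operators\<close>

lemma invertible_onD:
  assumes "invertible_on M F"
  shows "bounded_operator M M F" "bounded_operator M M (inv_into M F)"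
    "\<And>y. y \<in> M \<Longrightarrow> inv_into M F y \<in> M"
    "\<And>y. y \<in> M \<Longrightarrow> F (inv_into M F y) = y"
    "\<And>x. x \<in> M \<Longrightarrow> inv_into M F (F x) = x"
  using assms unfolding invertible_on_def
  by (auto intro: inv_into_into bij_betw_inv_into_right bij_betw_inv_into_left simp: bij_betw_imp_surj_on)

text \<open>The lower bound gives injectivity and, applied to preimages, the bound
  \<open>1 / \<delta>\<close> of the inverse.\<close>

lemma
  assumes M: "closed_csubspace M" and F: "bounded_operator M M F"
    and surj: "\<And>y. y \<in> M \<Longrightarrow> \<exists>x\<in>M. F x = y"
    and "\<delta> > 0" and lower: "\<And>x. x \<in> M \<Longrightarrow> \<delta> * norm x \<le> norm (F x)"
  shows invertible_onI: "invertible_on M F"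
    and norm_inv_into_le: "y \<in> M \<Longrightarrow> norm (inv_into M F y) \<le> norm y / \<delta>"
proof -
  note FD = bounded_operatorD[OF F] and MD = closed_csubspaceD[OF M]
  have inj: "inj_on F M"
  proof (rule inj_onI)
    fix x y assume xy: "x \<in> M" "y \<in> M" "F x = F y"
    have "\<delta> * norm (x - y) \<le> norm (F (x - y))" using xy MD(5) lower by blast
    then have "\<delta> * norm (x - y) \<le> 0" using xy by (simp add: bounded_operator_diff[OF F M])
    then show "x = y" using \<open>\<delta> > 0\<close> by (simp add: mult_le_0_iff)
  qed
  moreover have img: "F ` M = M" using FD(1) surj by blast
  ultimately have bij: "bij_betw F M M" by (simp add: bij_betw_def)
  have inv: "inv_into M F y \<in> M" "F (inv_into M F y) = y" if "y \<in> M" for y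
    using that img by (auto simp: inv_into_into f_inv_into_f)
  have eqI: "inv_into M F y = x" if "x \<in> M" "F x = y" for x y
    using inj that by (auto simp: inv_into_f_f)
  show norm: "norm (inv_into M F y) \<le> norm y / \<delta>" if "y \<in> M" for y
    using lower[OF inv(1)[OF that]] inv(2)[OF that] \<open>\<delta> > 0\<close> by (simp add: field_simps)
  have "bounded_operator M M (inv_into M F)"
  proof (rule bounded_operatorI[where c = "1 / \<delta>"])
    show "inv_into M F (x + y) = inv_into M F x + inv_into M F y" if "x \<in> M" "y \<in> M" for x y
      using that by (intro eqI) (auto simp: FD inv MD)
    show "inv_into M F (a *\<^sub>C x) = a *\<^sub>C inv_into M F x" if "x \<in> M" for a x
      using that by (intro eqI) (auto simp: FD inv MD)
  qed (use inv norm in auto)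
  then show "invertible_on M F" using F bij by (simp add: invertible_on_def)
qed

lemma invertible_on_lower_bound:
  assumes "invertible_on M F"
  obtains \<delta> where "\<delta> > 0" "\<And>x. x \<in> M \<Longrightarrow> \<delta> * norm x \<le> norm (F x)"
proof -
  note D = invertible_onD[OF assms]
  obtain c where c: "c > 0" "\<And>x. x \<in> M \<Longrightarrow> norm (inv_into M F x) \<le> c * norm x"
    by (rule bounded_operator_bound[OF D(2)]) blast
  have "1 / c * norm x \<le> norm (F x)" if "x \<in> M" for x
    using c(2)[OF bounded_operatorD(1)[OF D(1) that]] D(5)[OF that] c(1)
    by (simp add: field_simps)
  then show ?thesis using c(1) by (intro that[of "1 / c"]) auto
qed

text \<open>Solving \<open>x - G x = y\<close> means finding a fixed point of the strict contraction
  sending \<open>x\<close> to \<open>G x + y\<close>, so completeness of \<open>M\<close> gives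
  surjectivity. The lower bound \<open>1 - q\<close> is the reverse triangle inequality.\<close>

lemma
  assumes M: "closed_csubspace M" and G: "bounded_operator M M G" and q: "0 \<le> q" "q < 1"
    and le: "\<And>x. x \<in> M \<Longrightarrow> norm (G x) \<le> q * norm x"
  shows invertible_on_id_minus: "invertible_on M (\<lambda>x. x - G x)"
    and norm_inv_id_minus_le:
      "y \<in> M \<Longrightarrow> norm (inv_into M (\<lambda>x. x - G x) y) \<le> norm y / (1 - q)"
proof -
  note MD = closed_csubspaceD[OF M] and GD = bounded_operatorD[OF G]
  have F: "bounded_operator M M (\<lambda>x. x - G x)"
    by (rule bounded_operator_minus_op[OF bounded_operator_id G M]) simp
  have surj: "\<exists>x\<in>M. x - G x = y" if "y \<in> M" for y
  proof -
    have "\<exists>!x. x \<in> M \<and> G x + y = x"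
    proof (rule Banach_fix[OF _ _ q])
      show "complete M" using MD(2) by (simp add: complete_eq_closed)
      show "(\<lambda>x. G x + y) ` M \<subseteq> M" using GD(1) MD(4) that by blast
      show "dist (G x + y) (G x' + y) \<le> q * dist x x'" if "x \<in> M" "x' \<in> M" for x x'
        using le[OF MD(5)[OF that]] bounded_operator_diff[OF G M that] by (simp add: dist_norm)
    qed (use MD(3) in auto)
    then show ?thesis by (metis add_diff_cancel_left')
  qed
  have lower: "(1 - q) * norm x \<le> norm (x - G x)" if "x \<in> M" for x
    using norm_triangle_ineq2[of x "G x"] le[OF that] by (simp add: algebra_simps)
  show "invertible_on M (\<lambda>x. x - G x)"
    by (rule invertible_onI[OF M F surj _ lower]) (use q in auto)
  show "norm (inv_into M (\<lambda>x. x - G x) y) \<le> norm y / (1 - q)" if "y \<in> M"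
    by (rule norm_inv_into_le[OF M F surj _ lower that]) (use q in auto)
qed

lemma positive_onI:
  assumes "bounded_operator M M F" "\<And>x. x \<in> M \<Longrightarrow> cinner (F x) x = cinner x (F x)"
    "\<And>x. x \<in> M \<Longrightarrow> 0 \<le> F x \<bullet> x"
  shows "positive_on M F"
proof -
  have "cinner (F x) x \<in> \<real>\<^sub>\<ge>\<^sub>0" if "x \<in> M" for x
  proof -
    have "cnj (cinner (F x) x) = cinner (F x) x"
      using assms(2)[OF that] by (metis cinner_commute)
    then have "Im (cinner (F x) x) = 0" by (simp add: complex_eq_iff)
    then show ?thesis using assms(3)[OF that] by (simp add: complex_nonneg_Reals_iff Re_cinner)
  qed
  then show ?thesis using assms(1) by (simp add: positive_on_def)
qed

lemma positive_onD:
  assumes "positive_on M F"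
  shows "bounded_operator M M F" "\<And>x. x \<in> M \<Longrightarrow> 0 \<le> F x \<bullet> x"
  using assms by (auto simp: positive_on_def complex_nonneg_Reals_iff simp flip: Re_cinner)

text \<open>Polarisation: reality of the quadratic form at \<open>x + y\<close> and at \<open>x + \<i> y\<close>.\<close>

lemma positive_on_cinner_commute:
  assumes "positive_on M F" "closed_csubspace M" "x \<in> M" "y \<in> M"
  shows "cinner (F x) y = cinner x (F y)"
proof -
  note FD = bounded_operatorD[OF positive_onD(1)[OF assms(1)]] and MD = closed_csubspaceD[OF assms(2)]
  have real: "Im (cinner (F z) z) = 0" if "z \<in> M" for z
    using assms(1) that by (auto simp: positive_on_def complex_nonneg_Reals_iff)
  have "Im (cinner (F x) y) + Im (cinner (F y) x) = 0"
    using real[of "x + y"] real[of x] real[of y] assms(3,4) MD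
    by (simp add: FD cinner_add_left cinner_add_right)
  moreover have "Re (cinner (F y) x) = Re (cinner (F x) y)"
    using real[of "x + \<i> *\<^sub>C y"] real[of x] real[of y] assms(3,4) MD
    by (simp add: FD cinner_add_left cinner_add_right cinner_scaleC_left cinner_scaleC_right)
  ultimately have "cinner (F x) y = cnj (cinner (F y) x)"
    by (simp add: complex_eq_iff)
  then show ?thesis by (simp add: cinner_commute[of x "F y"])
qed

lemma positive_on_inner_commute:
  assumes "positive_on M F" "closed_csubspace M" "x \<in> M" "y \<in> M"
  shows "F x \<bullet> y = x \<bullet> F y"
  using positive_on_cinner_commute[OF assms] by (metis Re_cinner)

text \<open>Obtained from positivity of the form at \<open>x - (1/c) *\<^sub>R F x\<close>, since
  square roots are constructed only with its help. In particular, a vector on which the form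
  vanishes lies in the kernel of \<open>F\<close>.\<close>

lemma positive_on_norm_le:
  assumes F: "positive_on M F" and M: "closed_csubspace M" and "c > 0"
    and c: "\<And>x. x \<in> M \<Longrightarrow> norm (F x) \<le> c * norm x" and x: "x \<in> M"
  shows "(norm (F x))\<^sup>2 \<le> c * (F x \<bullet> x)"
proof -
  note FD = bounded_operatorD[OF positive_onD(1)[OF F]] and MD = closed_csubspaceD[OF M]
  have Fx: "F x \<in> M" using FD(1) x .
  define y where "y = x - (1/c) *\<^sub>R F x"
  have y: "y \<in> M" using x Fx MD by (simp add: y_def)
  have "F y = F x - (1/c) *\<^sub>R F (F x)"
    unfolding y_def using x Fx MD
    by (simp add: bounded_operator_diff[OF positive_onD(1)[OF F] M]
        bounded_operator_scaleR[OF positive_onD(1)[OF F]])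
  then have "F y \<bullet> y = (F x - (1/c) *\<^sub>R F (F x)) \<bullet> (x - (1/c) *\<^sub>R F x)"
    by (simp only: y_def)
  also have "\<dots> = F x \<bullet> x - 2 / c * (norm (F x))\<^sup>2 + (1/c)\<^sup>2 * (F (F x) \<bullet> F x)"
    using positive_on_inner_commute[OF F M Fx x]
    by (simp add: inner_diff_left inner_diff_right power2_norm_eq_inner)
      (simp add: power2_eq_square diff_divide_distrib)
  finally have Fyy: "F y \<bullet> y = F x \<bullet> x - 2 / c * (norm (F x))\<^sup>2 + (1/c)\<^sup>2 * (F (F x) \<bullet> F x)" .
  have "F (F x) \<bullet> F x \<le> c * (norm (F x))\<^sup>2"
  proof -
    have "F (F x) \<bullet> F x \<le> norm (F (F x)) * norm (F x)" by (rule norm_cauchy_schwarz)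
    also have "\<dots> \<le> c * norm (F x) * norm (F x)" by (intro mult_right_mono c Fx) simp
    finally show ?thesis by (simp add: power2_eq_square mult.assoc)
  qed
  then have "(1/c)\<^sup>2 * (F (F x) \<bullet> F x) \<le> (1/c)\<^sup>2 * (c * (norm (F x))\<^sup>2)" by (intro mult_left_mono) auto
  moreover have "(1/c)\<^sup>2 * (c * (norm (F x))\<^sup>2) = (norm (F x))\<^sup>2 / c"
    using \<open>c > 0\<close> by (simp add: power2_eq_square)
  ultimately have "(norm (F x))\<^sup>2 / c \<le> F x \<bullet> x"
    using positive_onD(2)[OF F y] Fyy by simp
  then show ?thesis using \<open>c > 0\<close> by (simp add: field_simps)
qed

text \<open>Expand the square and use
  \<open>(norm (F x))\<^sup>2 \<le> c * (F x \<bullet> x)\<close>. In general this makes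
  \<open>I - F / c\<close> a contraction, as the square root iteration requires; for a coercive
  \<open>F\<close> it is a strict contraction, whence invertibility.\<close>

lemma norm_id_minus_scaled_le:
  assumes F: "positive_on M F" and M: "closed_csubspace M" and "c > 0"
    and c: "\<And>x. x \<in> M \<Longrightarrow> norm (F x) \<le> c * norm x" and x: "x \<in> M"
  shows "(norm (x - (1/c) *\<^sub>R F x))\<^sup>2 \<le> (norm x)\<^sup>2 - (F x \<bullet> x) / c"
proof -
  have "(norm (x - (1/c) *\<^sub>R F x))\<^sup>2 = (norm x)\<^sup>2 - 2 / c * (F x \<bullet> x) + (norm (F x))\<^sup>2 / c\<^sup>2"
    by (simp add: power2_norm_eq_inner inner_diff_left inner_diff_right inner_commute[of x "F x"])
      (simp add: power2_eq_square diff_divide_distrib)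
  moreover have "(norm (F x))\<^sup>2 / c\<^sup>2 \<le> (F x \<bullet> x) / c"
    using positive_on_norm_le[OF F M \<open>c > 0\<close> c x] \<open>c > 0\<close>
    by (simp add: power2_eq_square field_simps)
  ultimately show ?thesis by simp
qed

text \<open>A coercive \<open>F\<close> has the form \<open>F = c (I - G)\<close> with a strict
  contraction \<open>G\<close>, so the fixed point argument inverts it.\<close>

lemma positive_definite_onI:
  assumes F: "positive_on M F" and M: "closed_csubspace M" and "\<delta> > 0"
    and lower: "\<And>x. x \<in> M \<Longrightarrow> \<delta> * (norm x)\<^sup>2 \<le> F x \<bullet> x"
  shows "positive_definite_on M F"
proof -
  note bo = positive_onD(1)[OF F] and MD = closed_csubspaceD[OF M]
  obtain c0 where c0: "\<And>x. x \<in> M \<Longrightarrow> norm (F x) \<le> c0 * norm x"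
    by (rule bounded_operator_bound[OF bo]) blast
  \<comment> \<open>Enlarging the bound of \<open>F\<close> to at least \<open>\<delta>\<close>
    keeps \<open>1 - \<delta> / c\<close> nonnegative, so that \<open>q\<close> is a genuine square
    root.\<close>
  define c where "c = max c0 \<delta>"
  have c: "norm (F x) \<le> c * norm x" if "x \<in> M" for x
    using c0[OF that] mult_right_mono[of c0 c "norm x"] by (simp add: c_def)
  have "c > 0" "\<delta> \<le> c" using \<open>\<delta> > 0\<close> by (auto simp: c_def)
  define q where "q = sqrt (1 - \<delta> / c)"
  have q: "0 \<le> q" "q < 1" using \<open>c > 0\<close> \<open>\<delta> > 0\<close> \<open>\<delta> \<le> c\<close> by (auto simp: q_def)
  define G where "G x = x - (1/c) *\<^sub>R F x" for x
  have G: "bounded_operator M M G"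
    unfolding G_def scaleC_complex_of_real[symmetric]
    by (intro bounded_operator_minus_op bounded_operator_id bounded_operator_scale bo M) simp
  have "norm (G x) \<le> q * norm x" if "x \<in> M" for x
  proof -
    have "(norm (G x))\<^sup>2 \<le> (norm x)\<^sup>2 - (F x \<bullet> x) / c"
      unfolding G_def by (rule norm_id_minus_scaled_le[OF F M \<open>c > 0\<close> c that])
    also have "\<dots> \<le> (norm x)\<^sup>2 - \<delta> * (norm x)\<^sup>2 / c"
      using lower[OF that] \<open>c > 0\<close> by (simp add: divide_right_mono)
    also have "\<dots> = (q * norm x)\<^sup>2"
      using \<open>c > 0\<close> \<open>\<delta> \<le> c\<close> by (simp add: q_def power_mult_distrib algebra_simps)
    finally show ?thesis using q by (simp add: power2_le_iff_abs_le)
  qed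
  note inv = invertible_on_id_minus[OF M G q this]
  have surj: "\<exists>x\<in>M. F x = y" if "y \<in> M" for y
  proof -
    have "(1/c) *\<^sub>R y \<in> M" using that MD by simp
    with invertible_onD(3,4)[OF inv] obtain x where x: "x \<in> M" "x - G x = (1/c) *\<^sub>R y" by blast
    then have "F x = y" using \<open>c > 0\<close> by (simp add: G_def)
    then show ?thesis using x(1) by blast
  qed
  have lower': "\<delta> * norm x \<le> norm (F x)" if "x \<in> M" for x
  proof (cases "x = 0")
    case False
    have "\<delta> * (norm x)\<^sup>2 \<le> norm (F x) * norm x"
      using lower[OF that] norm_cauchy_schwarz[of "F x" x] by linarith
    then show ?thesis using False by (simp add: power2_eq_square)
  qed simp
  have "invertible_on M F" by (rule invertible_onI[OF M bo surj \<open>\<delta> > 0\<close> lower'])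
  then show ?thesis using F by (simp add: positive_definite_on_def)
qed

section \<open>Square roots of positive operators\<close>

text \<open>
  For a contraction \<open>B\<close> the iteration \<open>Y \<mapsto> (B + Y\<^sup>2) / 2\<close> converges to a contraction \<open>L\<close> with
  \<open>(I - L)\<^sup>2 = I - B\<close>. Its increments are majorised by those of the scalar iteration with \<open>B = 1\<close>.
\<close>

primrec sqrt_iter :: "('a::real_vector \<Rightarrow> 'a) \<Rightarrow> nat \<Rightarrow> 'a \<Rightarrow> 'a" where
  "sqrt_iter B 0 x = 0"
| "sqrt_iter B (Suc n) x = (1/2) *\<^sub>R (B x + sqrt_iter B n (sqrt_iter B n x))"

primrec scalar_iter :: "nat \<Rightarrow> real" where
  "scalar_iter 0 = 0"
| "scalar_iter (Suc n) = (1 + (scalar_iter n)\<^sup>2) / 2"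

lemma scalar_iter_bounds: "0 \<le> scalar_iter n \<and> scalar_iter n \<le> 1"
  by (induction n) (auto simp: power_le_one)

lemma scalar_iter_mono: "incseq scalar_iter"
proof (rule incseq_SucI)
  fix n
  \<comment> \<open>One step of the scalar iteration adds exactly half of this square.\<close>
  have "0 \<le> (1 - scalar_iter n)\<^sup>2" by simp
  then show "scalar_iter n \<le> scalar_iter (Suc n)" by (simp add: power2_diff)
qed

locale contraction_on =
  fixes M :: "'a::chilbert_space set" and B :: "'a \<Rightarrow> 'a"
  assumes M: "closed_csubspace M" and B: "bounded_operator M M B"
    and norm_B: "x \<in> M \<Longrightarrow> norm (B x) \<le> norm x"
begin

abbreviation "Y \<equiv> sqrt_iter B"

lemma Y_bounded: "bounded_operator M M (Y n)"
proof (induction n)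
  case 0
  show ?case by (rule bounded_operatorI[where c = 0]) (auto simp: closed_csubspaceD[OF M])
next
  case (Suc n)
  show ?case
    unfolding sqrt_iter.simps scaleC_complex_of_real[symmetric]
    by (intro bounded_operator_scale bounded_operator_plus B bounded_operator_comp[OF Suc Suc] M)
qed

lemmas YD = bounded_operatorD[OF Y_bounded]

lemma norm_Y: "x \<in> M \<Longrightarrow> norm (Y n x) \<le> scalar_iter n * norm x"
proof (induction n arbitrary: x)
  case (Suc n)
  have "norm (Y n (Y n x)) \<le> scalar_iter n * norm (Y n x)" by (intro Suc YD)
  also have "\<dots> \<le> scalar_iter n * (scalar_iter n * norm x)"
    by (intro mult_left_mono Suc) (simp add: scalar_iter_bounds)
  finally have "norm (B x + Y n (Y n x)) \<le> (1 + (scalar_iter n)\<^sup>2) * norm x"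
    using norm_triangle_ineq[of "B x" "Y n (Y n x)"] norm_B[OF Suc.prems]
    by (simp add: power2_eq_square algebra_simps)
  then show ?case by simp
qed simp

lemma norm_Y_le: "x \<in> M \<Longrightarrow> norm (Y n x) \<le> norm x"
  using norm_Y[of x n] scalar_iter_bounds[of n] mult_right_mono[of "scalar_iter n" 1 "norm x"]
  by simp

text \<open>For consecutive iterates \<open>Y\<close> and \<open>Y'\<close> the splitting
  \<open>Y' Y' - Y Y = Y' (Y' - Y) + (Y' - Y) Y\<close> is the operator form of factoring
  \<open>a\<^sup>2 - b\<^sup>2\<close>, with the factors in an order that calls for no commutation.
  Each factor is bounded by its scalar counterpart.\<close>

lemma Y_increment:
  "x \<in> M \<Longrightarrow> norm (Y (Suc n) x - Y n x) \<le> (scalar_iter (Suc n) - scalar_iter n) * norm x"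
proof (induction n arbitrary: x)
  case 0
  then show ?case using norm_B by simp
next
  case (Suc n)
  define a b where "a = scalar_iter (Suc n)" and "b = scalar_iter n"
  have ab: "0 \<le> b" "b \<le> a"
    using scalar_iter_bounds incseqD[OF scalar_iter_mono, of n "Suc n"] by (auto simp only: a_def b_def)
  define d where "d = Y (Suc n) x - Y n x"
  have mem: "d \<in> M" "Y n x \<in> M" "Y (Suc n) x \<in> M"
    using YD(1)[OF Suc.prems] closed_csubspaceD(5)[OF M] unfolding d_def by (simp_all del: sqrt_iter.simps)
  have "Y (Suc n) (Y (Suc n) x) - Y n (Y n x) =
      Y (Suc n) d + (Y (Suc n) (Y n x) - Y n (Y n x))"
    unfolding d_def by (simp only: bounded_operator_diff[OF Y_bounded M mem(3,2)]) simp
  moreover have "norm (Y (Suc n) d) \<le> a * ((a - b) * norm x)"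
  proof -
    have "norm (Y (Suc n) d) \<le> a * norm d" unfolding a_def by (rule norm_Y[OF mem(1)])
    also have "\<dots> \<le> a * ((a - b) * norm x)"
      using Suc.IH[OF Suc.prems] ab by (intro mult_left_mono) (auto simp: d_def a_def b_def)
    finally show ?thesis .
  qed
  moreover have "norm (Y (Suc n) (Y n x) - Y n (Y n x)) \<le> (a - b) * (b * norm x)"
  proof -
    have "norm (Y (Suc n) (Y n x) - Y n (Y n x)) \<le> (a - b) * norm (Y n x)"
      unfolding a_def b_def by (rule Suc.IH[OF mem(2)])
    also have "\<dots> \<le> (a - b) * (b * norm x)"
      using norm_Y[OF Suc.prems, of n] ab by (intro mult_left_mono) (auto simp: b_def)
    finally show ?thesis .
  qed
  ultimately have "norm (Y (Suc n) (Y (Suc n) x) - Y n (Y n x)) \<le>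
      a * ((a - b) * norm x) + (a - b) * (b * norm x)"
    by (metis add_mono norm_triangle_le)
  also have "\<dots> = (a\<^sup>2 - b\<^sup>2) * norm x" by (simp add: power2_eq_square algebra_simps)
  finally have *: "norm (Y (Suc n) (Y (Suc n) x) - Y n (Y n x)) \<le> (a\<^sup>2 - b\<^sup>2) * norm x" .
  have Y_eq: "Y (Suc (Suc n)) x - Y (Suc n) x = (1/2) *\<^sub>R (Y (Suc n) (Y (Suc n) x) - Y n (Y n x))"
  proof -
    have "Y (Suc (Suc n)) x - Y (Suc n) x =
        (1/2) *\<^sub>R (B x + Y (Suc n) (Y (Suc n) x)) - (1/2) *\<^sub>R (B x + Y n (Y n x))"
      by (rule arg_cong2[where f = minus]) (rule sqrt_iter.simps(2))+
    then show ?thesis by (simp only: scaleR_add_right scaleR_diff_right add_diff_cancel_left)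
  qed
  have scalar_eq: "scalar_iter (Suc (Suc n)) - scalar_iter (Suc n) = (a\<^sup>2 - b\<^sup>2) / 2"
    unfolding a_def b_def by (simp only: scalar_iter.simps(2)[of "Suc n"] scalar_iter.simps(2)[of n])
      (simp add: field_simps)
  show ?case unfolding Y_eq scalar_eq using * by simp
qed

text \<open>The increments are dominated by those of a bounded increasing scalar sequence, whose sum
  telescopes.\<close>

lemma Y_Cauchy: assumes x: "x \<in> M" shows "convergent (\<lambda>n. Y n x)"
proof -
  have "summable (\<lambda>n. (scalar_iter (Suc n) - scalar_iter n) * norm x)"
  proof (intro summable_mult2)
    have "convergent scalar_iter"
      using scalar_iter_bounds by (intro Bseq_mono_convergent[OF BseqI'[of _ 1]])
        (auto intro: incseqD[OF scalar_iter_mono])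
    then show "summable (\<lambda>n. scalar_iter (Suc n) - scalar_iter n)"
      using telescope_summable unfolding convergent_def by blast
  qed
  then have "summable (\<lambda>n. Y (Suc n) x - Y n x)"
    by (rule summable_comparison_test'[where N = 0]) (use Y_increment[OF x] in auto)
  then have "convergent (\<lambda>n. \<Sum>i<n. Y (Suc i) x - Y i x)"
    by (simp add: summable_iff_convergent)
  then show ?thesis unfolding sum_lessThan_telescope[of "\<lambda>n. Y n x"] by simp
qed

definition "L x = lim (\<lambda>n. Y n x)"

lemma L: "x \<in> M \<Longrightarrow> (\<lambda>n. Y n x) \<longlonglongrightarrow> L x"
  using Y_Cauchy unfolding L_def by (simp add: convergent_LIMSEQ_iff)

lemma L_in: "x \<in> M \<Longrightarrow> L x \<in> M"
  using L YD(1) closed_csubspaceD(2)[OF M] by (metis closed_sequentially)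

lemma norm_L: "x \<in> M \<Longrightarrow> norm (L x) \<le> norm x"
  using norm_Y_le by (intro LIMSEQ_le_const2[OF tendsto_norm[OF L]]) auto

lemma L_bounded: "bounded_operator M M L"
proof (rule bounded_operatorI[where c = 1])
  note MD = closed_csubspaceD[OF M]
  show "L (x + y) = L x + L y" if "x \<in> M" "y \<in> M" for x y
    using tendsto_add[OF L[OF that(1)] L[OF that(2)]]
    by (intro LIMSEQ_unique[OF L[OF MD(4)[OF that]]]) (simp add: YD(2)[OF that])
  show "L (a *\<^sub>C x) = a *\<^sub>C L x" if "x \<in> M" for a x
    using bounded_linear.tendsto[OF bounded_linear_scaleC L[OF that]]
    by (intro LIMSEQ_unique[OF L[OF MD(8)[OF that]]]) (simp add: YD(3)[OF that])
qed (auto simp: L_in norm_L)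

text \<open>Limit of the recursion. The composition converges because the iterates are uniformly
  contractive, so \<open>Y n (Y n x - L x)\<close> tends to zero.\<close>

lemma L_fixed_point:
  assumes x: "x \<in> M" shows "2 *\<^sub>R L x = B x + L (L x)"
proof -
  have "(\<lambda>n. Y n (Y n x - L x)) \<longlonglongrightarrow> 0"
  proof (rule Lim_null_comparison[OF _ tendsto_norm_zero[OF LIM_zero[OF L[OF x]]]])
    show "\<forall>\<^sub>F n in sequentially. norm (Y n (Y n x - L x)) \<le> norm (Y n x - L x)"
      using norm_Y_le YD(1) L_in x closed_csubspaceD(5)[OF M] by simp
  qed
  from tendsto_add[OF this L[OF L_in[OF x]]] have "(\<lambda>n. Y n (Y n x)) \<longlonglongrightarrow> L (L x)"
    using x by (simp add: bounded_operator_diff[OF Y_bounded M YD(1) L_in])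
  then have "(\<lambda>n. (1/2) *\<^sub>R (B x + Y n (Y n x))) \<longlonglongrightarrow> (1/2) *\<^sub>R (B x + L (L x))"
    by (intro tendsto_intros)
  moreover have "(\<lambda>n. Y (Suc n) x) \<longlonglongrightarrow> L x" using L[OF x] by (rule LIMSEQ_Suc)
  ultimately have "L x = (1/2) *\<^sub>R (B x + L (L x))" using LIMSEQ_unique by auto
  then have "2 *\<^sub>R L x = 2 *\<^sub>R ((1/2) *\<^sub>R (B x + L (L x)))" by (rule arg_cong)
  then show ?thesis by simp
qed

text \<open>Every iterate is a polynomial in \<open>B\<close>, so it commutes with whatever commutes
  with \<open>B\<close>, and the limit inherits this.\<close>

lemma L_commute:
  assumes C: "bounded_operator M M C" "\<And>x. x \<in> M \<Longrightarrow> C (B x) = B (C x)" and x: "x \<in> M"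
  shows "C (L x) = L (C x)"
proof -
  note CD = bounded_operatorD[OF C(1)]
  have "C (Y n x) = Y n (C x)" if "x \<in> M" for n x
    using that
  proof (induction n arbitrary: x)
    case 0
    then show ?case using bounded_operator_zero[OF C(1) M] by simp
  next
    case (Suc n)
    then show ?case
      using bounded_operatorD(1)[OF B] YD(1) closed_csubspaceD[OF M]
      by (simp add: bounded_operator_scaleR[OF C(1)] CD C(2))
  qed
  then have "(\<lambda>n. C (Y n x)) \<longlonglongrightarrow> L (C x)" using L CD(1) x by simp
  moreover have "(\<lambda>n. C (Y n x)) \<longlonglongrightarrow> C (L x)"
  proof -
    obtain c where c: "\<And>x. x \<in> M \<Longrightarrow> norm (C x) \<le> c * norm x"
      by (rule bounded_operator_bound[OF C(1)]) blast
    have "norm (C (Y n x) - C (L x)) \<le> c * norm (Y n x - L x)" for n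
      using c[of "Y n x - L x"] bounded_operator_diff[OF C(1) M YD(1) L_in, OF x x] x
        closed_csubspaceD(5)[OF M YD(1) L_in, OF x x] by simp
    moreover have "(\<lambda>n. c * norm (Y n x - L x)) \<longlonglongrightarrow> 0"
      using tendsto_mult_right_zero[OF tendsto_norm_zero[OF LIM_zero[OF L[OF x]]]] .
    ultimately show ?thesis by (rule LIM_zero_cancel[OF Lim_null_comparison[OF always_eventually[OF allI]]])
  qed
  ultimately show ?thesis by (rule LIMSEQ_unique[symmetric])
qed

lemma L_selfadjoint:
  assumes sa: "\<And>x y. x \<in> M \<Longrightarrow> y \<in> M \<Longrightarrow> cinner (B x) y = cinner x (B y)"
    and "x \<in> M" "y \<in> M"
  shows "cinner (L x) y = cinner x (L y)"
proof -
  have half: "cinner ((1/2) *\<^sub>R x) y = (1/2) * cinner x y" "cinner x ((1/2) *\<^sub>R y) = (1/2) * cinner x y"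
    for x y :: 'a
    using cinner_scaleC_left[of "1/2" x y] cinner_scaleC_right[of x "1/2" y]
      scaleC_complex_of_real[of "1/2" x] scaleC_complex_of_real[of "1/2" y] by auto
  have Y: "cinner (Y n x) y = cinner x (Y n y)" if "x \<in> M" "y \<in> M" for n x y
    using that
  proof (induction n arbitrary: x y)
    case (Suc n)
    then show ?case by (simp add: half cinner_add_left cinner_add_right sa YD(1))
  qed simp
  have "(\<lambda>n. cinner (Y n x) y) \<longlonglongrightarrow> cinner (L x) y"
    by (rule bounded_linear.tendsto[OF bounded_linear_cinner_left L[OF \<open>x \<in> M\<close>]])
  moreover have "(\<lambda>n. cinner x (Y n y)) \<longlonglongrightarrow> cinner x (L y)"
    unfolding cinner_commute[of x]
    by (intro tendsto_cnj bounded_linear.tendsto[OF bounded_linear_cinner_left L[OF \<open>y \<in> M\<close>]])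
  ultimately show ?thesis using Y assms(2,3) by (simp add: LIMSEQ_unique)
qed

end

text \<open>With \<open>B = I - F / c\<close> the fixed point equation says that the square of
  \<open>I - L\<close> is \<open>F / c\<close>, so \<open>sqrt c\<close> times \<open>I - L\<close>
  is a root. The commutation clause is kept for the uniqueness proof: another root of
  \<open>F\<close> commutes with \<open>F\<close> and therefore with this one.\<close>

lemma ex_sqrt_on:
  assumes F: "positive_on M F" and M: "closed_csubspace M"
  obtains S where "positive_on M S" "\<And>x. x \<in> M \<Longrightarrow> S (S x) = F x"
    "\<And>C x. bounded_operator M M C \<Longrightarrow> (\<And>x. x \<in> M \<Longrightarrow> C (F x) = F (C x)) \<Longrightarrow> x \<in> M \<Longrightarrow>
      C (S x) = S (C x)"
proof -
  note bo = positive_onD(1)[OF F] and MD = closed_csubspaceD[OF M]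
  obtain c where c: "c > 0" "\<And>x. x \<in> M \<Longrightarrow> norm (F x) \<le> c * norm x"
    by (rule bounded_operator_bound[OF bo]) blast
  define B where "B x = x - (1/c) *\<^sub>R F x" for x
  interpret contraction_on M B
  proof
    show "bounded_operator M M B"
      unfolding B_def scaleC_complex_of_real[symmetric]
      by (intro bounded_operator_minus_op bounded_operator_id bounded_operator_scale bo M) simp
    show "norm (B x) \<le> norm x" if "x \<in> M" for x
    proof -
      have "(norm (B x))\<^sup>2 \<le> (norm x)\<^sup>2 - (F x \<bullet> x) / c"
        unfolding B_def by (rule norm_id_minus_scaled_le[OF F M c(1) c(2) that])
      also have "\<dots> \<le> (norm x)\<^sup>2" using positive_onD(2)[OF F that] c(1) by simp
      finally show ?thesis by (simp add: power2_le_iff_abs_le)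
    qed
  qed (rule M)
  define S where "S x = sqrt c *\<^sub>R (x - L x)" for x
  have S_bo: "bounded_operator M M S"
    unfolding S_def scaleC_complex_of_real[symmetric]
    by (intro bounded_operator_minus_op bounded_operator_id bounded_operator_scale L_bounded M) simp
  show ?thesis
  proof (rule that)
    have B_sa: "cinner (B x) y = cinner x (B y)" if "x \<in> M" "y \<in> M" for x y
      using positive_on_cinner_commute[OF F M that] unfolding B_def scaleC_complex_of_real[symmetric]
      by (simp add: cinner_diff_left cinner_diff_right cinner_scaleC_left cinner_scaleC_right)
    show "positive_on M S"
    proof (rule positive_onI[OF S_bo])
      fix x assume x: "x \<in> M"
      show "cinner (S x) x = cinner x (S x)"
        using L_selfadjoint[OF B_sa x x] unfolding S_def scaleC_complex_of_real[symmetric]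
        by (simp add: cinner_diff_left cinner_diff_right cinner_scaleC_left cinner_scaleC_right)
      have "L x \<bullet> x \<le> norm (L x) * norm x" by (rule norm_cauchy_schwarz)
      also have "\<dots> \<le> norm x * norm x" by (intro mult_right_mono norm_L x) simp
      finally show "0 \<le> S x \<bullet> x"
        using c(1) by (simp add: S_def inner_diff_left power2_eq_square flip: power2_norm_eq_inner)
    qed
    fix x assume x: "x \<in> M"
    have "S (S x) = c *\<^sub>R (x - 2 *\<^sub>R L x + L (L x))"
      using x MD L_in c(1) unfolding S_def
      by (simp add: bounded_operator_scaleR[OF L_bounded] bounded_operator_diff[OF L_bounded M]
          scaleR_diff_right scaleR_add_right scaleR_2 algebra_simps)
    also have "\<dots> = c *\<^sub>R (x - B x)" using L_fixed_point[OF x] by simp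
    also have "\<dots> = F x" using c(1) by (simp add: B_def)
    finally show "S (S x) = F x" .
  next
    fix C x assume C: "bounded_operator M M C" "\<And>x. x \<in> M \<Longrightarrow> C (F x) = F (C x)" and x: "x \<in> M"
    note Csimps = bounded_operator_scaleR[OF C(1)] bounded_operator_diff[OF C(1) M]
    have "C (B x) = B (C x)" if "x \<in> M" for x
      using that MD bounded_operatorD(1)[OF bo] unfolding B_def by (simp add: Csimps C(2))
    from L_commute[OF C(1) this x] show "C (S x) = S (C x)"
      using x MD L_in unfolding S_def by (simp add: Csimps)
  qed
qed

text \<open>Two positive roots \<open>S\<close> and \<open>T\<close> commute, so
  \<open>y = S x - T x\<close> is annihilated by \<open>S + T\<close>. Both forms then vanish at
  \<open>y\<close>, hence \<open>S y = T y = 0\<close>, and self-adjointness gives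
  \<open>y \<bullet> y = x \<bullet> S y - x \<bullet> T y = 0\<close>. This uniqueness gives
  meaning to the \<open>THE\<close> in \<open>sqrt_on\<close>.\<close>

lemma
  assumes F: "positive_on M F" and M: "closed_csubspace M"
  shows positive_on_sqrt_on: "positive_on M (sqrt_on M F)"
    and sqrt_on_sqrt_on: "x \<in> M \<Longrightarrow> sqrt_on M F (sqrt_on M F x) = F x"
proof -
  note bo = positive_onD(1)[OF F] and MD = closed_csubspaceD[OF M]
  obtain S where S: "positive_on M S" "\<And>x. x \<in> M \<Longrightarrow> S (S x) = F x"
    and comm: "\<And>C x. bounded_operator M M C \<Longrightarrow> (\<And>x. x \<in> M \<Longrightarrow> C (F x) = F (C x)) \<Longrightarrow> x \<in> M \<Longrightarrow>
      C (S x) = S (C x)"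
    by (rule ex_sqrt_on[OF F M]) blast
  note Sbo = positive_onD(1)[OF S(1)]
  have Sin: "S x \<in> M" if "x \<in> M" for x using bounded_operatorD(1)[OF Sbo that] .
  have unique: "T x = S x" if T: "positive_on M T" "\<And>x. x \<in> M \<Longrightarrow> T (T x) = F x" and x: "x \<in> M" for T x
  proof -
    note Tbo = positive_onD(1)[OF T(1)]
    have Tin: "T x \<in> M" if "x \<in> M" for x using bounded_operatorD(1)[OF Tbo that] .
    have TS: "T (S x) = S (T x)" if "x \<in> M" for x
      by (rule comm[OF Tbo _ that]) (simp add: T(2)[symmetric] Tin)
    define y where "y = S x - T x"
    have y: "y \<in> M" using x Sin Tin MD by (simp add: y_def)
    have "S y + T y = 0"
      unfolding y_def using x Sin Tin
      by (simp add: bounded_operator_diff[OF Sbo M] bounded_operator_diff[OF Tbo M] TS S(2) T(2))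
    then have "S y \<bullet> y + T y \<bullet> y = 0" by (metis inner_add_left inner_zero_left)
    then have zero: "S y \<bullet> y = 0" "T y \<bullet> y = 0"
      using positive_onD(2)[OF S(1) y] positive_onD(2)[OF T(1) y] by auto
    have null: "P y = 0" if P: "positive_on M P" "P y \<bullet> y = 0" for P
    proof -
      obtain c where c: "c > 0" "\<And>x. x \<in> M \<Longrightarrow> norm (P x) \<le> c * norm x"
        by (rule bounded_operator_bound[OF positive_onD(1)[OF P(1)]]) blast
      from positive_on_norm_le[OF P(1) M c y] P(2) show ?thesis by simp
    qed
    have "y \<bullet> y = (S x - T x) \<bullet> y" by (simp add: y_def)
    also have "\<dots> = x \<bullet> S y - x \<bullet> T y"
      by (simp add: inner_diff_left positive_on_inner_commute[OF S(1) M x y]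
          positive_on_inner_commute[OF T(1) M x y])
    also have "\<dots> = 0" using null[OF S(1) zero(1)] null[OF T(1) zero(2)] by simp
    finally show ?thesis by (simp add: y_def)
  qed
  let ?P = "\<lambda>S. positive_on M S \<and> S \<in> extensional M \<and> (\<forall>x\<in>M. S (S x) = F x)"
  have "\<exists>!S. ?P S"
  proof (rule ex1I[of _ "restrict S M"])
    have "bounded_operator M M (restrict S M)" by (rule bounded_operator_cong[OF Sbo M]) simp
    then show "?P (restrict S M)" using S Sin by (simp add: positive_on_def)
    fix T assume "?P T"
    then show "T = restrict S M" by (intro extensionalityI[of _ M]) (auto intro: unique)
  qed
  from theI'[OF this, folded sqrt_on_def] have "?P (sqrt_on M F)" .
  then show "positive_on M (sqrt_on M F)" "x \<in> M \<Longrightarrow> sqrt_on M F (sqrt_on M F x) = F x" by blast+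
qed

lemma norm_sqrt_on:
  assumes F: "positive_on M F" and M: "closed_csubspace M" and x: "x \<in> M"
  shows "(norm (sqrt_on M F x))\<^sup>2 = F x \<bullet> x"
proof -
  have "sqrt_on M F x \<in> M"
    by (rule bounded_operatorD(1)[OF positive_onD(1)[OF positive_on_sqrt_on[OF F M]] x])
  from positive_on_inner_commute[OF positive_on_sqrt_on[OF F M] M this x]
  show ?thesis by (simp add: power2_norm_eq_inner sqrt_on_sqrt_on[OF F M x])
qed

lemma positive_definite_onD:
  assumes "positive_definite_on M F"
  shows "positive_on M F" "invertible_on M F"
  using assms by (auto simp: positive_definite_on_def)

text \<open>Surjectivity and the lower bound pass from \<open>F\<close> to its root \<open>S\<close>
  because \<open>F\<close> is \<open>S\<close> applied twice:
  \<open>\<delta> * norm x \<le> norm (S (S x)) \<le> c * norm (S x)\<close>.\<close>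

lemma positive_definite_on_sqrt_on:
  assumes F: "positive_definite_on M F" and M: "closed_csubspace M"
  shows "positive_definite_on M (sqrt_on M F)"
proof -
  note F1 = positive_definite_onD(1)[OF F] and F2 = positive_definite_onD(2)[OF F]
  let ?S = "sqrt_on M F"
  note S = positive_on_sqrt_on[OF F1 M] and sq = sqrt_on_sqrt_on[OF F1 M]
  have Sin: "?S x \<in> M" if "x \<in> M" for x using bounded_operatorD(1)[OF positive_onD(1)[OF S] that] .
  obtain c where c: "c > 0" "\<And>x. x \<in> M \<Longrightarrow> norm (?S x) \<le> c * norm x"
    by (rule bounded_operator_bound[OF positive_onD(1)[OF S]]) blast
  obtain \<delta> where \<delta>: "\<delta> > 0" "\<And>x. x \<in> M \<Longrightarrow> \<delta> * norm x \<le> norm (F x)"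
    by (rule invertible_on_lower_bound[OF F2]) blast
  have "invertible_on M ?S"
  proof (rule invertible_onI[OF M positive_onD(1)[OF S]])
    show "\<exists>x\<in>M. ?S x = y" if "y \<in> M" for y
      using invertible_onD(3,4)[OF F2 that] sq Sin by metis
    show "\<delta> / c * norm x \<le> norm (?S x)" if "x \<in> M" for x
      using \<delta>(2)[OF that] c(2)[OF Sin[OF that]] sq[OF that] c(1) by (simp add: field_simps)
  qed (use \<delta> c in auto)
  then show ?thesis using S by (simp add: positive_definite_on_def)
qed

lemma
  assumes F: "positive_definite_on M F" and M: "closed_csubspace M"
  shows bounded_operator_inv_sqrt_on: "bounded_operator M M (inv_sqrt_on M F)"
    and inv_sqrt_on_in: "x \<in> M \<Longrightarrow> inv_sqrt_on M F x \<in> M"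
    and sqrt_on_inv_sqrt_on: "x \<in> M \<Longrightarrow> sqrt_on M F (inv_sqrt_on M F x) = x"
    and inv_sqrt_on_sqrt_on: "x \<in> M \<Longrightarrow> inv_sqrt_on M F (sqrt_on M F x) = x"
    and sqrt_on_in: "x \<in> M \<Longrightarrow> sqrt_on M F x \<in> M"
proof -
  note inv = invertible_onD[OF positive_definite_onD(2)[OF positive_definite_on_sqrt_on[OF F M]],
      folded inv_sqrt_on_def]
  show "bounded_operator M M (inv_sqrt_on M F)" by (rule inv(2))
  show "x \<in> M \<Longrightarrow> inv_sqrt_on M F x \<in> M" by (rule inv(3))
  show "x \<in> M \<Longrightarrow> sqrt_on M F (inv_sqrt_on M F x) = x" by (rule inv(4))
  show "x \<in> M \<Longrightarrow> inv_sqrt_on M F (sqrt_on M F x) = x" by (rule inv(5))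
  show "x \<in> M \<Longrightarrow> sqrt_on M F x \<in> M" by (rule bounded_operatorD(1)[OF inv(1)])
qed

text \<open>By the second identity the inverse root carries the given norm into the form of
  \<open>F\<close>. This is the purpose of the inverse roots in \<open>X2\<close>, \<open>X3\<close>
  and \<open>X5\<close>: they make the coupling isometric.\<close>

lemma
  assumes F: "positive_definite_on M F" and M: "closed_csubspace M" and x: "x \<in> M"
  shows apply_inv_sqrt_on: "F (inv_sqrt_on M F x) = sqrt_on M F x"
    and inner_apply_inv_sqrt_on: "F (inv_sqrt_on M F x) \<bullet> inv_sqrt_on M F x = (norm x)\<^sup>2"
proof -
  note sq = sqrt_on_sqrt_on[OF positive_definite_onD(1)[OF F] M]
  note facts = inv_sqrt_on_in[OF F M] sqrt_on_inv_sqrt_on[OF F M]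
  show "F (inv_sqrt_on M F x) = sqrt_on M F x"
    using sq[OF facts(1)[OF x]] by (simp add: facts(2)[OF x])
  show "F (inv_sqrt_on M F x) \<bullet> inv_sqrt_on M F x = (norm x)\<^sup>2"
    using norm_sqrt_on[OF positive_definite_onD(1)[OF F] M facts(1)[OF x]] facts(2)[OF x] by simp
qed

section \<open>Resolvents and transfer functions\<close>

lemma bounded_bilinear_scaleC:
  "bounded_bilinear (\<lambda>a (x :: 'a::complex_inner). a *\<^sub>C x)"
proof
  show "\<exists>K. \<forall>a (x :: 'a). norm (a *\<^sub>C x) \<le> norm a * norm x * K"
    by (intro exI[of _ 1]) (simp add: norm_scaleC)
  show "(r *\<^sub>R a) *\<^sub>C x = r *\<^sub>R (a *\<^sub>C x)" for r :: real and a and x :: 'a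
    by (simp add: scaleR_conv_of_real flip: scaleC_scaleC scaleC_complex_of_real)
qed (simp_all add: scaleC_add_left scaleC_add_right scaleC_scaleR_commute)

lemmas tendsto_scaleC [tendsto_intros] = bounded_bilinear.tendsto[OF bounded_bilinear_scaleC]
lemmas continuous_on_scaleC [continuous_intros] =
  bounded_bilinear.continuous_on[OF bounded_bilinear_scaleC]

text \<open>\<open>X1\<close> contracts only the norm weighted by \<open>D\<close>, so for the given
  norm its powers are merely bounded. That still makes the Neumann series of the resolvent converge
  throughout the disc.\<close>

locale power_bounded_operator =
  fixes A :: "'x::chilbert_space \<Rightarrow> 'x" and K :: real
  assumes A: "bounded_operator UNIV UNIV A" and norm_power_A: "norm ((A ^^ n) x) \<le> K * norm x"
begin

lemmas AD = bounded_operatorD(2,3)[OF A UNIV_I, simplified]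

lemma power_A_add: "(A ^^ n) (x + y) = (A ^^ n) x + (A ^^ n) y"
  by (induction n) (simp_all add: AD)

lemma power_A_scaleC: "(A ^^ n) (a *\<^sub>C x) = a *\<^sub>C (A ^^ n) x"
  by (induction n) (simp_all add: AD)

definition Res :: "complex \<Rightarrow> 'x \<Rightarrow> 'x" where
  "Res z x = (\<Sum>n. z ^ n *\<^sub>C (A ^^ n) x)"

context
  fixes z :: complex assumes z: "z \<in> ball 0 1"
begin

lemma summable_norm_Res: "summable (\<lambda>n. norm (z ^ n *\<^sub>C (A ^^ n) x))"
proof (rule summable_comparison_test')
  show "summable (\<lambda>n. cmod z ^ n * (K * norm x))"
    using z by (intro summable_mult2 summable_geometric) simp
  show "norm (norm (z ^ n *\<^sub>C (A ^^ n) x)) \<le> cmod z ^ n * (K * norm x)" for n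
    by (simp add: norm_scaleC norm_power mult_left_mono norm_power_A)
qed

lemma Res_sums: "(\<lambda>n. z ^ n *\<^sub>C (A ^^ n) x) sums Res z x"
  unfolding Res_def by (rule summable_sums[OF summable_norm_cancel[OF summable_norm_Res]])

lemma Res_add: "Res z (x + y) = Res z x + Res z y"
  using sums_add[OF Res_sums Res_sums, of x y]
  by (intro sums_unique2[OF Res_sums]) (simp add: power_A_add scaleC_add_right)

lemma Res_scaleC: "Res z (a *\<^sub>C x) = a *\<^sub>C Res z x"
  using bounded_linear.sums[OF bounded_linear_scaleC Res_sums, of a x]
  by (intro sums_unique2[OF Res_sums]) (simp add: power_A_scaleC scaleC_scaleC mult.commute)

lemma norm_Res_le: "norm (Res z x) \<le> K / (1 - cmod z) * norm x"
proof -
  have "norm (Res z x) \<le> (\<Sum>n. norm (z ^ n *\<^sub>C (A ^^ n) x))"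
    unfolding Res_def by (rule summable_norm[OF summable_norm_Res])
  also have "\<dots> \<le> (\<Sum>n. cmod z ^ n * (K * norm x))"
    using z
    by (intro suminf_le summable_norm_Res summable_mult2 summable_geometric)
      (simp_all add: norm_scaleC norm_power mult_left_mono norm_power_A)
  also have "\<dots> = 1 / (1 - cmod z) * (K * norm x)"
    using z by (subst suminf_mult2[symmetric]) (simp_all add: suminf_geometric summable_geometric)
  finally show ?thesis by (simp add: field_simps)
qed

lemma bounded_operator_Res: "bounded_operator UNIV UNIV (Res z)"
  by (rule bounded_operatorI[where c = "K / (1 - cmod z)"])
    (simp_all add: Res_add Res_scaleC norm_Res_le[unfolded times_divide_eq_left])

lemma Res_commute: "Res z (A x) = A (Res z x)"
  using bounded_linear.sums[OF bounded_operator_imp_bounded_linear[OF A] Res_sums, of x]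
  by (intro sums_unique2[OF Res_sums]) (simp add: AD funpow_swap1)

lemma Res_eq: "Res z x = x + z *\<^sub>C A (Res z x)"
proof -
  have "(\<lambda>n. z *\<^sub>C A (z ^ n *\<^sub>C (A ^^ n) x)) sums (z *\<^sub>C A (Res z x))"
    by (intro bounded_linear.sums[OF bounded_linear_scaleC]
        bounded_linear.sums[OF bounded_operator_imp_bounded_linear[OF A] Res_sums])
  then have "(\<lambda>n. z ^ Suc n *\<^sub>C (A ^^ Suc n) x) sums (z *\<^sub>C A (Res z x))"
    by (simp add: AD scaleC_scaleC)
  moreover have "(\<lambda>n. z ^ Suc n *\<^sub>C (A ^^ Suc n) x) sums (Res z x - x)"
    using Res_sums[of x] by (subst sums_Suc_iff) simp
  ultimately have "z *\<^sub>C A (Res z x) = Res z x - x" by (rule sums_unique2)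
  then show ?thesis by simp
qed

lemma Res_minus: "Res z x - z *\<^sub>C A (Res z x) = x"
  using Res_eq[of x] unfolding diff_eq_eq .

lemma Res_id_minus: "Res z (x - z *\<^sub>C A x) = x"
proof -
  have "Res z (x - z *\<^sub>C A x) = Res z x - z *\<^sub>C A (Res z x)"
    by (simp add: bounded_operator_diff[OF bounded_operator_Res] Res_scaleC Res_commute)
  then show ?thesis using Res_minus[of x] by simp
qed

lemma Res_eqI: "y - z *\<^sub>C A y = x \<Longrightarrow> Res z x = y"
  using Res_id_minus[of y] by simp

lemma inv_id_minus_eq_Res: "inv (\<lambda>x. x - z *\<^sub>C A x) = Res z"
proof (rule inv_unique_comp)
  show "(\<lambda>x. x - z *\<^sub>C A x) \<circ> Res z = id"
    by (auto simp: fun_eq_iff Res_minus)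
  show "Res z \<circ> (\<lambda>x. x - z *\<^sub>C A x) = id"
    by (auto simp: fun_eq_iff Res_id_minus)
qed

lemma invertible_id_minus: "invertible_on UNIV (\<lambda>x. x - z *\<^sub>C A x)"
proof -
  have "bij (\<lambda>x. x - z *\<^sub>C A x)"
  proof (rule o_bij)
    show "(\<lambda>x. x - z *\<^sub>C A x) \<circ> Res z = id"
      by (auto simp: fun_eq_iff Res_minus)
    show "Res z \<circ> (\<lambda>x. x - z *\<^sub>C A x) = id"
      by (auto simp: fun_eq_iff Res_id_minus)
  qed
  then show ?thesis
    unfolding invertible_on_def inv_id_minus_eq_Res
    by (intro conjI bounded_operator_Res bounded_operator_minus_op bounded_operator_id
        bounded_operator_scale A) auto
qed

end

text \<open>With \<open>y = Res z x\<close>, apply \<open>Res w\<close> to the identity \<open>y - z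
  *\<^sub>C A y = (y - w *\<^sub>C A y) + (w - z) *\<^sub>C A y\<close>.\<close>

lemma Res_diff:
  assumes "w \<in> ball 0 1" "z \<in> ball 0 1"
  shows "Res w x - Res z x = (w - z) *\<^sub>C Res w (A (Res z x))"
proof -
  let ?y = "Res z x"
  have "Res w x = Res w (?y - z *\<^sub>C A ?y)" by (simp only: Res_minus[OF assms(2)])
  also have "?y - z *\<^sub>C A ?y = (?y - w *\<^sub>C A ?y) + (w - z) *\<^sub>C A ?y"
    by (simp add: scaleC_diff_left)
  also have "Res w \<dots> = ?y + (w - z) *\<^sub>C Res w (A ?y)"
    by (simp only: Res_add[OF assms(1)] Res_scaleC[OF assms(1)] Res_id_minus[OF assms(1)])
  finally show ?thesis by simp
qed

text \<open>As \<open>w\<close> tends to \<open>z\<close> this exhibits the square of the resolvent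
  as the derivative of \<open>z *\<^sub>C Res z x\<close>, which explains the operator
  \<open>L\<close> in the proof of \<open>operator_analytic_transfer\<close>.\<close>

lemma scaled_Res_diff:
  assumes "w \<in> ball 0 1" "z \<in> ball 0 1"
  shows "w *\<^sub>C Res w x - z *\<^sub>C Res z x = (w - z) *\<^sub>C Res w (Res z x)"
proof -
  let ?y = "Res z x"
  have "w *\<^sub>C Res w x - z *\<^sub>C ?y = w *\<^sub>C (Res w x - ?y) + (w - z) *\<^sub>C ?y"
    by (simp add: scaleC_diff_left scaleC_diff_right)
  also have "w *\<^sub>C (Res w x - ?y) = (w - z) *\<^sub>C (w *\<^sub>C A (Res w ?y))"
    by (simp add: Res_diff[OF assms] scaleC_scaleC mult.commute Res_commute[OF assms(1)])
  also have "\<dots> + (w - z) *\<^sub>C ?y = (w - z) *\<^sub>C Res w ?y"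
    unfolding scaleC_add_right[symmetric] using Res_eq[OF assms(1), of ?y] by (simp add: add.commute)
  finally show ?thesis .
qed

text \<open>By the two resolvent identities the difference quotient differs from
  \<open>C (Res z (Res z (B u)))\<close> exactly by \<open>w - z\<close> times a composition whose
  norm stays bounded for \<open>w\<close> near \<open>z\<close>.\<close>

lemma operator_analytic_transfer:
  assumes D: "bounded_operator U Y D" and B: "bounded_operator U UNIV B"
    and C: "bounded_operator UNIV Y C" and Y: "closed_csubspace Y"
  shows "operator_analytic U Y (\<lambda>z u. D u + z *\<^sub>C C (Res z (B u)))"
  unfolding operator_analytic_def
proof
  fix z :: complex assume z: "z \<in> ball 0 1"
  define E where "E u = A (Res z (Res z (B u)))" for u
  have E: "bounded_operator U UNIV E"
    unfolding E_def using bounded_operator_comp[OF _ A] bounded_operator_comp[OF _ bounded_operator_Res[OF z]] B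
    by blast
  obtain k where k: "k > 0" "\<And>u. u \<in> U \<Longrightarrow> norm (E u) \<le> k * norm u"
    by (rule bounded_operator_bound[OF E]) blast
  obtain c where c: "c > 0" "\<And>x. norm (C x) \<le> c * norm x"
    by (rule bounded_operator_bound[OF C]) blast
  define L where "L u = C (Res z (Res z (B u)))" for u
  have "bounded_operator U Y L"
    unfolding L_def using bounded_operator_comp[OF _ C] bounded_operator_comp[OF _ bounded_operator_Res[OF z]] B
    by blast
  moreover let ?quotient = "\<lambda>w u. (1 / (w - z)) *\<^sub>C (D u + w *\<^sub>C C (Res w (B u)) - (D u + z *\<^sub>C C (Res z (B u))))"
  let ?close = "\<lambda>d e. \<forall>w\<in>ball 0 1. w \<noteq> z \<and> cmod (w - z) < d \<longrightarrow>
      (\<forall>u\<in>U. norm (?quotient w u - L u) \<le> e * norm u)"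
  have "\<forall>e>0. \<exists>d>0. ?close d e"
  proof (intro allI impI)
    fix e :: real assume "e > 0"
    \<comment> \<open>Half the distance from \<open>z\<close> to the unit circle, so that
      \<open>1 - cmod w \<ge> s\<close> for every \<open>w\<close> within \<open>s\<close> of
      \<open>z\<close>.\<close>
    define s where "s = (1 - cmod z) / 2"
    have s: "s > 0" using z by (simp add: s_def)
    define m where "m = c * (\<bar>K\<bar> / s) * k"
    have m: "m \<ge> 0" using c(1) k(1) s by (simp add: m_def)
    \<comment> \<open>\<open>m\<close> bounds the operator sending \<open>u\<close> to
      \<open>C (Res w (E u))\<close>; dividing by \<open>m + 1\<close> covers the case
      \<open>m = 0\<close>.\<close>
    define d where "d = min s (e / (m + 1))"
    have d: "d > 0" using s m \<open>e > 0\<close> by (simp add: d_def)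
    show "\<exists>d>0. ?close d e"
    proof (intro exI[of _ d] conjI ballI impI d)
      fix w u assume w: "w \<in> ball 0 1" "w \<noteq> z \<and> cmod (w - z) < d" and u: "u \<in> U"
      note CD = bounded_operatorD(2,3)[OF C UNIV_I, simplified] bounded_operator_diff[OF C]
      define y where "y = Res z (B u)"
      have "D u + w *\<^sub>C C (Res w (B u)) - (D u + z *\<^sub>C C (Res z (B u))) = (w - z) *\<^sub>C C (Res w y)"
        using scaled_Res_diff[OF w(1) z, of "B u"]
        by (simp add: y_def flip: CD)
      then have "?quotient w u - L u =
          C (Res w y) - C (Res z y)"
        using w(2) by (simp add: scaleC_scaleC L_def y_def)
      also have "\<dots> = (w - z) *\<^sub>C C (Res w (E u))"
        using Res_diff[OF w(1) z, of y] by (simp add: E_def y_def flip: CD)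
      finally have eq: "?quotient w u - L u =
          (w - z) *\<^sub>C C (Res w (E u))" .
      have "cmod w \<le> cmod z + cmod (w - z)" using norm_triangle_sub[of w z] by simp
      also have "\<dots> \<le> cmod z + s" using w(2) by (simp add: d_def)
      finally have ws: "1 - cmod w \<ge> s" by (simp add: s_def field_simps)
      have "norm (C (Res w (E u))) \<le> c * norm (Res w (E u))" by (rule c(2))
      also have "norm (Res w (E u)) \<le> K / (1 - cmod w) * norm (E u)" by (rule norm_Res_le[OF w(1)])
      also have "\<dots> \<le> \<bar>K\<bar> / s * norm (E u)"
        using ws s by (intro mult_right_mono frac_le) auto
      also have "\<dots> \<le> \<bar>K\<bar> / s * (k * norm u)" using s by (intro mult_left_mono k(2) u) auto
      finally have "norm (C (Res w (E u))) \<le> m * norm u"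
        using c(1) by (simp add: m_def mult.assoc)
      then have "norm ((w - z) *\<^sub>C C (Res w (E u))) \<le> d * (m * norm u)"
        unfolding norm_scaleC using w(2) d by (intro mult_mono) auto
      also have "\<dots> \<le> e / (m + 1) * (m * norm u)" using m by (intro mult_right_mono) (auto simp: d_def)
      also have "\<dots> = m / (m + 1) * (e * norm u)" by simp
      also have "\<dots> \<le> 1 * (e * norm u)" using m \<open>e > 0\<close> by (intro mult_right_mono) auto
      finally show "norm (?quotient w u - L u)
          \<le> e * norm u"
        unfolding eq by simp
    qed
  qed
  ultimately show "\<exists>L. bounded_operator U Y L \<and> (\<forall>e>0. \<exists>d>0. \<forall>w\<in>ball 0 1. w \<noteq> z \<and> cmod (w - z) < d \<longrightarrow>
      (\<forall>u\<in>U. norm (?quotient w u - L u) \<le> e * norm u))"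
    by blast
qed

end

section \<open>Vector-valued analytic functions\<close>

text \<open>Differentiating one vector at a time is enough for the feedback loop: combined with
  local norm bounds this notion is stable under applying and inverting operator functions, and it
  suffices for Cauchy's formula.\<close>

definition vec_differentiable :: "(complex \<Rightarrow> 'a::chilbert_space) \<Rightarrow> complex \<Rightarrow> bool" where
  "vec_differentiable f z \<longleftrightarrow> (\<exists>L. ((\<lambda>w. (1 / (w - z)) *\<^sub>C (f w - f z)) \<longlongrightarrow> L) (at z))"

lemma vec_differentiable_isCont:
  assumes "vec_differentiable f z"
  shows "isCont f z"
proof -
  obtain L where L: "((\<lambda>w. (1 / (w - z)) *\<^sub>C (f w - f z)) \<longlongrightarrow> L) (at z)"
    using assms unfolding vec_differentiable_def by blast
  have "((\<lambda>w. (w - z) *\<^sub>C ((1 / (w - z)) *\<^sub>C (f w - f z)) + f z) \<longlongrightarrow> (z - z) *\<^sub>C L + f z) (at z)"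
    by (intro tendsto_intros L)
  then have "((\<lambda>w. (w - z) *\<^sub>C ((1 / (w - z)) *\<^sub>C (f w - f z)) + f z) \<longlongrightarrow> f z) (at z)" by simp
  moreover have "\<forall>\<^sub>F w in at z. (w - z) *\<^sub>C ((1 / (w - z)) *\<^sub>C (f w - f z)) + f z = f w"
    by (auto simp: eventually_at_filter scaleC_scaleC)
  ultimately show ?thesis unfolding isCont_def by (rule Lim_transform_eventually)
qed

lemma vec_differentiable_const: "vec_differentiable (\<lambda>w. c) z"
  unfolding vec_differentiable_def by (intro exI[of _ 0]) simp

lemma vec_differentiable_add:
  assumes "vec_differentiable f z" "vec_differentiable g z"
  shows "vec_differentiable (\<lambda>w. f w + g w) z"
proof -
  obtain L L' where "((\<lambda>w. (1 / (w - z)) *\<^sub>C (f w - f z)) \<longlongrightarrow> L) (at z)"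
    "((\<lambda>w. (1 / (w - z)) *\<^sub>C (g w - g z)) \<longlongrightarrow> L') (at z)"
    using assms unfolding vec_differentiable_def by blast
  from tendsto_add[OF this] show ?thesis
    unfolding vec_differentiable_def
    by (intro exI[of _ "L + L'"]) (simp add: add_diff_add scaleC_add_right)
qed

lemma vec_differentiable_ident_scaleC:
  assumes "vec_differentiable f z"
  shows "vec_differentiable (\<lambda>w. w *\<^sub>C f w) z"
proof -
  obtain L where L: "((\<lambda>w. (1 / (w - z)) *\<^sub>C (f w - f z)) \<longlongrightarrow> L) (at z)"
    using assms unfolding vec_differentiable_def by blast
  have "((\<lambda>w. z *\<^sub>C ((1 / (w - z)) *\<^sub>C (f w - f z)) + f w) \<longlongrightarrow> z *\<^sub>C L + f z) (at z)"
    by (intro tendsto_intros L) (use vec_differentiable_isCont[OF assms] in \<open>simp add: isCont_def\<close>)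
  moreover have "\<forall>\<^sub>F w in at z. z *\<^sub>C ((1 / (w - z)) *\<^sub>C (f w - f z)) + f w =
      (1 / (w - z)) *\<^sub>C (w *\<^sub>C f w - z *\<^sub>C f z)"
    unfolding eventually_at_filter
  proof (intro always_eventually allI impI)
    fix w assume "w \<noteq> z"
    then have "f w = (1 / (w - z)) *\<^sub>C ((w - z) *\<^sub>C f w)" by (simp add: scaleC_scaleC)
    then have "z *\<^sub>C ((1 / (w - z)) *\<^sub>C (f w - f z)) + f w =
        (1 / (w - z)) *\<^sub>C (z *\<^sub>C (f w - f z)) + (1 / (w - z)) *\<^sub>C ((w - z) *\<^sub>C f w)"
      by (metis scaleC_scaleC mult.commute)
    also have "\<dots> = (1 / (w - z)) *\<^sub>C (w *\<^sub>C f w - z *\<^sub>C f z)"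
      unfolding scaleC_add_right[symmetric] by (simp add: scaleC_diff_left scaleC_diff_right)
    finally show "z *\<^sub>C ((1 / (w - z)) *\<^sub>C (f w - f z)) + f w =
      (1 / (w - z)) *\<^sub>C (w *\<^sub>C f w - z *\<^sub>C f z)" .
  qed
  ultimately show ?thesis
    unfolding vec_differentiable_def by (blast intro: Lim_transform_eventually)
qed

lemma vec_differentiable_cong:
  assumes "vec_differentiable f z" "open S" "z \<in> S" "\<And>w. w \<in> S \<Longrightarrow> f w = g w"
  shows "vec_differentiable g z"
proof -
  obtain L where L: "((\<lambda>w. (1 / (w - z)) *\<^sub>C (f w - f z)) \<longlongrightarrow> L) (at z)"
    using assms unfolding vec_differentiable_def by blast
  have "\<forall>\<^sub>F w in at z. w \<in> S" using assms(2,3) by (simp add: eventually_at_in_open')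
  then have "\<forall>\<^sub>F w in at z. (1 / (w - z)) *\<^sub>C (f w - f z) = (1 / (w - z)) *\<^sub>C (g w - g z)"
    by eventually_elim (simp add: assms)
  with L show ?thesis unfolding vec_differentiable_def by (blast intro: Lim_transform_eventually)
qed

lemma field_differentiable_cinner:
  assumes "vec_differentiable f z"
  shows "(\<lambda>w. cinner (f w) y) field_differentiable (at z)"
proof -
  obtain L where L: "((\<lambda>w. (1 / (w - z)) *\<^sub>C (f w - f z)) \<longlongrightarrow> L) (at z)"
    using assms unfolding vec_differentiable_def by blast
  from bounded_linear.tendsto[OF bounded_linear_cinner_left L, of y]
  have "((\<lambda>w. (cinner (f w) y - cinner (f z) y) / (w - z)) \<longlongrightarrow> cinner L y) (at z)"
    by (simp add: cinner_scaleC_left cinner_diff_left)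
  then show ?thesis
    unfolding field_differentiable_def has_field_derivative_iff by blast
qed

lemma operator_analytic_vec_differentiable:
  assumes "operator_analytic U Y V" "z \<in> ball 0 1" "u \<in> U"
  shows "vec_differentiable (\<lambda>w. V w u) z"
proof -
  obtain L where L: "\<And>e. e > 0 \<Longrightarrow> \<exists>d>0. \<forall>w\<in>ball 0 1. w \<noteq> z \<and> cmod (w - z) < d \<longrightarrow>
      (\<forall>u\<in>U. norm ((1 / (w - z)) *\<^sub>C (V w u - V z u) - L u) \<le> e * norm u)"
    using assms(1,2) unfolding operator_analytic_def by blast
  have "((\<lambda>w. (1 / (w - z)) *\<^sub>C (V w u - V z u)) \<longlongrightarrow> L u) (at z)"
  proof (rule tendstoI)
    fix e :: real assume "e > 0"
    \<comment> \<open>The added one covers \<open>u = 0\<close> and keeps \<open>e' * norm u\<close>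
      strictly below \<open>e\<close>.\<close>
    define e' where "e' = e / (norm u + 1)"
    have e': "e' > 0" "e' * norm u < e"
      using \<open>e > 0\<close> by (simp_all add: e'_def field_simps add_pos_nonneg)
    obtain d where d: "d > 0" "\<And>w. w \<in> ball 0 1 \<Longrightarrow> w \<noteq> z \<Longrightarrow> cmod (w - z) < d \<Longrightarrow>
        norm ((1 / (w - z)) *\<^sub>C (V w u - V z u) - L u) \<le> e' * norm u"
      using L[OF e'(1)] assms(3) by blast
    have "\<forall>\<^sub>F w in at z. w \<in> ball 0 1 \<inter> ball z d"
      using assms(2) d(1) by (intro eventually_at_in_open') auto
    moreover have "\<forall>\<^sub>F w in at z. w \<noteq> z" by (simp add: eventually_at_filter)
    ultimately show "\<forall>\<^sub>F w in at z. dist ((1 / (w - z)) *\<^sub>C (V w u - V z u)) (L u) < e"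
    proof eventually_elim
      case (elim w)
      then show ?case using d(2)[of w] e'(2) by (auto simp: dist_norm norm_minus_commute)
    qed
  qed
  then show ?thesis unfolding vec_differentiable_def by blast
qed

text \<open>The local bound on the operators absorbs the motion of the argument, so convergence at
  each fixed vector suffices.\<close>

lemma tendsto_operator_apply:
  fixes N :: "complex \<Rightarrow> 'a::chilbert_space \<Rightarrow> 'b::chilbert_space"
  assumes U: "closed_csubspace U" and lin: "\<forall>\<^sub>F w in at z. bounded_operator U Y (N w)"
    and bound: "\<forall>\<^sub>F w in at z. \<forall>u\<in>U. norm (N w u) \<le> K * norm u"
    and cont: "\<And>u. u \<in> U \<Longrightarrow> ((\<lambda>w. N w u) \<longlongrightarrow> N z u) (at z)"
    and g: "(g \<longlongrightarrow> l) (at z)" "\<forall>\<^sub>F w in at z. g w \<in> U" "l \<in> U"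
  shows "((\<lambda>w. N w (g w)) \<longlongrightarrow> N z l) (at z)"
proof -
  have "((\<lambda>w. N w (g w) - N w l) \<longlongrightarrow> 0) (at z)"
  proof (rule Lim_null_comparison)
    show "((\<lambda>w. K * norm (g w - l)) \<longlongrightarrow> 0) (at z)"
      by (intro tendsto_mult_right_zero tendsto_norm_zero LIM_zero g(1))
    show "\<forall>\<^sub>F w in at z. norm (N w (g w) - N w l) \<le> K * norm (g w - l)"
      using lin bound g(2)
    proof eventually_elim
      case (elim w)
      then show ?case
        using closed_csubspaceD(5)[OF U _ g(3)] bounded_operator_diff[OF elim(1) U _ g(3)]
        by metis
    qed
  qed
  from tendsto_add[OF this cont[OF g(3)]] show ?thesis by simp
qed

text \<open>Product rule: the quotient splits into \<open>N w\<close> applied to the quotient of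
  \<open>g\<close>, plus the quotient of \<open>N w\<close> at the fixed vector \<open>g z\<close>.
  The first part converges by the local bound on \<open>N\<close>.\<close>

lemma vec_differentiable_apply:
  fixes N :: "complex \<Rightarrow> 'a::chilbert_space \<Rightarrow> 'b::chilbert_space"
  assumes U: "closed_csubspace U" and S: "open S" "z \<in> S"
    and lin: "\<And>w. w \<in> S \<Longrightarrow> bounded_operator U Y (N w)"
    and bound: "\<And>w u. w \<in> S \<Longrightarrow> u \<in> U \<Longrightarrow> norm (N w u) \<le> K * norm u"
    and diff: "\<And>u. u \<in> U \<Longrightarrow> vec_differentiable (\<lambda>w. N w u) z"
    and g: "vec_differentiable g z" "\<And>w. w \<in> S \<Longrightarrow> g w \<in> U"
  shows "vec_differentiable (\<lambda>w. N w (g w)) z"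
proof -
  note UD = closed_csubspaceD[OF U]
  have inS: "\<forall>\<^sub>F w in at z. w \<in> S" using S by (simp add: eventually_at_in_open')
  obtain l where l: "((\<lambda>w. (1 / (w - z)) *\<^sub>C (g w - g z)) \<longlongrightarrow> l) (at z)"
    using g(1) unfolding vec_differentiable_def by blast
  obtain L where L: "((\<lambda>w. (1 / (w - z)) *\<^sub>C (N w (g z) - N z (g z))) \<longlongrightarrow> L) (at z)"
    using diff[OF g(2)[OF S(2)]] unfolding vec_differentiable_def by blast
  have qU: "\<forall>\<^sub>F w in at z. (1 / (w - z)) *\<^sub>C (g w - g z) \<in> U"
    using inS by eventually_elim (use UD g(2) S(2) in auto)
  \<comment> \<open>The quotients of \<open>g\<close> stay in the closed set \<open>U\<close>, so
    their limit is an admissible argument of \<open>N z\<close>.\<close>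
  have lU: "l \<in> U" using Lim_in_closed_set[OF UD(2) qU _ l] by simp
  have "((\<lambda>w. N w ((1 / (w - z)) *\<^sub>C (g w - g z))) \<longlongrightarrow> N z l) (at z)"
  proof (rule tendsto_operator_apply[OF U _ _ _ l qU lU])
    show "\<forall>\<^sub>F w in at z. bounded_operator U Y (N w)"
      using inS by eventually_elim (rule lin)
    show "\<forall>\<^sub>F w in at z. \<forall>u\<in>U. norm (N w u) \<le> K * norm u"
      using inS by eventually_elim (use bound in blast)
    show "((\<lambda>w. N w u) \<longlongrightarrow> N z u) (at z)" if "u \<in> U" for u
      using vec_differentiable_isCont[OF diff[OF that]] by (simp add: isCont_def)
  qed
  from tendsto_add[OF this L]
  have "((\<lambda>w. N w ((1 / (w - z)) *\<^sub>C (g w - g z)) + (1 / (w - z)) *\<^sub>C (N w (g z) - N z (g z)))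
      \<longlongrightarrow> N z l + L) (at z)" .
  moreover have "\<forall>\<^sub>F w in at z. N w ((1 / (w - z)) *\<^sub>C (g w - g z)) + (1 / (w - z)) *\<^sub>C (N w (g z) - N z (g z)) =
      (1 / (w - z)) *\<^sub>C (N w (g w) - N z (g z))"
    using inS
  proof eventually_elim
    case (elim w)
    have "N w ((1 / (w - z)) *\<^sub>C (g w - g z)) = (1 / (w - z)) *\<^sub>C (N w (g w) - N w (g z))"
      using g(2)[OF elim] g(2)[OF S(2)] UD bounded_operatorD(3)[OF lin[OF elim]]
      by (simp add: bounded_operator_diff[OF lin[OF elim] U])
    then show ?case by (simp flip: scaleC_add_right)
  qed
  ultimately show ?thesis
    unfolding vec_differentiable_def by (blast intro: Lim_transform_eventually)
qed

lemma vec_differentiable_bounded_operator: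
  assumes "bounded_operator UNIV Y F" "vec_differentiable g z"
  shows "vec_differentiable (\<lambda>w. F (g w)) z"
proof -
  obtain K where K: "\<And>x. norm (F x) \<le> K * norm x"
    by (rule bounded_operator_bound[OF assms(1)]) blast
  show ?thesis
    by (rule vec_differentiable_apply[where U = UNIV and S = UNIV and N = "\<lambda>_. F" and K = K,
        OF _ _ _ assms(1) K vec_differentiable_const assms(2)]) auto
qed

text \<open>As \<open>N\<close> inverts \<open>I - M\<close>, differences obey
  \<open>N w - N z = N w (M w - M z) N z\<close>. One use of this gives continuity of
  \<open>N\<close> at each vector, a second one the derivative.\<close>

lemma vec_differentiable_inverse:
  fixes M N :: "complex \<Rightarrow> 'a::chilbert_space \<Rightarrow> 'a"
  assumes U: "closed_csubspace U" and S: "open S" "z \<in> S"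
    and N: "\<And>w. w \<in> S \<Longrightarrow> bounded_operator U U (N w)"
    and bound: "\<And>w u. w \<in> S \<Longrightarrow> u \<in> U \<Longrightarrow> norm (N w u) \<le> K * norm u"
    and M: "\<And>w u. w \<in> S \<Longrightarrow> u \<in> U \<Longrightarrow> M w u \<in> U"
    and inverse: "\<And>w u. w \<in> S \<Longrightarrow> u \<in> U \<Longrightarrow> N w u - M w (N w u) = u"
      "\<And>w u. w \<in> S \<Longrightarrow> u \<in> U \<Longrightarrow> N w (u - M w u) = u"
    and diff: "\<And>u. u \<in> U \<Longrightarrow> vec_differentiable (\<lambda>w. M w u) z"
    and u: "u \<in> U"
  shows "vec_differentiable (\<lambda>w. N w u) z"
proof -
  note UD = closed_csubspaceD[OF U]
  have inS: "\<forall>\<^sub>F w in at z. w \<in> S" using S by (simp add: eventually_at_in_open')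
  have NU: "N w u \<in> U" if "w \<in> S" "u \<in> U" for w u using bounded_operatorD(1)[OF N] that by blast
  have id: "N w u - N z u = N w (M w (N z u) - M z (N z u))" if "w \<in> S" "u \<in> U" for w u
  proof -
    let ?y = "N z u"
    have y: "?y \<in> U" using NU S(2) that(2) .
    have "N w (?y - M w ?y) = ?y" using inverse(2) that(1) y by blast
    moreover have "N w (?y - M z ?y) = N w u" using inverse(1)[OF S(2) that(2)] by simp
    moreover have "N w (M w ?y - M z ?y) = N w (?y - M z ?y) - N w (?y - M w ?y)"
      using y that S(2) M UD by (simp flip: bounded_operator_diff[OF N U])
    ultimately show ?thesis by simp
  qed
  have cont: "((\<lambda>w. N w u) \<longlongrightarrow> N z u) (at z)" if u: "u \<in> U" for u
  proof -
    let ?y = "N z u"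
    have y: "?y \<in> U" using NU S(2) u .
    have "((\<lambda>w. N w u - N z u) \<longlongrightarrow> 0) (at z)"
    proof (rule Lim_null_comparison)
      have "((\<lambda>w. M w ?y) \<longlongrightarrow> M z ?y) (at z)"
        using vec_differentiable_isCont[OF diff[OF y]] by (simp add: isCont_def)
      then show "((\<lambda>w. K * norm (M w ?y - M z ?y)) \<longlongrightarrow> 0) (at z)"
        by (intro tendsto_mult_right_zero tendsto_norm_zero LIM_zero)
      show "\<forall>\<^sub>F w in at z. norm (N w u - N z u) \<le> K * norm (M w ?y - M z ?y)"
        using inS
      proof eventually_elim
        case (elim w)
        then show ?case unfolding id[OF elim u] using M S(2) y UD by (intro bound) auto
      qed
    qed
    then show ?thesis by (rule LIM_zero_cancel)
  qed
  let ?y = "N z u"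
  have y: "?y \<in> U" using NU S(2) u .
  obtain l where l: "((\<lambda>w. (1 / (w - z)) *\<^sub>C (M w ?y - M z ?y)) \<longlongrightarrow> l) (at z)"
    using diff[OF y] unfolding vec_differentiable_def by blast
  have qU: "\<forall>\<^sub>F w in at z. (1 / (w - z)) *\<^sub>C (M w ?y - M z ?y) \<in> U"
    using inS by eventually_elim (use UD M S(2) y in auto)
  have lU: "l \<in> U" using Lim_in_closed_set[OF UD(2) qU _ l] by simp
  have "((\<lambda>w. N w ((1 / (w - z)) *\<^sub>C (M w ?y - M z ?y))) \<longlongrightarrow> N z l) (at z)"
  proof (rule tendsto_operator_apply[OF U _ _ cont l qU lU])
    show "\<forall>\<^sub>F w in at z. bounded_operator U U (N w)"
      using inS by eventually_elim (rule N)
    show "\<forall>\<^sub>F w in at z. \<forall>u\<in>U. norm (N w u) \<le> K * norm u"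
      using inS by eventually_elim (use bound in blast)
  qed
  moreover have "\<forall>\<^sub>F w in at z. N w ((1 / (w - z)) *\<^sub>C (M w ?y - M z ?y)) =
      (1 / (w - z)) *\<^sub>C (N w u - N z u)"
    using inS
  proof eventually_elim
    case (elim w)
    then show ?case
      using M S(2) y UD bounded_operatorD(3)[OF N[OF elim]] by (simp add: id[OF elim u])
  qed
  ultimately show ?thesis
    unfolding vec_differentiable_def by (blast intro: Lim_transform_eventually)
qed

section \<open>Circle means and Taylor coefficients\<close>

lemma circlepath_in_ball: "0 < r \<Longrightarrow> r < 1 \<Longrightarrow> circlepath 0 r t \<in> ball 0 1"
  by (simp add: circlepath norm_mult)

lemma norm_circlepath_0: "0 < r \<Longrightarrow> cmod (circlepath 0 r t) = r"
  by (simp add: circlepath norm_mult)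

lemma continuous_on_circlepath: "continuous_on {0..1} (circlepath 0 r)"
  by (intro continuous_on_path) auto

lemma continuous_on_circle_comp:
  assumes "continuous_on (ball 0 1) f" "0 < r" "r < 1"
  shows "continuous_on {0..1} (\<lambda>t. f (circlepath 0 r t))"
  by (rule continuous_on_compose2[OF assms(1) continuous_on_circlepath])
    (use circlepath_in_ball assms in auto)

text \<open>Cauchy's formula for derivatives, with the circle parametrised over the unit interval.
  The coefficients \<open>a\<close> are the Taylor coefficients because a power series vanishing on
  the disc is zero.\<close>

lemma circle_mean_coefficient:
  assumes g: "g holomorphic_on ball 0 1" and r: "0 < r" "r < 1"
    and a: "\<And>z. z \<in> ball 0 1 \<Longrightarrow> (\<lambda>n. a n * z ^ n) sums g z"
  shows "((\<lambda>t. g (circlepath 0 r t) / circlepath 0 r t ^ n) has_integral a n) {0..1}"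
proof -
  have "a n - (deriv ^^ n) g 0 / fact n = 0"
  proof (rule complex_powser_zero_coeff[where a = "\<lambda>n. a n - (deriv ^^ n) g 0 / fact n"])
    fix z :: complex assume z: "z \<in> ball 0 1"
    show "(\<lambda>n. (a n - (deriv ^^ n) g 0 / fact n) * z ^ n) sums 0"
      using sums_diff[OF a[OF z] holomorphic_power_series[OF g z]] by (simp add: algebra_simps)
  qed
  then have an: "a n = (deriv ^^ n) g 0 / fact n" by simp
  have sub: "cball 0 r \<subseteq> ball 0 1" "ball 0 r \<subseteq> ball (0::complex) 1" using r by auto
  have "((\<lambda>u. g u / (u - 0) ^ Suc n) has_contour_integral ((2 * pi * \<i>) / (fact n) * (deriv ^^ n) g 0))
      (circlepath 0 r)"
    using g sub r by (intro Cauchy_has_contour_integral_higher_derivative_circlepath)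
      (auto intro: holomorphic_on_subset holomorphic_on_imp_continuous_on)
  then have "((\<lambda>t. g (circlepath 0 r t) / circlepath 0 r t ^ Suc n *
      vector_derivative (circlepath 0 r) (at t within {0..1})) has_integral (2 * pi * \<i>) * a n) {0..1}"
    by (simp add: has_contour_integral_def an)
  moreover have "g (circlepath 0 r t) / circlepath 0 r t ^ Suc n *
      vector_derivative (circlepath 0 r) (at t within {0..1}) =
      (2 * pi * \<i>) * (g (circlepath 0 r t) / circlepath 0 r t ^ n)" if "t \<in> {0..1}" for t
  proof -
    \<comment> \<open>The velocity is \<open>2 * pi * \<i>\<close> times the point on the circle,
      which lowers the exponent from \<open>Suc n\<close> to \<open>n\<close>.\<close>
    have "vector_derivative (circlepath 0 r) (at t within {0..1}) = (2 * pi * \<i>) * circlepath 0 r t"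
      using that by (subst vector_derivative_circlepath01) (auto simp: circlepath)
    moreover have "circlepath 0 r t \<noteq> 0" using r by (simp add: circlepath)
    ultimately show ?thesis by simp
  qed
  ultimately have "((\<lambda>t. (2 * pi * \<i>) * (g (circlepath 0 r t) / circlepath 0 r t ^ n))
      has_integral (2 * pi * \<i>) * a n) {0..1}"
    by (subst (asm) has_integral_cong) auto
  from has_integral_mult_right[OF this, of "1 / (2 * pi * \<i>)"] show ?thesis by simp
qed

definition vec_analytic :: "(complex \<Rightarrow> 'a::chilbert_space) \<Rightarrow> bool" where
  "vec_analytic f \<longleftrightarrow> (\<forall>z\<in>ball 0 1. vec_differentiable f z)"

lemma vec_analytic_continuous: "vec_analytic f \<Longrightarrow> continuous_on (ball 0 1) f"
  unfolding vec_analytic_def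
  by (intro continuous_at_imp_continuous_on ballI vec_differentiable_isCont) blast

lemma holomorphic_cinner: "vec_analytic f \<Longrightarrow> (\<lambda>z. cinner (f z) y) holomorphic_on ball 0 1"
  unfolding vec_analytic_def holomorphic_on_def
  using field_differentiable_at_within[OF field_differentiable_cinner] by blast

text \<open>The coefficients are vector-valued Cauchy integrals; they are identified weakly.\<close>

lemma vec_analytic_power_series:
  fixes f :: "complex \<Rightarrow> 'a::chilbert_space"
  assumes f: "vec_analytic f"
  obtains c where "\<And>z. z \<in> ball 0 1 \<Longrightarrow> (\<lambda>n. z ^ n *\<^sub>C c n) sums f z"
proof -
  define a where "a y n = (deriv ^^ n) (\<lambda>z. cinner (f z) y) 0 / fact n" for y n
  have a: "(\<lambda>n. a y n * z ^ n) sums cinner (f z) y" if "z \<in> ball 0 1" for y z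
    using holomorphic_power_series[OF holomorphic_cinner[OF f] that] by (simp add: a_def)
  define F where "F r n t = (1 / circlepath 0 r t ^ n) *\<^sub>C f (circlepath 0 r t)" for r n t
  have F_cont: "continuous_on {0..1} (F r n)" if r: "0 < r" "r < 1" for r n
  proof -
    have "circlepath 0 r t \<noteq> 0" for t using r by (simp add: circlepath)
    then show ?thesis unfolding F_def
      using continuous_on_circle_comp[OF vec_analytic_continuous[OF f] r]
      by (intro continuous_intros continuous_on_circlepath) auto
  qed
  define c where "c r n = integral {0..1} (F r n)" for r n
  have F_int: "(F r n has_integral c r n) {0..1}" if "0 < r" "r < 1" for r n
    unfolding c_def by (intro integrable_integral integrable_continuous_interval F_cont that)
  have c: "cinner (c r n) y = a y n" if r: "0 < r" "r < 1" for r n y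
  proof -
    have "((\<lambda>t. cinner (F r n t) y) has_integral cinner (c r n) y) {0..1}"
      using has_integral_linear[OF F_int[OF r] bounded_linear_cinner_left] by (simp add: o_def)
    moreover have "((\<lambda>t. cinner (F r n t) y) has_integral a y n) {0..1}"
      using circle_mean_coefficient[OF holomorphic_cinner[OF f] r a, of y n]
      by (simp add: F_def cinner_scaleC_left)
    ultimately show ?thesis by (rule has_integral_unique)
  qed
  \<comment> \<open>The coefficient does not depend on the radius; \<open>1/2\<close> is an
    arbitrary choice between 0 and 1.\<close>
  define d where "d n = c (1/2) n" for n
  have d: "c r n = d n" if "0 < r" "r < 1" for r n
    unfolding d_def by (rule cinner_eqI) (simp add: c that)
  have "(\<lambda>n. z ^ n *\<^sub>C d n) sums f z" if z: "z \<in> ball 0 1" for z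
  proof -
    \<comment> \<open>Midway between \<open>cmod z\<close> and 1: the Cauchy estimate on this circle
      dominates the series at \<open>z\<close> by a geometric one with ratio
      \<open>cmod z / r\<close>.\<close>
    define r where "r = (1 + cmod z) / 2"
    have r: "0 < r" "r < 1" "cmod z < r" using z by (auto simp: r_def add_pos_nonneg)
    have "compact ((\<lambda>t. f (circlepath 0 r t)) ` {0..1})"
      by (intro compact_continuous_image continuous_on_circle_comp vec_analytic_continuous f r) simp
    then have "bounded ((\<lambda>t. f (circlepath 0 r t)) ` {0..1})" by (rule compact_imp_bounded)
    then obtain B where B: "\<And>t. t \<in> {0..1} \<Longrightarrow> norm (f (circlepath 0 r t)) \<le> B"
      unfolding bounded_iff by blast
    have "norm (d n) \<le> B / r ^ n" for n
    proof -
      have "norm (F r n t) \<le> B / r ^ n" if "t \<in> {0..1}" for t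
        using B[OF that] r(1)
        by (simp add: F_def norm_scaleC norm_divide norm_power norm_circlepath_0 divide_right_mono)
      then have "norm (c r n) \<le> (B / r ^ n) * (1 - 0)"
        using F_int[OF r(1,2), of n] order_trans[OF norm_ge_zero B[of 0]] r(1)
          has_integral_bound[of "B / r ^ n" "F r n" "c r n" 0 1] by simp
      then show ?thesis by (simp add: d[OF r(1,2)])
    qed
    then have bd: "norm (z ^ n *\<^sub>C d n) \<le> B * (cmod z / r) ^ n" for n
      using mult_left_mono[of "norm (d n)" "B / r ^ n" "cmod z ^ n"]
      by (simp add: norm_scaleC norm_power power_divide mult.commute)
    have "summable (\<lambda>n. z ^ n *\<^sub>C d n)"
    proof (rule summable_comparison_test'[where N = 0])
      show "summable (\<lambda>n. B * (cmod z / r) ^ n)"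
        using r by (intro summable_mult summable_geometric) simp
    qed (rule bd)
    then obtain s where s: "(\<lambda>n. z ^ n *\<^sub>C d n) sums s" by (auto simp: summable_def)
    have "s = f z"
    proof (rule cinner_eqI)
      fix y
      have "(\<lambda>n. cinner (z ^ n *\<^sub>C d n) y) sums cinner s y"
        by (rule bounded_linear.sums[OF bounded_linear_cinner_left s])
      moreover have "cinner (z ^ n *\<^sub>C d n) y = a y n * z ^ n" for n
        by (simp add: cinner_scaleC_left d_def c)
      ultimately show "cinner s y = cinner (f z) y" using a[OF z] by (simp add: sums_unique2)
    qed
    then show ?thesis using s by simp
  qed
  then show ?thesis using that by blast
qed

context
  fixes f :: "complex \<Rightarrow> 'a::chilbert_space" and c :: "nat \<Rightarrow> 'a"
  assumes f: "vec_analytic f" and c: "\<And>z. z \<in> ball 0 1 \<Longrightarrow> (\<lambda>n. z ^ n *\<^sub>C c n) sums f z"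
begin

lemma cinner_sums: "z \<in> ball 0 1 \<Longrightarrow> (\<lambda>n. cinner (c n) y * z ^ n) sums cinner (f z) y"
  using bounded_linear.sums[OF bounded_linear_cinner_left c]
  by (simp add: cinner_scaleC_left mult.commute)

text \<open>On the circle \<open>1 / z ^ n\<close> is the conjugate of \<open>z ^ n\<close> divided
  by \<open>r ^ (2 * n)\<close>, so the coefficient formula becomes an inner product with a
  monomial.\<close>

lemma circle_mean_inner_power:
  assumes r: "0 < r" "r < 1"
  shows "((\<lambda>t. f (circlepath 0 r t) \<bullet> (circlepath 0 r t ^ n *\<^sub>C y)) has_integral r ^ (2 * n) * (c n \<bullet> y)) {0..1}"
proof -
  have "((\<lambda>t. cinner (f (circlepath 0 r t)) y / circlepath 0 r t ^ n) has_integral cinner (c n) y) {0..1}"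
    by (rule circle_mean_coefficient[OF holomorphic_cinner[OF f] r cinner_sums])
  from has_integral_mult_right[OF this, of "of_real (r ^ (2 * n))"]
  have "((\<lambda>t. of_real (r ^ (2 * n)) * (cinner (f (circlepath 0 r t)) y / circlepath 0 r t ^ n))
      has_integral of_real (r ^ (2 * n)) * cinner (c n) y) {0..1}" .
  moreover have "of_real (r ^ (2 * n)) * (cinner (f (circlepath 0 r t)) y / circlepath 0 r t ^ n) =
      cinner (f (circlepath 0 r t)) (circlepath 0 r t ^ n *\<^sub>C y)" for t
  proof -
    let ?z = "circlepath 0 r t"
    have "?z * cnj ?z = of_real (r\<^sup>2)"
      using norm_circlepath_0[OF r(1), of t] by (simp add: complex_mult_cnj cmod_power2[symmetric])
    then have "of_real (r ^ (2 * n)) = ?z ^ n * cnj ?z ^ n"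
      by (metis of_real_power power_mult power_mult_distrib)
    moreover have "?z \<noteq> 0" using r by (simp add: circlepath)
    ultimately show ?thesis by (simp add: cinner_scaleC_right)
  qed
  ultimately have "((\<lambda>t. cinner (f (circlepath 0 r t)) (circlepath 0 r t ^ n *\<^sub>C y))
      has_integral of_real (r ^ (2 * n)) * cinner (c n) y) {0..1}" by simp
  from has_integral_linear[OF this bounded_linear_Re] show ?thesis
    by (simp add: o_def Re_cinner)
qed

text \<open>The mean value property, as the case \<open>n = 0\<close>. It evaluates means of
  expressions that are affine in \<open>f\<close>.\<close>

lemma circle_mean_inner_0:
  assumes r: "0 < r" "r < 1"
  shows "((\<lambda>t. f (circlepath 0 r t) \<bullet> y) has_integral (f 0 \<bullet> y)) {0..1}"
proof -
  have "(\<lambda>n. 0 ^ n *\<^sub>C c n) sums (\<Sum>n\<in>{0}. 0 ^ n *\<^sub>C c n)"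
    by (rule sums_finite) (auto simp: power_0_left)
  then have "f 0 = c 0" using c[of 0] by (simp add: sums_unique2)
  then show ?thesis using circle_mean_inner_power[OF r, of 0 y] by simp
qed

end

lemma vec_analytic_diff_monomial:
  assumes "vec_analytic f"
  shows "vec_analytic (\<lambda>z. f z - z ^ n *\<^sub>C c)"
proof -
  have "vec_analytic (\<lambda>z. z ^ n *\<^sub>C (- c))"
    unfolding vec_analytic_def
  proof (induction n)
    case (Suc n)
    then show ?case using vec_differentiable_ident_scaleC by (fastforce simp: scaleC_scaleC[symmetric])
  qed (simp add: vec_differentiable_const)
  then show ?thesis
    using assms vec_differentiable_add unfolding vec_analytic_def scaleC_minus_right by fastforce
qed

text \<open>Monomials are orthogonal in the circle mean. They are removed one at a time while the
  exact mean square of the remainder is tracked; its nonnegativity is the claim.\<close>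

lemma circle_mean_bessel:
  fixes f :: "complex \<Rightarrow> 'a::chilbert_space"
  assumes f: "vec_analytic f" and c: "\<And>z. z \<in> ball 0 1 \<Longrightarrow> (\<lambda>n. z ^ n *\<^sub>C c n) sums f z"
    and r: "0 < r" "r < 1"
  shows "(\<Sum>n<N. r ^ (2 * n) * (norm (c n))\<^sup>2) \<le> integral {0..1} (\<lambda>t. (norm (f (circlepath 0 r t)))\<^sup>2)"
proof -
  define g where "g N z = f z - (\<Sum>n<N. z ^ n *\<^sub>C c n)" for N z
  have "vec_analytic (g N)
    \<and> ((\<lambda>t. (norm (g N (circlepath 0 r t)))\<^sup>2) has_integral
        integral {0..1} (\<lambda>t. (norm (f (circlepath 0 r t)))\<^sup>2) - (\<Sum>n<N. r ^ (2 * n) * (norm (c n))\<^sup>2)) {0..1}" for N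
  proof (induction N)
    case 0
    have "(\<lambda>t. (norm (f (circlepath 0 r t)))\<^sup>2) integrable_on {0..1}"
      by (intro integrable_continuous_interval continuous_intros
          continuous_on_circle_comp vec_analytic_continuous f r)
    then show ?case using f by (simp add: g_def integrable_integral)
  next
    case (Suc N)
    have gN: "vec_analytic (g N)" using Suc by blast
    have gS: "g (Suc N) z = g N z - z ^ N *\<^sub>C c N" for z by (simp add: g_def algebra_simps)
    \<comment> \<open>Power series of the remainder: the first \<open>N\<close> coefficients are
      gone, so the coefficient at index \<open>N\<close> is still \<open>c N\<close>.\<close>
    define d where "d n = (if n < N then 0 else c n)" for n
    have d: "(\<lambda>n. z ^ n *\<^sub>C d n) sums g N z" if z: "z \<in> ball 0 1" for z
    proof -
      have "(\<lambda>n. if n \<in> {..<N} then z ^ n *\<^sub>C c n else 0) sums (\<Sum>n<N. z ^ n *\<^sub>C c n)"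
        by (rule sums_If_finite_set) simp
      from sums_diff[OF c[OF z] this] show ?thesis
        unfolding g_def by (rule sums_cong[THEN iffD1, rotated]) (simp add: d_def)
    qed
    have "((\<lambda>t. g N (circlepath 0 r t) \<bullet> (circlepath 0 r t ^ N *\<^sub>C c N)) has_integral
        r ^ (2 * N) * (d N \<bullet> c N)) {0..1}"
      by (rule circle_mean_inner_power[OF gN d r])
    then have "((\<lambda>t. 2 * (g N (circlepath 0 r t) \<bullet> (circlepath 0 r t ^ N *\<^sub>C c N))) has_integral
        2 * (r ^ (2 * N) * (norm (c N))\<^sup>2)) {0..1}"
      by (intro has_integral_mult_right) (simp add: d_def power2_norm_eq_inner)
    moreover have "((\<lambda>t. r ^ (2 * N) * (norm (c N))\<^sup>2) has_integral r ^ (2 * N) * (norm (c N))\<^sup>2) {0..1::real}"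
      using has_integral_const_real[of "r ^ (2 * N) * (norm (c N))\<^sup>2" 0 1] by simp
    ultimately have "((\<lambda>t. (norm (g N (circlepath 0 r t)))\<^sup>2 -
        2 * (g N (circlepath 0 r t) \<bullet> (circlepath 0 r t ^ N *\<^sub>C c N)) + r ^ (2 * N) * (norm (c N))\<^sup>2)
      has_integral (integral {0..1} (\<lambda>t. (norm (f (circlepath 0 r t)))\<^sup>2) -
        (\<Sum>n<N. r ^ (2 * n) * (norm (c n))\<^sup>2)) - 2 * (r ^ (2 * N) * (norm (c N))\<^sup>2)
        + r ^ (2 * N) * (norm (c N))\<^sup>2) {0..1}"
      using Suc by (intro has_integral_add has_integral_diff) blast+
    moreover have "(norm (g N (circlepath 0 r t)))\<^sup>2 -
        2 * (g N (circlepath 0 r t) \<bullet> (circlepath 0 r t ^ N *\<^sub>C c N)) + r ^ (2 * N) * (norm (c N))\<^sup>2 =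
        (norm (g (Suc N) (circlepath 0 r t)))\<^sup>2" for t
    proof -
      have "(norm (circlepath 0 r t ^ N *\<^sub>C c N))\<^sup>2 = r ^ (2 * N) * (norm (c N))\<^sup>2"
        using r by (simp add: norm_scaleC norm_power norm_circlepath_0 power_mult_distrib
            power_mult[symmetric] mult.commute)
      moreover have "(norm (x - y))\<^sup>2 = (norm x)\<^sup>2 - 2 * (x \<bullet> y) + (norm y)\<^sup>2" for x y :: 'a
        by (simp add: power2_norm_eq_inner inner_diff_left inner_diff_right inner_commute[of y x])
      ultimately show ?thesis by (simp add: gS)
    qed
    ultimately show ?case
      using vec_analytic_diff_monomial[OF gN, of N "c N"] by (simp add: gS[abs_def] diff_diff_eq)
  qed
  then have "((\<lambda>t. (norm (g N (circlepath 0 r t)))\<^sup>2) has_integral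
        integral {0..1} (\<lambda>t. (norm (f (circlepath 0 r t)))\<^sup>2) - (\<Sum>n<N. r ^ (2 * n) * (norm (c n))\<^sup>2)) {0..1}"
    by blast
  from has_integral_nonneg[OF this] show ?thesis by simp
qed

section \<open>Elements of the Hardy space\<close>

lemma hardy_from_power_series:
  fixes f :: "complex \<Rightarrow> 'a::chilbert_space"
  assumes c: "\<And>z. z \<in> ball 0 1 \<Longrightarrow> (\<lambda>n. z ^ n *\<^sub>C c n) sums f z"
    and bound: "\<And>N. (\<Sum>n<N. (norm (c n))\<^sup>2) \<le> b"
  obtains g where "\<And>z. z \<in> ball 0 1 \<Longrightarrow> hardy_fun g z = f z" "(norm g)\<^sup>2 \<le> b"
proof -
  have "summable (\<lambda>n. (norm (c n))\<^sup>2)"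
    by (rule bounded_imp_summable[of _ b]) (use bound[of "Suc _"] in \<open>simp_all add: lessThan_Suc_atMost\<close>)
  then have "square_summable c" by (simp add: square_summable_def)
  then obtain g where g: "hardy_coeff g = c" using ex_hardy_with_coeff by blast
  show ?thesis
  proof (rule that)
    show "hardy_fun g z = f z" if "z \<in> ball 0 1" for z
      using hardy_coeff_sums[OF that, of g] c[OF that] by (simp add: g sums_unique2)
    show "(norm g)\<^sup>2 \<le> b"
      unfolding sums_unique[OF norm_hardy_sums] g
      by (rule suminf_le_const) (use \<open>summable (\<lambda>n. (norm (c n))\<^sup>2)\<close> bound in auto)
  qed
qed

text \<open>Bessel's inequality bounds each partial sum for \<open>r < 1\<close>, and a finite sum
  allows the limit as \<open>r\<close> tends to 1. The weight \<open>r\<^sup>2\<close> is the form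
  in which the energy balance delivers the means; it disappears in the limit.\<close>

lemma hardy_from_circle_means:
  fixes f :: "complex \<Rightarrow> 'a::chilbert_space"
  assumes f: "vec_analytic f"
    and bound: "\<And>r. 0 < r \<Longrightarrow> r < 1 \<Longrightarrow> r\<^sup>2 * integral {0..1} (\<lambda>t. (norm (f (circlepath 0 r t)))\<^sup>2) \<le> b"
  obtains g where "\<And>z. z \<in> ball 0 1 \<Longrightarrow> hardy_fun g z = f z" "(norm g)\<^sup>2 \<le> b"
proof -
  obtain c where c: "\<And>z. z \<in> ball 0 1 \<Longrightarrow> (\<lambda>n. z ^ n *\<^sub>C c n) sums f z"
    by (rule vec_analytic_power_series[OF f]) blast
  have "(\<Sum>n<N. (norm (c n))\<^sup>2) \<le> b" for N
  proof (rule tendsto_upperbound)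
    show "((\<lambda>r. r\<^sup>2 * (\<Sum>n<N. r ^ (2 * n) * (norm (c n))\<^sup>2)) \<longlongrightarrow> (\<Sum>n<N. (norm (c n))\<^sup>2)) (at_left 1)"
    proof -
      have "((\<lambda>r. r\<^sup>2 * (\<Sum>n<N. r ^ (2 * n) * (norm (c n))\<^sup>2)) \<longlongrightarrow>
          1\<^sup>2 * (\<Sum>n<N. 1 ^ (2 * n) * (norm (c n))\<^sup>2)) (at_left (1::real))"
        by (intro tendsto_intros)
      then show ?thesis by simp
    qed
    have "\<forall>\<^sub>F r in at_left (1::real). r \<in> {0<..<1}" by (rule eventually_at_leftI[of 0]) auto
    then show "\<forall>\<^sub>F r in at_left 1. r\<^sup>2 * (\<Sum>n<N. r ^ (2 * n) * (norm (c n))\<^sup>2) \<le> b"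
    proof eventually_elim
      case (elim r)
      then have r: "0 < r" "r < 1" by auto
      have "r\<^sup>2 * (\<Sum>n<N. r ^ (2 * n) * (norm (c n))\<^sup>2) \<le>
          r\<^sup>2 * integral {0..1} (\<lambda>t. (norm (f (circlepath 0 r t)))\<^sup>2)"
        by (intro mult_left_mono circle_mean_bessel[OF f c r]) auto
      then show ?case using bound[OF r] by linarith
    qed
  qed simp
  from hardy_from_power_series[OF c this] that show ?thesis by blast
qed

lemma hardy_fun_0: "hardy_fun f 0 = hardy_coeff f 0"
proof -
  have "(\<lambda>n. 0 ^ n *\<^sub>C hardy_coeff f n) sums (\<Sum>n\<in>{0}. 0 ^ n *\<^sub>C hardy_coeff f n)"
    by (rule sums_finite) (auto simp: power_0_left)
  then show ?thesis using hardy_coeff_sums[of 0 f] by (simp add: sums_unique2)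
qed

section \<open>The backward shift and Hardy functions with values in a subspace\<close>

definition backward_shift :: "'a::chilbert_space hardy \<Rightarrow> 'a hardy" where
  "backward_shift f = (SOME g. hardy_coeff g = (\<lambda>n. hardy_coeff f (Suc n)))"

lemma hardy_coeff_backward_shift: "hardy_coeff (backward_shift f) n = hardy_coeff f (Suc n)"
proof -
  have "square_summable (\<lambda>n. hardy_coeff f (Suc n))"
    using square_summable_hardy_coeff[of f] unfolding square_summable_def
    by (subst summable_Suc_iff[of "\<lambda>n. (norm (hardy_coeff f n))\<^sup>2"])
  from someI_ex[OF ex_hardy_with_coeff[OF this], folded backward_shift_def] show ?thesis by simp
qed

text \<open>The zeroth coefficient is dropped and the others are kept, so the energy lost is that of
  the value emitted at the origin. This is the balance of the realisation from which
  \<open>V\<close> is recovered.\<close>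

lemma norm_backward_shift: "(norm f)\<^sup>2 = (norm (hardy_fun f 0))\<^sup>2 + (norm (backward_shift f))\<^sup>2"
proof -
  have "(\<lambda>n. (norm (hardy_coeff f (Suc n)))\<^sup>2) sums (norm (backward_shift f))\<^sup>2"
    using norm_hardy_sums[of "backward_shift f"] by (simp add: hardy_coeff_backward_shift)
  then have "(\<lambda>n. (norm (hardy_coeff f n))\<^sup>2) sums ((norm (backward_shift f))\<^sup>2 + (norm (hardy_coeff f 0))\<^sup>2)"
    by (subst sums_Suc_iff[symmetric]) simp
  from sums_unique2[OF norm_hardy_sums this] show ?thesis by (simp add: hardy_fun_0)
qed

lemma bounded_operator_backward_shift: "bounded_operator UNIV UNIV backward_shift"
proof (rule bounded_operatorI[where c = 1])
  fix f g :: "'a hardy" and a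
  show "backward_shift (f + g) = backward_shift f + backward_shift g"
    by (rule hardy_eqI_coeff) (simp add: fun_eq_iff hardy_coeff_backward_shift hardy_coeff_add)
  show "backward_shift (a *\<^sub>C f) = a *\<^sub>C backward_shift f"
    by (rule hardy_eqI_coeff) (simp add: fun_eq_iff hardy_coeff_backward_shift hardy_coeff_scaleC)
  have "(norm (backward_shift f))\<^sup>2 \<le> (norm f)\<^sup>2" using norm_backward_shift[of f] by simp
  then show "norm (backward_shift f) \<le> 1 * norm f" by (simp add: power2_le_iff_abs_le)
qed simp

lemma bounded_operator_hardy_fun_0: "bounded_operator UNIV UNIV (\<lambda>f. hardy_fun f 0)"
proof (rule bounded_operatorI[where c = 1])
  show "norm (hardy_fun f 0) \<le> 1 * norm f" for f :: "'a hardy"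
    by (simp add: hardy_fun_0 norm_hardy_coeff_le)
qed (simp_all add: hardy_fun_add hardy_fun_scaleC)

lemma hardy_fun_backward_shift:
  assumes z: "z \<in> ball 0 1"
  shows "hardy_fun f z = hardy_fun f 0 + z *\<^sub>C hardy_fun (backward_shift f) z"
proof -
  have "(\<lambda>n. z *\<^sub>C (z ^ n *\<^sub>C hardy_coeff (backward_shift f) n)) sums
      (z *\<^sub>C hardy_fun (backward_shift f) z)"
    by (rule bounded_linear.sums[OF bounded_linear_scaleC hardy_coeff_sums[OF z]])
  then have "(\<lambda>n. z ^ Suc n *\<^sub>C hardy_coeff f (Suc n)) sums (z *\<^sub>C hardy_fun (backward_shift f) z)"
    by (simp add: scaleC_scaleC hardy_coeff_backward_shift)
  moreover have "(\<lambda>n. z ^ Suc n *\<^sub>C hardy_coeff f (Suc n)) sums (hardy_fun f z - hardy_fun f 0)"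
    using hardy_coeff_sums[OF z, of f] by (subst sums_Suc_iff) (simp add: hardy_fun_0)
  ultimately have "z *\<^sub>C hardy_fun (backward_shift f) z = hardy_fun f z - hardy_fun f 0"
    by (rule sums_unique2)
  then show ?thesis by simp
qed

text \<open>Reads off both parts of a relation \<open>f = v + z g\<close>, the form that the
  interpolation condition takes for Hardy functions.\<close>

lemma backward_shift_eqI:
  assumes "\<And>z. z \<in> ball 0 1 \<Longrightarrow> hardy_fun f z = v + z *\<^sub>C hardy_fun g z"
  shows "backward_shift f = g" "hardy_fun f 0 = v"
proof -
  show "hardy_fun f 0 = v" using assms[of 0] by simp
  have "hardy_coeff f = (\<lambda>n. case n of 0 \<Rightarrow> v | Suc m \<Rightarrow> hardy_coeff g m)"
  proof (rule hardy_coeff_eqI)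
    fix z :: complex assume z: "z \<in> ball 0 1"
    have "(\<lambda>n. z *\<^sub>C (z ^ n *\<^sub>C hardy_coeff g n)) sums (z *\<^sub>C hardy_fun g z)"
      by (rule bounded_linear.sums[OF bounded_linear_scaleC hardy_coeff_sums[OF z]])
    then show "(\<lambda>n. z ^ n *\<^sub>C (case n of 0 \<Rightarrow> v | Suc m \<Rightarrow> hardy_coeff g m)) sums hardy_fun f z"
      using sums_Suc_iff[of "\<lambda>n. z ^ n *\<^sub>C (case n of 0 \<Rightarrow> v | Suc m \<Rightarrow> hardy_coeff g m)"]
      by (simp add: assms[OF z] scaleC_scaleC add.commute)
  qed
  then show "backward_shift f = g"
    by (intro hardy_eqI_coeff) (simp add: fun_eq_iff hardy_coeff_backward_shift)
qed

lemma hardy_space_mem: "f \<in> hardy_space Y \<Longrightarrow> z \<in> ball 0 1 \<Longrightarrow> hardy_fun f z \<in> Y"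
  by (simp add: hardy_space_def)

text \<open>Prepend \<open>v\<close> to the coefficients of \<open>f\<close>. This supplies
  existence for the \<open>THE\<close> in \<open>sz_nagy_schaeffer\<close>.\<close>

lemma ex_hardy_shift: "\<exists>g. \<forall>z\<in>ball 0 1. hardy_fun g z = v + z *\<^sub>C hardy_fun f z"
proof -
  have "square_summable (\<lambda>n. case n of 0 \<Rightarrow> v | Suc m \<Rightarrow> hardy_coeff f m)"
    using square_summable_hardy_coeff[of f] unfolding square_summable_def
    by (subst summable_Suc_iff[symmetric]) simp
  then obtain g where g: "hardy_coeff g = (\<lambda>n. case n of 0 \<Rightarrow> v | Suc m \<Rightarrow> hardy_coeff f m)"
    using ex_hardy_with_coeff by blast
  have "hardy_fun g z = v + z *\<^sub>C hardy_fun f z" if z: "z \<in> ball 0 1" for z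
  proof -
    have "(\<lambda>n. z *\<^sub>C (z ^ n *\<^sub>C hardy_coeff f n)) sums (z *\<^sub>C hardy_fun f z)"
      by (rule bounded_linear.sums[OF bounded_linear_scaleC hardy_coeff_sums[OF z]])
    then have "(\<lambda>n. z ^ Suc n *\<^sub>C hardy_coeff g (Suc n)) sums (z *\<^sub>C hardy_fun f z)"
      by (simp add: g scaleC_scaleC)
    moreover have "(\<lambda>n. z ^ Suc n *\<^sub>C hardy_coeff g (Suc n)) sums (hardy_fun g z - v)"
      using hardy_coeff_sums[OF z, of g] by (subst sums_Suc_iff) (simp add: g)
    ultimately have "hardy_fun g z - v = z *\<^sub>C hardy_fun f z" by (rule sums_unique2[symmetric])
    then show ?thesis by (simp add: algebra_simps)
  qed
  then show ?thesis by blast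
qed

text \<open>Evaluation at a point of the disc is bounded, so the space is an intersection of
  preimages of the closed set \<open>Y\<close> under continuous maps.\<close>

lemma closed_csubspace_hardy_space:
  assumes Y: "closed_csubspace Y"
  shows "closed_csubspace (hardy_space Y)"
proof -
  have cont: "bounded_operator UNIV UNIV (\<lambda>f :: 'a hardy. hardy_fun f z)" if z: "z \<in> ball 0 1" for z
  proof (rule bounded_operatorI[where c = "1 / (1 - cmod z)"])
    fix f :: "'a hardy"
    have s: "summable (\<lambda>n. cmod z ^ n * norm f)"
      using z by (intro summable_mult2 summable_geometric) simp
    have le: "norm (z ^ n *\<^sub>C hardy_coeff f n) \<le> cmod z ^ n * norm f" for n
      by (simp add: norm_scaleC norm_power mult_left_mono norm_hardy_coeff_le)
    have "norm (hardy_fun f z) \<le> (\<Sum>n. cmod z ^ n * norm f)"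
      unfolding sums_unique[OF hardy_coeff_sums[OF z, of f]] by (rule norm_suminf_le[OF le s])
    also have "\<dots> = 1 / (1 - cmod z) * norm f"
      using z by (subst suminf_mult2[symmetric]) (simp_all add: suminf_geometric summable_geometric)
    finally show "norm (hardy_fun f z) \<le> 1 / (1 - cmod z) * norm f" .
  qed (simp_all add: hardy_fun_add hardy_fun_scaleC)
  have eq: "hardy_space Y = (\<Inter>z\<in>ball 0 1. (\<lambda>f. hardy_fun f z) -` Y)"
    by (auto simp: hardy_space_def)
  have "closed (hardy_space Y)" unfolding eq
  proof (intro closed_INT ballI closed_vimage closed_csubspaceD(2)[OF Y])
    fix z :: complex assume "z \<in> ball 0 1"
    from bounded_operator_imp_bounded_linear[OF cont[OF this]]
    show "continuous_on UNIV (\<lambda>f :: 'a hardy. hardy_fun f z)"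
      by (rule linear_continuous_on)
  qed
  moreover have "hardy_fun (r *\<^sub>R f) z = r *\<^sub>R hardy_fun f z" for r z and f :: "'a hardy"
    by (simp add: hardy_fun_scaleC flip: scaleC_complex_of_real)
  ultimately show ?thesis
    using closed_csubspaceD[OF Y]
    by (auto simp: closed_csubspace_def subspace_def hardy_space_def hardy_fun_add hardy_fun_scaleC hardy_fun_zero)
qed

section \<open>Defect operators and the operators of the statement\<close>

lemmas bounded_operator_adj = bounded_operator_adjoint_on[OF closed_csubspace_UNIV closed_csubspace_UNIV]
lemmas cinner_adj = cinner_adjoint_on[OF closed_csubspace_UNIV closed_csubspace_UNIV _ UNIV_I UNIV_I]
lemmas inner_adj = inner_adjoint_on[OF closed_csubspace_UNIV closed_csubspace_UNIV _ UNIV_I UNIV_I]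

lemma cinner_adj_left:
  assumes "bounded_operator UNIV UNIV F"
  shows "cinner (F\<^sup>\<dagger> y) x = cinner y (F x)"
  using cinner_adj[OF assms, of x y] by (metis cinner_commute)

lemma inner_adj_left:
  assumes "bounded_operator UNIV UNIV F"
  shows "F\<^sup>\<dagger> y \<bullet> x = y \<bullet> F x"
  using cinner_adj_left[OF assms, of y x] by (metis Re_cinner)

lemma invertible_UNIV_D:
  assumes "invertible_on UNIV F"
  shows "bounded_operator UNIV UNIV (inv F)" "F (inv F y) = y" "inv F (F x) = x"
  using invertible_onD[OF assms] by auto

context
  fixes C :: "'a::chilbert_space \<Rightarrow> 'b::chilbert_space"
  assumes C: "contraction UNIV UNIV C"
begin

lemma contraction_bounded: "bounded_operator UNIV UNIV C"
  using C by (simp add: contraction_def)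

lemma contraction_norm_le: "norm (C x) \<le> norm x"
  using C by (simp add: contraction_def)

lemma positive_id_minus_adj_comp: "positive_on UNIV (\<lambda>x. x - C\<^sup>\<dagger> (C x))"
proof (rule positive_onI)
  show "bounded_operator UNIV UNIV (\<lambda>x. x - C\<^sup>\<dagger> (C x))"
    by (intro bounded_operator_minus_op bounded_operator_id bounded_operator_comp[OF contraction_bounded]
        bounded_operator_adj contraction_bounded) auto
  show "cinner (x - C\<^sup>\<dagger> (C x)) x = cinner x (x - C\<^sup>\<dagger> (C x))" for x
    by (simp add: cinner_diff_left cinner_diff_right cinner_adj_left[OF contraction_bounded]
        cinner_adj[OF contraction_bounded, symmetric])
  show "0 \<le> (x - C\<^sup>\<dagger> (C x)) \<bullet> x" for x
    using power_mono[OF contraction_norm_le[of x], of 2]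
    by (simp add: inner_diff_left inner_adj_left[OF contraction_bounded] power2_norm_eq_inner)
qed

lemma positive_defect: "positive_on UNIV (defect C)"
  unfolding defect_def by (rule positive_on_sqrt_on[OF positive_id_minus_adj_comp closed_csubspace_UNIV])

lemma bounded_operator_defect: "bounded_operator UNIV UNIV (defect C)"
  by (rule positive_onD(1)[OF positive_defect])

lemma norm_defect: "(norm (defect C x))\<^sup>2 = (norm x)\<^sup>2 - (norm (C x))\<^sup>2"
  unfolding defect_def norm_sqrt_on[OF positive_id_minus_adj_comp closed_csubspace_UNIV UNIV_I]
  by (simp add: inner_diff_left inner_adj_left[OF contraction_bounded] power2_norm_eq_inner)

text \<open>\<open>D2 C\<close> is the Gram operator of the inner product weighted by the defect
  operator. The orthogonality arguments for the coupling translate between the two inner products by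
  this identity and its variants.\<close>

lemma cinner_D2: "cinner (D2 C x) y = cinner (defect C x) (defect C y)"
  using positive_on_cinner_commute[OF positive_defect closed_csubspace_UNIV] by (simp add: D2_def)

lemma inner_D2: "D2 C x \<bullet> y = defect C x \<bullet> defect C y"
  using cinner_D2 by (metis Re_cinner)

lemma cinner_D2_right: "cinner x (D2 C y) = cinner (defect C x) (defect C y)"
  using cinner_D2 by (metis cinner_commute)

lemma inner_D2_right: "x \<bullet> D2 C y = defect C x \<bullet> defect C y"
  using cinner_D2_right by (metis Re_cinner)

lemma bounded_operator_D2: "bounded_operator UNIV UNIV (D2 C)"
  unfolding D2_def o_def by (rule bounded_operator_comp[OF bounded_operator_defect bounded_operator_defect])

lemma positive_D2: "positive_on UNIV (D2 C)"
  by (rule positive_onI[OF bounded_operator_D2]) (simp_all add: cinner_D2 cinner_D2_right inner_D2)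

lemma closed_csubspace_defect_space: "closed_csubspace (defect_space C)"
  unfolding defect_space_def by (rule closed_csubspace_closure_range[OF bounded_operator_defect])

lemma defect_in_defect_space: "defect C x \<in> defect_space C"
  unfolding defect_space_def by (rule subsetD[OF closure_subset rangeI])

end

lemma closed_csubspace_ker_adj:
  "bounded_operator UNIV UNIV F \<Longrightarrow> closed_csubspace (ker_adj F)"
  unfolding ker_adj_def by (rule closed_csubspace_kernel[OF bounded_operator_adj])

text \<open>The data on which the coefficient functions depend. The lifting itself enters through
  \<open>contractive_interpolant_iff\<close>.\<close>

locale lifting_problem =
  fixes A :: "'h::chilbert_space \<Rightarrow> 'k::chilbert_space"
    and T' :: "'k \<Rightarrow> 'k"
    and R Q :: "'z::chilbert_space \<Rightarrow> 'h"
  assumes A: "contraction UNIV UNIV A" and strict: "onorm A < 1"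
    and T': "contraction UNIV UNIV T'"
    and R: "bounded_operator UNIV UNIV R" and Q: "bounded_operator UNIV UNIV Q"
    and intertwine: "T' (A (R x)) = A (Q x)"
    and QR: "positive_on UNIV (\<lambda>x. Q\<^sup>\<dagger> (Q x) - R\<^sup>\<dagger> (R x))"
    and left_inverse: "\<exists>L. bounded_operator UNIV UNIV L \<and> (\<forall>x. L (R x) = x)"
begin

abbreviation "D \<equiv> defect A"
abbreviation "J \<equiv> J_op A T' R Q"
abbreviation "J' \<equiv> J_adj A T' R Q"
abbreviation "\<Delta> \<equiv> Delta_Omega A T' R Q"
abbreviation "\<D> \<equiv> defect_sum T' R Q"
abbreviation "\<P> \<equiv> parameter_space T' R Q"
abbreviation "Qplus h \<equiv> inv (D2_conj A Q) (Q\<^sup>\<dagger> (D2 A h))"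
abbreviation "iD2 \<equiv> inv (D2 A)"

lemmas D = bounded_operator_defect[OF A]
lemmas D_lin = bounded_operatorD(2,3)[OF D, simplified] bounded_operator_diff[OF D, simplified]
  bounded_operator_minus[OF D, simplified] bounded_operator_zero[OF D, simplified]
lemma norm_D_le: "norm (D h) \<le> norm h"
  using norm_defect[OF A, of h] by (auto intro!: power2_le_imp_le[of "norm (D h)" "norm h"])

text \<open>Strictness of \<open>A\<close> enters here: \<open>(norm (D h))\<^sup>2 = (norm
  h)\<^sup>2 - (norm (A h))\<^sup>2\<close> leaves the factor \<open>1 - (onorm A)\<^sup>2\<close>,
  so the weighted norm is equivalent to the given one.\<close>

lemma D_lower: obtains \<delta> where "\<delta> > 0" "\<And>h. \<delta> * (norm h)\<^sup>2 \<le> (norm (D h))\<^sup>2"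
proof
  have bl: "bounded_linear A" by (rule bounded_operator_imp_bounded_linear[OF contraction_bounded[OF A]])
  show "1 - (onorm A)\<^sup>2 > 0"
    using strict onorm_pos_le[OF bl] by (simp add: abs_square_less_1)
  fix h
  have "(norm (A h))\<^sup>2 \<le> (onorm A * norm h)\<^sup>2" by (intro power_mono onorm[OF bl]) simp
  then show "(1 - (onorm A)\<^sup>2) * (norm h)\<^sup>2 \<le> (norm (D h))\<^sup>2"
    by (simp add: norm_defect[OF A] power_mult_distrib algebra_simps)
qed

section \<open>Positive definiteness of the operators to be inverted\<close>

lemma positive_definite_D2: "positive_definite_on UNIV (D2 A)"
proof -
  obtain \<delta> where "\<delta> > 0" "\<And>h. \<delta> * (norm h)\<^sup>2 \<le> (norm (D h))\<^sup>2" by (rule D_lower) blast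
  then show ?thesis
    by (intro positive_definite_onI[OF positive_D2[OF A] closed_csubspace_UNIV])
      (auto simp: inner_D2[OF A] power2_norm_eq_inner)
qed

lemma positive_definite_D: "positive_definite_on UNIV D"
proof -
  have *: "D2 A = (\<lambda>x. x - A\<^sup>\<dagger> (A x))"
    by (auto simp: D2_def defect_def fun_eq_iff
        sqrt_on_sqrt_on[OF positive_id_minus_adj_comp[OF A] closed_csubspace_UNIV])
  show ?thesis
    using positive_definite_on_sqrt_on[OF positive_definite_D2 closed_csubspace_UNIV]
    unfolding * by (simp add: defect_def)
qed

lemmas iD2 = invertible_UNIV_D[OF positive_definite_onD(2)[OF positive_definite_D2]]

lemma norm_R_le_Q: "norm (R x) \<le> norm (Q x)"
proof -
  have "(norm (R x))\<^sup>2 \<le> (norm (Q x))\<^sup>2"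
    using positive_onD(2)[OF QR, of x]
    by (simp add: inner_diff_left inner_adj_left[OF R] inner_adj_left[OF Q] power2_norm_eq_inner)
  then show ?thesis by (simp add: power2_le_iff_abs_le)
qed

lemma R_lower: obtains \<rho> where "\<rho> > 0" "\<And>x. \<rho> * norm x \<le> norm (R x)"
proof -
  obtain L where L: "bounded_operator UNIV UNIV L" "\<And>x. L (R x) = x" using left_inverse by blast
  obtain c where c: "c > 0" "\<And>y. norm (L y) \<le> c * norm y"
    by (rule bounded_operator_bound[OF L(1)]) blast
  have "1 / c * norm x \<le> norm (R x)" for x
    using c(2)[of "R x"] c(1) by (simp add: L(2) field_simps)
  then show ?thesis using c(1) by (intro that[of "1 / c"]) auto
qed

lemma positive_definite_D2_conj:
  assumes S: "bounded_operator UNIV UNIV S" and "\<rho> > 0" and lower: "\<And>x. \<rho> * norm x \<le> norm (S x)"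
  shows "positive_definite_on UNIV (D2_conj A S)"
proof -
  obtain \<delta> where \<delta>: "\<delta> > 0" "\<And>h. \<delta> * (norm h)\<^sup>2 \<le> (norm (D h))\<^sup>2" by (rule D_lower) blast
  show ?thesis
  proof (rule positive_definite_onI[of _ _ "\<delta> * \<rho>\<^sup>2"])
    show "positive_on UNIV (D2_conj A S)"
      unfolding D2_conj_def
      by (rule positive_onI) (simp_all add: bounded_operator_comp[OF S bounded_operator_comp[OF
              bounded_operator_D2[OF A] bounded_operator_adj[OF S]]] cinner_adj_left[OF S]
          cinner_adj[OF S, symmetric] inner_adj_left[OF S] cinner_D2[OF A] cinner_D2_right[OF A]
          inner_D2[OF A])
    show "\<delta> * \<rho>\<^sup>2 * (norm x)\<^sup>2 \<le> D2_conj A S x \<bullet> x" for x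
    proof -
      have "\<delta> * (\<rho> * norm x)\<^sup>2 \<le> \<delta> * (norm (S x))\<^sup>2"
        using \<delta>(1) \<open>\<rho> > 0\<close> by (intro mult_left_mono power_mono lower) auto
      also have "\<dots> \<le> (norm (D (S x)))\<^sup>2" by (rule \<delta>(2))
      finally show ?thesis
        by (simp add: D2_conj_def inner_adj_left[OF S] inner_D2[OF A] power_mult_distrib
            power2_norm_eq_inner)
    qed
  qed (use \<delta> \<open>\<rho> > 0\<close> in auto)
qed

lemma positive_definite_D2_conj_R: "positive_definite_on UNIV (D2_conj A R)"
  by (rule R_lower) (rule positive_definite_D2_conj[OF R])

text \<open>\<open>Q\<close> inherits the lower bound of \<open>R\<close> because
  \<open>norm (R x) \<le> norm (Q x)\<close>.\<close>

lemma positive_definite_D2_conj_Q: "positive_definite_on UNIV (D2_conj A Q)"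
  by (rule R_lower) (rule positive_definite_D2_conj[OF Q _ order_trans[OF _ norm_R_le_Q]])

lemmas inv_conj_R = invertible_UNIV_D[OF positive_definite_onD(2)[OF positive_definite_D2_conj_R]]
lemmas inv_conj_Q = invertible_UNIV_D[OF positive_definite_onD(2)[OF positive_definite_D2_conj_Q]]

text \<open>The form of \<open>Delta A S\<close> at \<open>x\<close> is
  \<open>(norm (D (iD2 x)))\<^sup>2\<close>. Since \<open>x = D (D (iD2 x))\<close> and
  \<open>D\<close> is contractive, it dominates \<open>(norm x)\<^sup>2\<close>.\<close>

lemma positive_definite_Delta:
  assumes S: "bounded_operator UNIV UNIV S"
  shows "positive_definite_on (ker_adj S) (Delta A S)"
    and "x \<in> ker_adj S \<Longrightarrow> Delta A S x \<bullet> x = (norm (D (iD2 x)))\<^sup>2"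
proof -
  note K = closed_csubspace_ker_adj[OF S]
  have bo: "bounded_operator (ker_adj S) (ker_adj S) (Delta A S)"
    unfolding Delta_def
    by (rule bounded_operator_comp[OF bounded_operator_mono[OF iD2(1)] bounded_operator_orth_proj[OF K]]) auto
  have form: "cinner (Delta A S x) y = cinner (D (iD2 x)) (D (iD2 y))" if "y \<in> ker_adj S" for x y
  proof -
    have "cinner (Delta A S x) y = cinner (iD2 x) (D2 A (iD2 y))"
      by (simp add: Delta_def cinner_orth_proj_left[OF K that] iD2(2))
    then show ?thesis by (simp add: cinner_D2_right[OF A])
  qed
  then show form': "Delta A S x \<bullet> x = (norm (D (iD2 x)))\<^sup>2" if "x \<in> ker_adj S" for x
    using that by (metis Re_cinner power2_norm_eq_inner)
  show "positive_definite_on (ker_adj S) (Delta A S)"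
  proof (rule positive_definite_onI[of _ _ 1])
    show "positive_on (ker_adj S) (Delta A S)"
      by (rule positive_onI[OF bo]) (simp_all add: form form' cinner_commute[of _ "Delta A S _"] cinner_self)
    show "1 * (norm x)\<^sup>2 \<le> Delta A S x \<bullet> x" if "x \<in> ker_adj S" for x
    proof -
      have "norm x = norm (D (D (iD2 x)))" using iD2(2)[of x] by (simp add: D2_def)
      also have "\<dots> \<le> norm (D (iD2 x))" by (rule norm_D_le)
      finally show ?thesis using that by (simp add: form')
    qed
  qed (simp_all add: K)
qed

lemmas KQ = closed_csubspace_ker_adj[OF Q]
lemmas KR = closed_csubspace_ker_adj[OF R]
lemmas Delta_Q = positive_definite_Delta[OF Q]
lemmas Delta_R = positive_definite_Delta[OF R]

lemma bounded_operator_D_circ: "bounded_operator UNIV UNIV (D_circ R Q)"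
  unfolding D_circ_def by (rule positive_onD(1)[OF positive_on_sqrt_on[OF QR closed_csubspace_UNIV]])

lemma norm_D_circ: "(norm (D_circ R Q x))\<^sup>2 = (norm (Q x))\<^sup>2 - (norm (R x))\<^sup>2"
  unfolding D_circ_def norm_sqrt_on[OF QR closed_csubspace_UNIV UNIV_I]
  by (simp add: inner_diff_left inner_adj_left[OF R] inner_adj_left[OF Q] power2_norm_eq_inner)

lemma closed_csubspace_D_circ_space: "closed_csubspace (D_circ_space R Q)"
  unfolding D_circ_space_def by (rule closed_csubspace_closure_range[OF bounded_operator_D_circ])

lemma D_circ_in: "D_circ R Q x \<in> D_circ_space R Q"
  unfolding D_circ_space_def by (rule subsetD[OF closure_subset rangeI])

lemma closed_\<D>: "closed_csubspace \<D>"
  unfolding defect_sum_def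
  by (intro closed_csubspace_Times closed_csubspace_D_circ_space closed_csubspace_defect_space T')

lemma closed_\<P>: "closed_csubspace \<P>"
  unfolding parameter_space_def
  by (intro closed_csubspace_Times closed_csubspace_D_circ_space closed_csubspace_defect_space T' KR)

lemma bounded_operator_defect_AR: "bounded_operator UNIV (defect_space T') (\<lambda>x. defect T' (A (R x)))"
  by (rule bounded_operator_codomain[OF bounded_operator_comp[OF R bounded_operator_comp[OF
          contraction_bounded[OF A] bounded_operator_defect[OF T']]] defect_in_defect_space[OF T']])

lemma bounded_operator_J: "bounded_operator UNIV \<D> J"
  unfolding J_op_def defect_sum_def
  by (rule bounded_operator_Pair[OF bounded_operator_codomain[OF bounded_operator_D_circ D_circ_in]
        bounded_operator_defect_AR])

lemma bounded_operator_J': "bounded_operator \<D> UNIV J'"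
  unfolding J_adj_def by (rule bounded_operator_adjoint_on[OF closed_csubspace_UNIV closed_\<D> bounded_operator_J])

lemma cinner_J: "p \<in> \<D> \<Longrightarrow> cinner (J x) p = cinner x (J' p)"
  unfolding J_adj_def by (rule cinner_adjoint_on[OF closed_csubspace_UNIV closed_\<D> bounded_operator_J UNIV_I])

lemma inner_J: "p \<in> \<D> \<Longrightarrow> J x \<bullet> p = x \<bullet> J' p"
  using cinner_J by (metis Re_cinner)

text \<open>Hence \<open>Q x \<mapsto> (J x, R x)\<close> is isometric when \<open>H\<close> carries the norm \<open>norm (D h)\<close>.\<close>

lemma norm_D_Q: "(norm (D (Q x)))\<^sup>2 = (norm (J x))\<^sup>2 + (norm (D (R x)))\<^sup>2"
proof -
  have "(norm (J x))\<^sup>2 = (norm (D_circ R Q x))\<^sup>2 + (norm (defect T' (A (R x))))\<^sup>2"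
    by (simp add: J_op_def norm_Pair)
  \<comment> \<open>After expansion the terms telescope; \<open>T' (A (R x)) = A (Q x)\<close>
    identifies the last one.\<close>
  then show ?thesis
    by (simp add: norm_defect[OF A] norm_defect[OF T'] norm_D_circ intertwine)
qed

text \<open>The summand added to the identity is positive: with \<open>y\<close> solving
  \<open>D2_conj A R y = J' p\<close>, its form at \<open>p\<close> equals
  \<open>D2_conj A R y \<bullet> y\<close>.\<close>

lemma positive_definite_Delta_Omega: "positive_definite_on \<D> \<Delta>"
proof -
  define y where "y p = inv (D2_conj A R) (J' p)" for p
  have y: "D2_conj A R (y p) = J' p" for p by (simp add: y_def inv_conj_R(2))
  note conj_pos = positive_definite_onD(1)[OF positive_definite_D2_conj_R]
  have bo_y: "bounded_operator \<D> UNIV y"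
    unfolding y_def by (rule bounded_operator_comp[OF bounded_operator_J' inv_conj_R(1)])
  have bo: "bounded_operator \<D> \<D> \<Delta>"
    unfolding Delta_Omega_def
    by (intro bounded_operator_plus[OF bounded_operator_id bounded_operator_comp[OF bo_y[unfolded y_def]
            bounded_operator_J] closed_\<D>]) auto
  show ?thesis
  proof (rule positive_definite_onI[of _ _ 1])
    show "positive_on \<D> \<Delta>"
    proof (rule positive_onI[OF bo])
      fix p assume p: "p \<in> \<D>"
      have "cinner (J (y p)) p = cinner (y p) (D2_conj A R (y p))" by (simp add: cinner_J[OF p] y)
      moreover have "cinner p (J (y p)) = cinner (D2_conj A R (y p)) (y p)"
        unfolding y by (metis cinner_J[OF p] cinner_commute)
      ultimately show "cinner (\<Delta> p) p = cinner p (\<Delta> p)"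
        using positive_on_cinner_commute[OF conj_pos closed_csubspace_UNIV UNIV_I UNIV_I, of "y p" "y p"]
        by (simp add: Delta_Omega_def cinner_add_left cinner_add_right flip: y_def)
    next
      fix p assume p: "p \<in> \<D>"
      show "0 \<le> \<Delta> p \<bullet> p"
        using positive_onD(2)[OF conj_pos UNIV_I, of "y p"]
        by (simp add: Delta_Omega_def inner_add_left inner_J[OF p] y inner_commute[of "J' p"] flip: y_def)
    qed
    show "1 * (norm p)\<^sup>2 \<le> \<Delta> p \<bullet> p" if p: "p \<in> \<D>" for p
      using positive_onD(2)[OF conj_pos UNIV_I, of "y p"]
      by (simp add: Delta_Omega_def inner_add_left inner_J[OF p] y inner_commute[of "J' p"]
          power2_norm_eq_inner flip: y_def)
  qed (simp_all add: closed_\<D>)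
qed

section \<open>The unitary coupling\<close>

text \<open>\<open>G\<close> inverts \<open>X3\<close> on the complement of the range of \<open>Q\<close> in the inner product of \<open>D\<close>.\<close>

definition G :: "'h \<Rightarrow> 'h" where
  "G e = iD2 (inv_sqrt_on (ker_adj Q) (Delta A Q) e)"

lemma bounded_operator_G: "bounded_operator (ker_adj Q) UNIV G"
  unfolding G_def
  by (rule bounded_operator_comp[OF bounded_operator_inv_sqrt_on[OF Delta_Q(1) KQ]
        bounded_operator_mono[OF iD2(1)]]) auto

lemma bounded_operator_X3: "bounded_operator UNIV (ker_adj Q) (X3 A Q)"
  unfolding X3_def
  by (rule bounded_operator_comp[OF bounded_operator_orth_proj[OF KQ]
        bounded_operator_inv_sqrt_on[OF Delta_Q(1) KQ]])

lemma bounded_operator_Qplus: "bounded_operator UNIV UNIV (\<lambda>h. Qplus h)"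
  by (rule bounded_operator_comp[OF bounded_operator_comp[OF bounded_operator_D2[OF A]
          bounded_operator_adj[OF Q]] inv_conj_Q(1)])

lemma inner_Q_ker: "k \<in> ker_adj Q \<Longrightarrow> Q x \<bullet> k = 0"
  by (simp add: inner_adj[OF Q] ker_adj_def)

lemma inner_R_ker: "k \<in> ker_adj R \<Longrightarrow> R x \<bullet> k = 0"
  by (simp add: inner_adj[OF R] ker_adj_def)

lemma D2_G: "D2 A (G e) = inv_sqrt_on (ker_adj Q) (Delta A Q) e"
  by (simp add: G_def iD2(2))

lemma D2_G_in: "e \<in> ker_adj Q \<Longrightarrow> D2 A (G e) \<in> ker_adj Q"
  unfolding D2_G by (rule inv_sqrt_on_in[OF Delta_Q(1) KQ])

lemma D_Q_orth_D_G: "e \<in> ker_adj Q \<Longrightarrow> D (Q x) \<bullet> D (G e) = 0"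
  using inner_Q_ker[OF D2_G_in] by (simp add: inner_D2_right[OF A])

lemma Qplus_Q: "Qplus (Q x) = x"
  using inv_conj_Q(3)[of x] by (simp add: D2_conj_def)

lemma X3_G: assumes "e \<in> ker_adj Q" shows "X3 A Q (G e) = e"
proof -
  have "X3 A Q (G e) = inv_sqrt_on (ker_adj Q) (Delta A Q) (Delta A Q (inv_sqrt_on (ker_adj Q) (Delta A Q) e))"
    by (simp add: X3_def G_def Delta_def)
  also have "\<dots> = e"
    by (simp add: inv_sqrt_on_sqrt_on[OF Delta_Q(1) KQ] apply_inv_sqrt_on[OF Delta_Q(1) KQ] assms)
  finally show ?thesis .
qed

lemma X3_Q: "X3 A Q (Q x) = 0"
proof -
  have "orth_proj (ker_adj Q) (Q x) = 0"
    by (rule orth_proj_eqI[OF KQ closed_csubspaceD(3)[OF KQ]]) (simp add: cinner_adj[OF Q] ker_adj_def)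
  then show ?thesis
    by (simp add: X3_def bounded_operator_zero[OF bounded_operator_inv_sqrt_on[OF Delta_Q(1) KQ] KQ])
qed

lemma norm_D_G: "e \<in> ker_adj Q \<Longrightarrow> (norm (D (G e)))\<^sup>2 = (norm e)\<^sup>2"
  unfolding G_def
  by (simp add: Delta_Q(2)[symmetric] inv_sqrt_on_in[OF Delta_Q(1) KQ]
      inner_apply_inv_sqrt_on[OF Delta_Q(1) KQ])

text \<open>\<open>Qplus\<close> is the weighted least squares inverse of \<open>Q\<close>: the
  residual \<open>h - Q (Qplus h)\<close> is orthogonal to the range of \<open>Q\<close> in the
  weighted inner product, so \<open>D2 A\<close> sends it into \<open>ker_adj Q\<close>, and the
  vectors with this property are those reached by \<open>G\<close>.\<close>

lemma decomposition: "h = Q (Qplus h) + G (X3 A Q h)"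
proof -
  define k where "k = D2 A (h - Q (Qplus h))"
  note D2_lin = bounded_operatorD(2)[OF bounded_operator_D2[OF A], simplified]
    bounded_operator_diff[OF bounded_operator_D2[OF A], simplified]
  have "Q\<^sup>\<dagger> k = Q\<^sup>\<dagger> (D2 A h) - D2_conj A Q (Qplus h)"
    by (simp add: k_def D2_lin D2_conj_def bounded_operator_diff[OF bounded_operator_adj[OF Q]])
  then have k: "k \<in> ker_adj Q" by (simp add: ker_adj_def inv_conj_Q(2))
  have h: "h = Q (Qplus h) + iD2 k" by (simp add: k_def iD2(3))
  have kG: "iD2 k = G (sqrt_on (ker_adj Q) (Delta A Q) k)"
    by (simp add: G_def inv_sqrt_on_sqrt_on[OF Delta_Q(1) KQ k])
  have "X3 A Q h = X3 A Q (Q (Qplus h)) + X3 A Q (iD2 k)"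
    by (subst h) (simp add: bounded_operatorD(2)[OF bounded_operator_X3])
  also have "\<dots> = sqrt_on (ker_adj Q) (Delta A Q) k"
    unfolding kG by (simp add: X3_Q X3_G sqrt_on_in[OF Delta_Q(1) KQ k])
  finally have "G (X3 A Q h) = iD2 k" unfolding kG by (rule arg_cong)
  from h[folded this] show ?thesis .
qed

lemmas X3_in = bounded_operatorD(1)[OF bounded_operator_X3 UNIV_I]

lemma norm_D_decomposition: "(norm (D h))\<^sup>2 = (norm (D (Q (Qplus h))))\<^sup>2 + (norm (X3 A Q h))\<^sup>2"
proof -
  have "D h = D (Q (Qplus h)) + D (G (X3 A Q h))"
    using arg_cong[OF decomposition[of h], of D] by (simp only: D_lin)
  then have "(norm (D h))\<^sup>2 = (norm (D (Q (Qplus h))))\<^sup>2 + 2 * (D (Q (Qplus h)) \<bullet> D (G (X3 A Q h)))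
      + (norm (D (G (X3 A Q h))))\<^sup>2"
    by (simp add: power2_norm_eq_inner inner_add_left inner_add_right inner_commute)
  then show ?thesis by (simp add: D_Q_orth_D_G[OF X3_in] norm_D_G[OF X3_in])
qed

text \<open>Together with \<open>X2\<close> this is the input column of the coupling. Its second
  component is \<open>X5\<close>; the first lies in the closed range of
  \<open>D_circ\<close>.\<close>

definition E1 :: "'z \<times> 'k \<times> 'h \<Rightarrow> 'z \<times> 'k" where
  "E1 u = inv_sqrt_on \<D> \<Delta> (fst u, fst (snd u))"

lemmas Delta_O = positive_definite_Delta_Omega closed_\<D>

lemma parameter_space_iff: "u \<in> \<P> \<longleftrightarrow> (fst u, fst (snd u)) \<in> \<D> \<and> snd (snd u) \<in> ker_adj R"
  by (auto simp: parameter_space_def defect_sum_def mem_Times_iff)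

lemma bounded_operator_E1: "bounded_operator \<P> \<D> E1"
proof -
  have "bounded_operator \<P> \<D> (\<lambda>u. (fst u, fst (snd u)))"
    unfolding parameter_space_def defect_sum_def
    by (intro bounded_operator_Pair bounded_operator_fst
        bounded_operator_comp[OF bounded_operator_snd bounded_operator_fst])
  then show ?thesis
    unfolding E1_def by (rule bounded_operator_comp[OF _ bounded_operator_inv_sqrt_on[OF Delta_O]])
qed

lemmas E1_in = bounded_operatorD(1)[OF bounded_operator_E1]

lemma X2_eq: "X2 A T' R Q u = - R (inv (D2_conj A R) (J' (E1 u)))
    - iD2 (inv_sqrt_on (ker_adj R) (Delta A R) (snd (snd u)))"
  by (simp add: X2_def E1_def split: prod.split)

lemma X5_eq: "X5 A T' R Q u = snd (E1 u)"
  by (simp add: X5_def E1_def split: prod.split)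

lemma bounded_operator_X2: "bounded_operator \<P> UNIV (X2 A T' R Q)"
proof -
  have "bounded_operator \<P> UNIV (\<lambda>u. - R (inv (D2_conj A R) (J' (E1 u))))"
    by (intro bounded_operator_uminus bounded_operator_comp[OF bounded_operator_E1
          bounded_operator_comp[OF bounded_operator_J' bounded_operator_comp[OF inv_conj_R(1) R]]]) simp
  moreover have "bounded_operator \<P> UNIV (\<lambda>u. iD2 (inv_sqrt_on (ker_adj R) (Delta A R) (snd (snd u))))"
    unfolding parameter_space_def
    by (rule bounded_operator_comp[OF bounded_operator_comp[OF bounded_operator_snd bounded_operator_snd]
          bounded_operator_comp[OF bounded_operator_inv_sqrt_on[OF Delta_R(1) KR]
          bounded_operator_mono[OF iD2(1)]]]) auto
  ultimately show ?thesis unfolding X2_eq[abs_def] by (intro bounded_operator_minus_op) simp_all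
qed

lemma bounded_operator_X5: "bounded_operator \<P> (defect_space T') (X5 A T' R Q)"
  unfolding X5_eq[abs_def]
  by (rule bounded_operator_comp[OF bounded_operator_E1[unfolded defect_sum_def] bounded_operator_snd])

text \<open>Two cancellations: the part of \<open>X2\<close> in the range of \<open>R\<close> is
  chosen to offset \<open>J x \<bullet> E1 u\<close>, and the part coming from
  \<open>ker_adj R\<close> pairs to zero with \<open>R x\<close>. Thus inputs act orthogonally to
  the vectors \<open>(J x, R x)\<close>.\<close>

lemma E_orth:
  assumes u: "u \<in> \<P>"
  shows "J x \<bullet> E1 u + D (R x) \<bullet> D (X2 A T' R Q u) = 0"
proof -
  define q where "q = E1 u"
  define y where "y = inv (D2_conj A R) (J' q)"
  define k where "k = inv_sqrt_on (ker_adj R) (Delta A R) (snd (snd u))"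
  have q: "q \<in> \<D>" unfolding q_def by (rule E1_in[OF u])
  have k: "k \<in> ker_adj R"
    unfolding k_def using u by (intro inv_sqrt_on_in[OF Delta_R(1) KR]) (simp add: parameter_space_iff)
  have "D (R x) \<bullet> D (R y) = x \<bullet> D2_conj A R y"
    by (simp add: D2_conj_def inner_adj[OF R, symmetric] inner_D2_right[OF A])
  also have "\<dots> = J x \<bullet> q" by (simp add: y_def inv_conj_R(2) inner_J[OF q])
  finally have 1: "D (R x) \<bullet> D (R y) = J x \<bullet> q" .
  have 2: "D (R x) \<bullet> D (iD2 k) = 0"
    using inner_D2_right[OF A, of "R x" "iD2 k"] by (simp add: iD2(2) inner_R_ker[OF k])
  have "X2 A T' R Q u = - R y - iD2 k" by (simp add: X2_eq q_def y_def k_def)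
  then show ?thesis by (simp add: D_lin inner_diff_right 1 2 flip: q_def)
qed

text \<open>For \<open>q = E1 u\<close> and \<open>y\<close> solving
  \<open>D2_conj A R y = J' q\<close>, the operator \<open>\<Delta>\<close> is made so that
  \<open>(norm q)\<^sup>2 + (norm (D (R y)))\<^sup>2 = \<Delta> q \<bullet> q\<close>. The inverse
  roots of \<open>\<Delta>\<close> and \<open>Delta A R\<close> then restore the norms of the
  components of \<open>u\<close>, and the two parts of \<open>X2\<close> are orthogonal in the
  weighted inner product.\<close>

lemma norm_E:
  assumes u: "u \<in> \<P>"
  shows "(norm (E1 u))\<^sup>2 + (norm (D (X2 A T' R Q u)))\<^sup>2 = (norm u)\<^sup>2"
proof -
  define q where "q = E1 u"
  define y where "y = inv (D2_conj A R) (J' q)"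
  define k where "k = inv_sqrt_on (ker_adj R) (Delta A R) (snd (snd u))"
  have uD: "(fst u, fst (snd u)) \<in> \<D>" "snd (snd u) \<in> ker_adj R" using u by (simp_all add: parameter_space_iff)
  have q: "q \<in> \<D>" unfolding q_def by (rule E1_in[OF u])
  have k: "k \<in> ker_adj R" unfolding k_def by (rule inv_sqrt_on_in[OF Delta_R(1) KR uD(2)])
  have X2: "X2 A T' R Q u = - R y - iD2 k" by (simp add: X2_eq q_def y_def k_def)
  have "D (R y) \<bullet> D (iD2 k) = 0"
    using inner_D2_right[OF A, of "R y" "iD2 k"] by (simp add: iD2(2) inner_R_ker[OF k])
  then have "(norm (D (X2 A T' R Q u)))\<^sup>2 = (norm (D (R y)))\<^sup>2 + (norm (D (iD2 k)))\<^sup>2"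
    by (simp add: X2 D_lin power2_norm_eq_inner inner_diff_left inner_diff_right inner_commute)
  moreover have "(norm (D (iD2 k)))\<^sup>2 = (norm (snd (snd u)))\<^sup>2"
    using inner_apply_inv_sqrt_on[OF Delta_R(1) KR uD(2)] by (simp add: Delta_R(2)[OF k, symmetric] flip: k_def)
  moreover have "(norm q)\<^sup>2 + (norm (D (R y)))\<^sup>2 = (norm (fst u, fst (snd u)))\<^sup>2"
  proof -
    have "D (R y) \<bullet> D (R y) = y \<bullet> D2_conj A R y"
      by (simp add: D2_conj_def inner_adj[OF R, symmetric] inner_D2_right[OF A])
    also have "\<dots> = J y \<bullet> q" by (simp add: y_def inv_conj_R(2) inner_J[OF q])
    finally have "(norm q)\<^sup>2 + (norm (D (R y)))\<^sup>2 = \<Delta> q \<bullet> q"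
      by (simp add: Delta_Omega_def power2_norm_eq_inner inner_add_left y_def)
    also have "\<dots> = (norm (fst u, fst (snd u)))\<^sup>2"
      unfolding q_def E1_def by (rule inner_apply_inv_sqrt_on[OF Delta_O uD(1)])
    finally show ?thesis .
  qed
  moreover have "(norm u)\<^sup>2 = (norm (fst u, fst (snd u)))\<^sup>2 + (norm (snd (snd u)))\<^sup>2"
    by (cases u, simp add: norm_Pair split: prod.split)
  ultimately show ?thesis by (simp flip: q_def)
qed

text \<open>Inverse of the input column. The projections turn it into a bounded operator on the
  whole space, as the realisation of \<open>V\<close> requires; on the range of the column they act
  as identities.\<close>

definition E_inv :: "('z \<times> 'k) \<times> 'h \<Rightarrow> 'z \<times> 'k \<times> 'h" where
  "E_inv p = (fst (sqrt_on \<D> \<Delta> (orth_proj \<D> (fst p))), snd (sqrt_on \<D> \<Delta> (orth_proj \<D> (fst p))),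
    sqrt_on (ker_adj R) (Delta A R) (orth_proj (ker_adj R)
      (D2 A (- (snd p + R (inv (D2_conj A R) (J' (orth_proj \<D> (fst p)))))))))"

lemma bounded_operator_E_inv: "bounded_operator UNIV \<P> E_inv"
proof -
  note fst = bounded_operator_fst[of UNIV UNIV, unfolded UNIV_Times_UNIV]
  note snd = bounded_operator_snd[of UNIV UNIV, unfolded UNIV_Times_UNIV]
  note P = bounded_operator_comp[OF fst bounded_operator_orth_proj[OF closed_\<D>]]
  have sq: "bounded_operator UNIV \<D> (\<lambda>p. sqrt_on \<D> \<Delta> (orth_proj \<D> (fst p)))"
    by (rule bounded_operator_comp[OF P positive_onD(1)[OF positive_on_sqrt_on[OF
            positive_definite_onD(1)[OF positive_definite_Delta_Omega] closed_\<D>]]])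
  have "bounded_operator UNIV UNIV (\<lambda>p. snd p + R (inv (D2_conj A R) (J' (orth_proj \<D> (fst p)))))"
    by (rule bounded_operator_plus[OF snd bounded_operator_comp[OF P bounded_operator_comp[OF
            bounded_operator_J' bounded_operator_comp[OF inv_conj_R(1) R]]] closed_csubspace_UNIV])
  note bounded_operator_comp[OF bounded_operator_uminus[OF this closed_csubspace_UNIV] bounded_operator_D2[OF A]]
  note bounded_operator_comp[OF bounded_operator_comp[OF this bounded_operator_orth_proj[OF KR]]
      positive_onD(1)[OF positive_on_sqrt_on[OF positive_definite_onD(1)[OF Delta_R(1)] KR]]]
  with sq show ?thesis
    unfolding E_inv_def[abs_def] parameter_space_def
    by (intro bounded_operator_Pair bounded_operator_comp[OF sq[unfolded defect_sum_def] bounded_operator_fst, folded defect_sum_def]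
        bounded_operator_comp[OF sq[unfolded defect_sum_def] bounded_operator_snd, folded defect_sum_def])
qed

text \<open>Orthogonality to all \<open>(J x, R x)\<close> says that \<open>k\<close>, the image of
  \<open>- (h + R y)\<close> under \<open>D2 A\<close>, is annihilated by
  \<open>R\<^sup>\<dagger>\<close> and so lies in the domain of \<open>Delta A R\<close>. Hence
  inputs fill the whole orthogonal complement, which makes the coupling unitary.\<close>

lemma E_inv:
  assumes q: "q \<in> \<D>" and orth: "\<And>x. J x \<bullet> q + D (R x) \<bullet> D h = 0"
  shows "E1 (E_inv (q, h)) = q" "X2 A T' R Q (E_inv (q, h)) = h"
proof -
  define y where "y = inv (D2_conj A R) (J' q)"
  define k where "k = D2 A (- (h + R y))"
  have "x \<bullet> R\<^sup>\<dagger> k = 0" for x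
  proof -
    have "x \<bullet> R\<^sup>\<dagger> k = - (D (R x) \<bullet> D h) - x \<bullet> D2_conj A R y"
      by (simp add: k_def inner_adj[OF R, symmetric] inner_D2_right[OF A] D_lin inner_diff_right
          D2_conj_def)
    also have "\<dots> = - (D (R x) \<bullet> D h) - J x \<bullet> q" by (simp add: y_def inv_conj_R(2) inner_J[OF q])
    finally show ?thesis using orth[of x] by simp
  qed
  from this[of "R\<^sup>\<dagger> k"] have k: "k \<in> ker_adj R" by (simp add: ker_adj_def)
  have u: "E_inv (q, h) = (fst (sqrt_on \<D> \<Delta> q), snd (sqrt_on \<D> \<Delta> q), sqrt_on (ker_adj R) (Delta A R) k)"
    by (simp only: E_inv_def fst_conv snd_conv orth_proj_ident[OF closed_\<D> q]
        y_def[symmetric] k_def[symmetric] orth_proj_ident[OF KR k])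
  show E1: "E1 (E_inv (q, h)) = q" by (simp add: E1_def u inv_sqrt_on_sqrt_on[OF Delta_O q])
  have "X2 A T' R Q (E_inv (q, h)) = - R y - iD2 k"
    unfolding X2_eq E1 by (simp add: y_def u inv_sqrt_on_sqrt_on[OF Delta_R(1) KR k])
  also have "\<dots> = h" by (simp add: k_def iD2(3))
  finally show "X2 A T' R Q (E_inv (q, h)) = h" .
qed

lemma bounded_operator_X1: "bounded_operator UNIV UNIV (X1 A R Q)"
  unfolding X1_def by (rule bounded_operator_comp[OF bounded_operator_Qplus R])

lemma bounded_operator_X4: "bounded_operator UNIV (defect_space T') (X4 A T' R Q)"
  unfolding X4_def by (rule bounded_operator_comp[OF bounded_operator_Qplus bounded_operator_defect_AR])

text \<open>An inequality only because the component in \<open>D_circ_space R Q\<close> is dropped.\<close>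

lemma energy:
  assumes u: "u \<in> \<P>"
  shows "(norm (X4 A T' R Q h + X5 A T' R Q u))\<^sup>2 + (norm (D (X1 A R Q h + X2 A T' R Q u)))\<^sup>2
    + (norm (X3 A Q h))\<^sup>2 \<le> (norm (D h))\<^sup>2 + (norm u)\<^sup>2"
proof -
  define x where "x = Qplus h"
  have X1: "X1 A R Q h = R x" by (simp add: X1_def x_def)
  have "X4 A T' R Q h + X5 A T' R Q u = snd (J x + E1 u)"
    by (simp add: X4_def X5_eq J_op_def x_def)
  then have "(norm (X4 A T' R Q h + X5 A T' R Q u))\<^sup>2 \<le> (norm (J x + E1 u))\<^sup>2"
    using norm_snd_le[where x = "fst (J x + E1 u)" and y = "snd (J x + E1 u)"]
    by (simp add: power_mono del: fst_add snd_add)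
  moreover have "(norm (J x + E1 u))\<^sup>2 = (norm (J x))\<^sup>2 + 2 * (J x \<bullet> E1 u) + (norm (E1 u))\<^sup>2"
    by (simp add: power2_norm_eq_inner inner_add_left inner_add_right inner_commute)
  moreover have "(norm (D (X1 A R Q h + X2 A T' R Q u)))\<^sup>2 =
      (norm (D (R x)))\<^sup>2 + 2 * (D (R x) \<bullet> D (X2 A T' R Q u)) + (norm (D (X2 A T' R Q u)))\<^sup>2"
    by (simp add: X1 D_lin power2_norm_eq_inner inner_add_left inner_add_right inner_commute)
  ultimately show ?thesis
    using norm_D_Q[of x] E_orth[OF u, of x] norm_E[OF u] norm_D_decomposition[of h] by (simp flip: x_def)
qed

end

section \<open>The coefficient functions\<close>

lemma operator_analytic_cong:
  assumes "operator_analytic U Y V" "\<And>z u. z \<in> ball 0 1 \<Longrightarrow> u \<in> U \<Longrightarrow> V z u = V' z u"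
  shows "operator_analytic U Y V'"
  using assms(1) unfolding operator_analytic_def by (simp add: assms(2))

lemma (in power_bounded_operator) operator_analytic_Res: "operator_analytic UNIV UNIV Res"
proof (rule operator_analytic_cong)
  show "operator_analytic UNIV UNIV (\<lambda>z u. u + z *\<^sub>C A (Res z u))"
    by (rule operator_analytic_transfer[OF bounded_operator_id bounded_operator_id A]) auto
qed (simp add: Res_eq[symmetric])

context lifting_problem
begin

abbreviation "x1 \<equiv> X1 A R Q"
abbreviation "x2 \<equiv> X2 A T' R Q"
abbreviation "x3 \<equiv> X3 A Q"
abbreviation "x4 \<equiv> X4 A T' R Q"
abbreviation "x5 \<equiv> X5 A T' R Q"

lemmas X1_lin = bounded_operatorD(2,3)[OF bounded_operator_X1, simplified]
lemmas X3_lin = bounded_operatorD(2,3)[OF bounded_operator_X3, simplified]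
lemmas X4_lin = bounded_operatorD(2,3)[OF bounded_operator_X4, simplified]
lemmas X4_in = bounded_operatorD(1)[OF bounded_operator_X4 UNIV_I]
lemmas X5_in = bounded_operatorD(1)[OF bounded_operator_X5]

lemma energy_free: "(norm (x4 h))\<^sup>2 + (norm (D (x1 h)))\<^sup>2 + (norm (x3 h))\<^sup>2 \<le> (norm (D h))\<^sup>2"
  using energy[OF closed_csubspaceD(3)[OF closed_\<P>], of h]
  by (simp add: bounded_operator_zero[OF bounded_operator_X2 closed_\<P>]
      bounded_operator_zero[OF bounded_operator_X5 closed_\<P>])

lemma norm_D_power_X1: "norm (D ((x1 ^^ n) h)) \<le> norm (D h)"
proof (induction n)
  case (Suc n)
  have "(norm (D (x1 ((x1 ^^ n) h))))\<^sup>2 \<le> (norm (D ((x1 ^^ n) h)))\<^sup>2"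
    using energy_free[of "(x1 ^^ n) h"] zero_le_power2[of "norm (x4 ((x1 ^^ n) h))"]
      zero_le_power2[of "norm (x3 ((x1 ^^ n) h))"] by linarith
  then have "norm (D ((x1 ^^ Suc n) h)) \<le> norm (D ((x1 ^^ n) h))" by simp
  then show ?case using Suc by linarith
qed simp

text \<open>\<open>X1\<close> contracts the weighted norm, so \<open>1 / sqrt \<delta>\<close>
  serves, with \<open>\<delta>\<close> from \<open>D_lower\<close>. That constant is merely obtained
  inside a proof, whereas the interpretation needs a fixed term; hence the
  \<open>SOME\<close>.\<close>

definition power_bound :: real where
  "power_bound = (SOME K. \<forall>n h. norm ((x1 ^^ n) h) \<le> K * norm h)"

lemma power_bound: "norm ((x1 ^^ n) h) \<le> power_bound * norm h"
proof -
  obtain \<delta> where \<delta>: "\<delta> > 0" "\<And>h. \<delta> * (norm h)\<^sup>2 \<le> (norm (D h))\<^sup>2" by (rule D_lower) blast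
  have "norm ((x1 ^^ n) h) \<le> (1 / sqrt \<delta>) * norm h" for n h
  proof -
    have "\<delta> * (norm ((x1 ^^ n) h))\<^sup>2 \<le> (norm (D ((x1 ^^ n) h)))\<^sup>2" by (rule \<delta>(2))
    also have "\<dots> \<le> (norm h)\<^sup>2"
      using order_trans[OF norm_D_power_X1 norm_D_le] by (simp add: power_mono)
    finally have "(sqrt \<delta> * norm ((x1 ^^ n) h))\<^sup>2 \<le> (norm h)\<^sup>2"
      using \<delta>(1) by (simp add: power_mult_distrib)
    then have "sqrt \<delta> * norm ((x1 ^^ n) h) \<le> norm h" by (rule power2_le_imp_le) simp
    then show ?thesis using \<delta>(1) by (simp add: field_simps)
  qed
  then have "\<exists>K. \<forall>n h. norm ((x1 ^^ n) h) \<le> K * norm h" by blast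
  from someI_ex[OF this, folded power_bound_def] show ?thesis by blast
qed

sublocale X1: power_bounded_operator x1 power_bound
  by unfold_locales (rule bounded_operator_X1, rule power_bound)

context
  fixes z :: complex assumes z: "z \<in> ball 0 1"
begin

lemma inv_I_minus_zX1: "inv (I_minus_zX1 A R Q z) = X1.Res z"
  unfolding I_minus_zX1_def by (rule X1.inv_id_minus_eq_Res[OF z])

lemma invertible_I_minus_zX1: "invertible_on UNIV (I_minus_zX1 A R Q z)"
  unfolding I_minus_zX1_def by (rule X1.invertible_id_minus[OF z])

lemma Phi11_eq: "Phi11 A T' R Q z p = z *\<^sub>C x3 (X1.Res z (x2 p))"
  by (simp add: Phi11_def inv_I_minus_zX1)

lemma Phi12_eq: "Phi12 A R Q z h = x3 (X1.Res z h)"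
  by (simp add: Phi12_def inv_I_minus_zX1)

lemma Phi21_eq: "Phi21 A T' R Q z p = x5 p + z *\<^sub>C x4 (X1.Res z (x2 p))"
  by (simp add: Phi21_def inv_I_minus_zX1)

lemma Phi22_eq: "Phi22 A T' R Q z h = x4 (X1.Res z h)"
  by (simp add: Phi22_def inv_I_minus_zX1)

text \<open>The vector \<open>x = z *\<^sub>C X1.Res z (x2 u)\<close> satisfies
  \<open>x = z *\<^sub>C (x1 x + x2 u)\<close>, and the energy balance at \<open>x\<close> with
  input \<open>u\<close> controls both outputs. The gain of a factor \<open>cmod z\<close> for
  \<open>Phi11\<close>, as in Schwarz's lemma, is what makes the feedback loop solvable.\<close>

lemma Phi_bounds:
  assumes u: "u \<in> \<P>"
  shows "norm (Phi11 A T' R Q z u) \<le> cmod z * norm u" "norm (Phi21 A T' R Q z u) \<le> norm u"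
proof -
  define g where "g = X1.Res z (x2 u)"
  define x where "x = z *\<^sub>C g"
  have g: "g = x1 x + x2 u"
    using X1.Res_eq[OF z, of "x2 u"] by (simp add: g_def x_def X1_lin add.commute)
  have e: "Phi11 A T' R Q z u = x3 x" by (simp add: Phi11_eq x_def g_def X3_lin)
  have t: "Phi21 A T' R Q z u = x4 x + x5 u" by (simp add: Phi21_eq x_def g_def X4_lin)
  define a where "a = (norm (D g))\<^sup>2"
  have Dx: "(norm (D x))\<^sup>2 = (cmod z)\<^sup>2 * a"
    by (simp add: x_def a_def D_lin norm_scaleC power_mult_distrib)
  have z2: "(cmod z)\<^sup>2 \<le> 1" using z by (simp add: abs_square_le_1)
  have en: "(norm (x4 x + x5 u))\<^sup>2 + a + (norm (x3 x))\<^sup>2 \<le> (cmod z)\<^sup>2 * a + (norm u)\<^sup>2"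
    using energy[OF u, of x] by (simp add: Dx a_def flip: g)
  have za: "(cmod z)\<^sup>2 * a \<le> a" using z2 by (simp add: a_def mult_left_le_one_le)
  have "(norm (x4 x + x5 u))\<^sup>2 \<le> (norm u)\<^sup>2"
    using en za zero_le_power2[of "norm (x3 x)"] by linarith
  then show "norm (Phi21 A T' R Q z u) \<le> norm u" unfolding t by (rule power2_le_imp_le) simp
  have 1: "(norm (x3 x))\<^sup>2 \<le> (norm u)\<^sup>2 - (1 - (cmod z)\<^sup>2) * a"
    using en zero_le_power2[of "norm (x4 x + x5 u)"] by (simp only: left_diff_distrib)
  have 2: "(norm (x3 x))\<^sup>2 \<le> (cmod z)\<^sup>2 * a"
    using norm_D_decomposition[of x] zero_le_power2[of "norm (D (Q (Qplus x)))"] Dx by linarith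
  \<comment> \<open>A convex combination of the bounds \<open>1\<close> and \<open>2\<close> with
    weights \<open>(cmod z)\<^sup>2\<close> and \<open>1 - (cmod z)\<^sup>2\<close>, chosen so that
    the unknown \<open>a\<close> cancels.\<close>
  have "(norm (x3 x))\<^sup>2 = (cmod z)\<^sup>2 * (norm (x3 x))\<^sup>2 + (1 - (cmod z)\<^sup>2) * (norm (x3 x))\<^sup>2"
    by (simp add: algebra_simps)
  also have "\<dots> \<le> (cmod z)\<^sup>2 * ((norm u)\<^sup>2 - (1 - (cmod z)\<^sup>2) * a) + (1 - (cmod z)\<^sup>2) * ((cmod z)\<^sup>2 * a)"
    using z2 by (intro add_mono mult_left_mono 1 2) auto
  also have "\<dots> = (cmod z * norm u)\<^sup>2" by (simp add: power_mult_distrib algebra_simps)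
  finally show "norm (Phi11 A T' R Q z u) \<le> cmod z * norm u"
    unfolding e by (rule power2_le_imp_le) simp
qed

lemma bounded_operator_Phi11: "bounded_operator \<P> (ker_adj Q) (Phi11 A T' R Q z)"
  unfolding Phi11_eq[abs_def]
  by (rule bounded_operator_scale[OF bounded_operator_comp[OF bounded_operator_comp[OF
          bounded_operator_X2 X1.bounded_operator_Res[OF z]] bounded_operator_X3] KQ])

lemma bounded_operator_Phi12: "bounded_operator UNIV (ker_adj Q) (Phi12 A R Q z)"
  unfolding Phi12_eq[abs_def]
  by (rule bounded_operator_comp[OF X1.bounded_operator_Res[OF z] bounded_operator_X3])

lemma bounded_operator_Phi21: "bounded_operator \<P> (defect_space T') (Phi21 A T' R Q z)"
  unfolding Phi21_eq[abs_def]
  by (intro bounded_operator_plus[OF bounded_operator_X5] bounded_operator_scale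
      bounded_operator_comp[OF bounded_operator_comp[OF
          bounded_operator_X2 X1.bounded_operator_Res[OF z]] bounded_operator_X4]
      closed_csubspace_defect_space[OF T'])

lemma bounded_operator_Phi22: "bounded_operator UNIV (defect_space T') (Phi22 A T' R Q z)"
  unfolding Phi22_eq[abs_def]
  by (rule bounded_operator_comp[OF X1.bounded_operator_Res[OF z] bounded_operator_X4])

end

section \<open>Schur and Hardy class membership of the coefficient functions\<close>

lemma Phi11_schur: "Phi11 A T' R Q \<in> schur_class \<P> (ker_adj Q)"
proof -
  have "operator_analytic \<P> (ker_adj Q) (\<lambda>z u. 0 + z *\<^sub>C x3 (X1.Res z (x2 u)))"
    by (rule X1.operator_analytic_transfer[OF _ bounded_operator_X2 bounded_operator_X3 KQ])
      (rule bounded_operatorI[where c = 0], simp_all add: closed_csubspaceD[OF KQ])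
  then have "operator_analytic \<P> (ker_adj Q) (Phi11 A T' R Q)"
    by (rule operator_analytic_cong) (simp add: Phi11_eq)
  moreover have "norm (Phi11 A T' R Q z u) \<le> norm u" if "z \<in> ball 0 1" "u \<in> \<P>" for z u
    using Phi_bounds(1)[OF that] mult_right_mono[of "cmod z" 1 "norm u"] that(1) by simp
  ultimately show ?thesis
    by (simp add: schur_class_def contraction_def bounded_operator_Phi11)
qed

lemma Phi21_schur: "Phi21 A T' R Q \<in> schur_class \<P> (defect_space T')"
proof -
  have "operator_analytic \<P> (defect_space T') (\<lambda>z u. x5 u + z *\<^sub>C x4 (X1.Res z (x2 u)))"
    by (rule X1.operator_analytic_transfer[OF bounded_operator_X5 bounded_operator_X2
          bounded_operator_X4 closed_csubspace_defect_space[OF T']])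
  then have "operator_analytic \<P> (defect_space T') (Phi21 A T' R Q)"
    by (rule operator_analytic_cong) (simp add: Phi21_eq)
  then show ?thesis
    by (simp add: schur_class_def contraction_def bounded_operator_Phi21 Phi_bounds(2))
qed

lemma energy_free_sum:
  "(\<Sum>n<N. (norm (x4 ((x1 ^^ n) h)))\<^sup>2 + (norm (x3 ((x1 ^^ n) h)))\<^sup>2) + (norm (D ((x1 ^^ N) h)))\<^sup>2
    \<le> (norm (D h))\<^sup>2"
proof (induction N)
  case (Suc N)
  then show ?case using energy_free[of "(x1 ^^ N) h"] by simp
qed simp

text \<open>The Taylor coefficients are \<open>F ((x1 ^^ n) h)\<close>, outputs of the system
  without input; their energies add up to at most the initial energy
  \<open>(norm (D h))\<^sup>2\<close>.\<close>

lemma output_hardy: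
  assumes F: "bounded_operator UNIV Y F"
    and le: "\<And>h. (norm (F h))\<^sup>2 \<le> (norm (x4 h))\<^sup>2 + (norm (x3 h))\<^sup>2"
  shows "\<exists>f\<in>hardy_space Y. \<forall>z\<in>ball 0 1. hardy_fun f z = F (X1.Res z h)"
proof -
  have 1: "(\<lambda>n. z ^ n *\<^sub>C F ((x1 ^^ n) h)) sums F (X1.Res z h)" if "z \<in> ball 0 1" for z
    using bounded_linear.sums[OF bounded_operator_imp_bounded_linear[OF F] X1.Res_sums[OF that]]
    by (simp add: bounded_operatorD(3)[OF F])
  have 2: "(\<Sum>n<N. (norm (F ((x1 ^^ n) h)))\<^sup>2) \<le> (norm (D h))\<^sup>2" for N
  proof -
    have "(\<Sum>n<N. (norm (F ((x1 ^^ n) h)))\<^sup>2) \<le>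
        (\<Sum>n<N. (norm (x4 ((x1 ^^ n) h)))\<^sup>2 + (norm (x3 ((x1 ^^ n) h)))\<^sup>2)"
      by (intro sum_mono le)
    then show ?thesis
      using energy_free_sum[where N = N and h = h] zero_le_power2[of "norm (D ((x1 ^^ N) h))"] by linarith
  qed
  obtain f where f: "\<And>z. z \<in> ball 0 1 \<Longrightarrow> hardy_fun f z = F (X1.Res z h)" "(norm f)\<^sup>2 \<le> (norm (D h))\<^sup>2"
    by (rule hardy_from_power_series[OF 1 2]) (assumption, rule that)
  then have "f \<in> hardy_space Y" using bounded_operatorD(1)[OF F] by (simp add: hardy_space_def)
  then show ?thesis using f(1) by blast
qed

lemma Phi12_hardy: "Phi12 A R Q \<in> operator_hardy_class UNIV (ker_adj Q)"
  using output_hardy[OF bounded_operator_X3]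
  by (simp add: operator_hardy_class_def bounded_operator_Phi12 Phi12_eq)

lemma Phi22_hardy: "Phi22 A T' R Q \<in> operator_hardy_class UNIV (defect_space T')"
  using output_hardy[OF bounded_operator_X4]
  by (simp add: operator_hardy_class_def bounded_operator_Phi22 Phi22_eq)

section \<open>The feedback system\<close>

text \<open>The right-hand side of \<open>gamma_formula\<close>, available at each point before it
  is known to come from a Hardy function.\<close>

definition gamma_value :: "(complex \<Rightarrow> 'h \<Rightarrow> 'z \<times> 'k \<times> 'h) \<Rightarrow> complex \<Rightarrow> 'h \<Rightarrow> 'k" where
  "gamma_value V z h = Phi22 A T' R Q z h + Phi21 A T' R Q z (V z
    (inv_into (ker_adj Q) (I_minus_Phi11_V A T' R Q V z) (Phi12 A R Q z h)))"

context
  fixes V :: "complex \<Rightarrow> 'h \<Rightarrow> 'z \<times> 'k \<times> 'h"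
  assumes V: "V \<in> schur_class (ker_adj Q) \<P>"
begin

text \<open>Generating function in \<open>z\<close> of the closed-loop states with initial value
  \<open>h\<close>: multiplication by \<open>z\<close> is the delay, and
  \<open>x3 (state z h)\<close> is the signal fed to \<open>V z\<close>.\<close>

definition state :: "complex \<Rightarrow> 'h \<Rightarrow> 'h" where
  "state z h = X1.Res z (h + z *\<^sub>C x2 (V z
    (inv_into (ker_adj Q) (I_minus_Phi11_V A T' R Q V z) (Phi12 A R Q z h))))"

lemma V_analytic: "operator_analytic (ker_adj Q) \<P> V"
  using V by (simp add: schur_class_def)

context
  fixes z :: complex assumes z: "z \<in> ball 0 1"
begin

lemma bounded_operator_V: "bounded_operator (ker_adj Q) \<P> (V z)"
  and norm_V_le: "e \<in> ker_adj Q \<Longrightarrow> norm (V z e) \<le> norm e"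
  using V z by (simp_all add: schur_class_def contraction_def)

lemmas V_in = bounded_operatorD(1)[OF bounded_operator_V]

lemma bounded_operator_Phi11_V: "bounded_operator (ker_adj Q) (ker_adj Q) (\<lambda>e. Phi11 A T' R Q z (V z e))"
  by (rule bounded_operator_comp[OF bounded_operator_V bounded_operator_Phi11[OF z]])

lemma norm_Phi11_V_le: "e \<in> ker_adj Q \<Longrightarrow> norm (Phi11 A T' R Q z (V z e)) \<le> cmod z * norm e"
  using Phi_bounds(1)[OF z V_in] mult_left_mono[OF norm_V_le, of e "cmod z"] by fastforce

text \<open>The factor \<open>cmod z\<close> from \<open>Phi_bounds\<close> makes the loop gain a
  strict contraction, whatever the Schur function \<open>V\<close> is.\<close>

lemma invertible_I_minus_Phi11_V: "invertible_on (ker_adj Q) (I_minus_Phi11_V A T' R Q V z)"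
  unfolding I_minus_Phi11_V_def
  by (rule invertible_on_id_minus[OF KQ bounded_operator_Phi11_V _ _ norm_Phi11_V_le]) (use z in auto)

lemma norm_inv_I_minus_Phi11_V:
  "e \<in> ker_adj Q \<Longrightarrow>
    norm (inv_into (ker_adj Q) (I_minus_Phi11_V A T' R Q V z) e) \<le> norm e / (1 - cmod z)"
  unfolding I_minus_Phi11_V_def
  by (rule norm_inv_id_minus_le[OF KQ bounded_operator_Phi11_V _ _ norm_Phi11_V_le]) (use z in auto)

lemmas feedback_inv = invertible_onD[OF invertible_I_minus_Phi11_V]

lemma feedback_in: "inv_into (ker_adj Q) (I_minus_Phi11_V A T' R Q V z) (Phi12 A R Q z h) \<in> ker_adj Q"
  by (rule feedback_inv(3)[OF bounded_operatorD(1)[OF bounded_operator_Phi12[OF z] UNIV_I]])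

text \<open>Solving the loop equation for \<open>g\<close> by the resolvent and applying
  \<open>x3\<close> gives exactly the equation that \<open>inv_into\<close> inverts. To compute
  \<open>gamma_value\<close> it therefore suffices to exhibit some solution of the loop equation,
  which is how the interpolation condition and the converse are proved.\<close>

lemma state_equation_unique:
  assumes g: "g = h + z *\<^sub>C (x1 g + x2 (V z (x3 g)))"
  shows "x3 g = inv_into (ker_adj Q) (I_minus_Phi11_V A T' R Q V z) (Phi12 A R Q z h)"
    and "gamma_value V z h = x4 g + x5 (V z (x3 g))" and "g = state z h"
proof -
  let ?u = "V z (x3 g)"
  have u: "?u \<in> \<P>" by (rule V_in[OF X3_in])
  have "g - z *\<^sub>C x1 g = h + z *\<^sub>C x2 ?u" by (subst g) (simp add: scaleC_add_right)
  from X1.Res_eqI[OF z this] have Res: "g = X1.Res z h + z *\<^sub>C X1.Res z (x2 ?u)"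
    by (simp add: X1.Res_add[OF z] X1.Res_scaleC[OF z])
  have "x3 g = x3 (X1.Res z h + z *\<^sub>C X1.Res z (x2 ?u))" using Res by (rule arg_cong)
  also have "\<dots> = Phi12 A R Q z h + Phi11 A T' R Q z ?u"
    by (simp add: X3_lin Phi12_eq[OF z] Phi11_eq[OF z])
  finally have "I_minus_Phi11_V A T' R Q V z (x3 g) = Phi12 A R Q z h"
    unfolding I_minus_Phi11_V_def diff_eq_eq .
  then show e: "x3 g = inv_into (ker_adj Q) (I_minus_Phi11_V A T' R Q V z) (Phi12 A R Q z h)"
    using feedback_inv(5)[OF X3_in, of g] by simp
  have "x4 g = x4 (X1.Res z h + z *\<^sub>C X1.Res z (x2 ?u))" using Res by (rule arg_cong)
  then show "gamma_value V z h = x4 g + x5 ?u"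
    unfolding gamma_value_def e[symmetric] by (simp add: X4_lin Phi22_eq[OF z] Phi21_eq[OF z])
  show "g = state z h"
    unfolding state_def e[symmetric] using Res by (simp add: X1.Res_add[OF z] X1.Res_scaleC[OF z])
qed

text \<open>The signal \<open>e\<close> found by inversion is consistent with the state it
  generates: its fixed point equation says \<open>x3 (state z h) = e\<close>.\<close>

lemma state_equation:
  "state z h = h + z *\<^sub>C (x1 (state z h) + x2 (V z (x3 (state z h))))"
proof -
  define e where "e = inv_into (ker_adj Q) (I_minus_Phi11_V A T' R Q V z) (Phi12 A R Q z h)"
  have g: "state z h = X1.Res z h + z *\<^sub>C X1.Res z (x2 (V z e))"
    by (simp add: state_def X1.Res_add[OF z] X1.Res_scaleC[OF z] flip: e_def)
  have "I_minus_Phi11_V A T' R Q V z e = Phi12 A R Q z h"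
    unfolding e_def by (rule feedback_inv(4)[OF bounded_operatorD(1)[OF bounded_operator_Phi12[OF z] UNIV_I]])
  then have "e = Phi12 A R Q z h + Phi11 A T' R Q z (V z e)"
    by (simp add: I_minus_Phi11_V_def diff_eq_eq)
  also have "\<dots> = x3 (state z h)"
    unfolding g by (simp add: X3_lin Phi12_eq[OF z] Phi11_eq[OF z])
  finally have e: "x3 (state z h) = e" ..
  have "state z h = X1.Res z (h + z *\<^sub>C x2 (V z e))"
    by (simp add: state_def flip: e_def)
  then have "state z h = (h + z *\<^sub>C x2 (V z e)) + z *\<^sub>C x1 (state z h)"
    using X1.Res_eq[OF z, of "h + z *\<^sub>C x2 (V z e)"] by simp
  also have "\<dots> = h + z *\<^sub>C (x1 (state z h) + x2 (V z e))" by (simp add: scaleC_add_right)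
  finally show ?thesis unfolding e .
qed

lemma gamma_value_state: "gamma_value V z h = x4 (state z h) + x5 (V z (x3 (state z h)))"
  by (rule state_equation_unique(2)[OF state_equation])

lemma gamma_value_in: "gamma_value V z h \<in> defect_space T'"
  unfolding gamma_value_state
  by (intro closed_csubspaceD(4)[OF closed_csubspace_defect_space[OF T']] X4_in X5_in V_in X3_in)

lemma bounded_operator_gamma_value: "bounded_operator UNIV (defect_space T') (gamma_value V z)"
  unfolding gamma_value_def
  by (rule bounded_operator_plus[OF bounded_operator_Phi22[OF z] bounded_operator_comp[OF
        bounded_operator_comp[OF bounded_operator_comp[OF bounded_operator_Phi12[OF z] feedback_inv(2)]
          bounded_operator_V] bounded_operator_Phi21[OF z]] closed_csubspace_defect_space[OF T']])

text \<open>Scale the energy balance by \<open>(cmod z)\<^sup>2\<close> and substitute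
  \<open>z *\<^sub>C (x1 x + x2 u) = x - h\<close>. The squares of \<open>norm (D x)\<close> cancel,
  so the state survives only linearly.\<close>

lemma gamma_value_bound:
  "(cmod z)\<^sup>2 * (norm (gamma_value V z h))\<^sup>2 \<le> 2 * (D (state z h) \<bullet> D h) - (norm (D h))\<^sup>2"
proof -
  define x where "x = state z h"
  define u where "u = V z (x3 x)"
  have u: "u \<in> \<P>" unfolding u_def by (rule V_in[OF X3_in])
  have x: "x - h = z *\<^sub>C (x1 x + x2 u)"
    using state_equation[of h] by (simp add: x_def u_def algebra_simps)
  have "(norm u)\<^sup>2 \<le> (norm (x3 x))\<^sup>2" unfolding u_def by (intro power_mono norm_V_le X3_in) simp
  then have "(norm (x4 x + x5 u))\<^sup>2 + (norm (D (x1 x + x2 u)))\<^sup>2 \<le> (norm (D x))\<^sup>2"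
    using energy[OF u, of x] by linarith
  then have "(cmod z)\<^sup>2 * ((norm (x4 x + x5 u))\<^sup>2 + (norm (D (x1 x + x2 u)))\<^sup>2) \<le> (cmod z)\<^sup>2 * (norm (D x))\<^sup>2"
    by (rule mult_left_mono) simp
  moreover have "(cmod z)\<^sup>2 * (norm (D (x1 x + x2 u)))\<^sup>2 = (norm (D x - D h))\<^sup>2"
    using arg_cong[OF x, of "\<lambda>y. norm (D y)"] by (simp add: D_lin norm_scaleC power_mult_distrib)
  moreover have "(cmod z)\<^sup>2 * (norm (D x))\<^sup>2 \<le> (norm (D x))\<^sup>2"
    using z by (intro mult_left_le_one_le) (auto simp: abs_square_le_1)
  moreover have "(norm (D x - D h))\<^sup>2 = (norm (D x))\<^sup>2 - 2 * (D x \<bullet> D h) + (norm (D h))\<^sup>2"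
    by (simp add: power2_norm_eq_inner inner_diff_left inner_diff_right inner_commute)
  ultimately show ?thesis
    by (simp add: gamma_value_state distrib_left flip: x_def u_def)
qed

end

lemma state_0: "state 0 h = h"
  using state_equation[of 0 h] by simp

text \<open>Assembled from the rules for applying and inverting operator functions, each of which
  asks for a bound that is uniform near \<open>z\<close>.\<close>

lemma vec_analytic_state: "vec_analytic (\<lambda>z. state z h)" (is ?state)
  and vec_analytic_gamma_value: "vec_analytic (\<lambda>z. gamma_value V z h)" (is ?gamma)
proof -
  have "vec_differentiable (\<lambda>z. state z h) z \<and> vec_differentiable (\<lambda>z. gamma_value V z h) z"
    if z: "z \<in> ball 0 1" for z
  proof -
    \<comment> \<open>The disc of this radius contains \<open>z\<close>, and on it
      \<open>1 / (1 - cmod w)\<close> is at most \<open>1 / (1 - r)\<close>. This bounds the inverse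
      in the loop and, up to the constant \<open>power_bound\<close>, the resolvent.\<close>
    define r where "r = (1 + cmod z) / 2"
    define S where "S = ball (0::complex) r"
    have r: "r < 1" using z by (simp add: r_def)
    have S: "open S" "z \<in> S" "\<And>w. w \<in> S \<Longrightarrow> w \<in> ball 0 1" "\<And>w. w \<in> S \<Longrightarrow> 1 - cmod w \<ge> 1 - r"
      using z by (auto simp: S_def r_def)
    define inv_fb where "inv_fb w = inv_into (ker_adj Q) (I_minus_Phi11_V A T' R Q V w)" for w
    have Phi11_diff: "vec_differentiable (\<lambda>w. Phi11 A T' R Q w u) z" if "u \<in> \<P>" for u
    proof (rule operator_analytic_vec_differentiable[OF _ z that])
      show "operator_analytic \<P> (ker_adj Q) (Phi11 A T' R Q)"
        using Phi11_schur by (simp add: schur_class_def)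
    qed
    have V_diff: "vec_differentiable (\<lambda>w. V w e) z" if "e \<in> ker_adj Q" for e
      by (rule operator_analytic_vec_differentiable[OF V_analytic z that])
    have M_diff: "vec_differentiable (\<lambda>w. Phi11 A T' R Q w (V w e)) z" if e: "e \<in> ker_adj Q" for e
    proof (rule vec_differentiable_apply[OF closed_\<P> S(1,2) _ _ Phi11_diff V_diff[OF e]])
      show "bounded_operator \<P> (ker_adj Q) (Phi11 A T' R Q w)" if "w \<in> S" for w
        by (rule bounded_operator_Phi11[OF S(3)[OF that]])
      show "norm (Phi11 A T' R Q w u) \<le> r * norm u" if "w \<in> S" "u \<in> \<P>" for w u
        using Phi_bounds(1)[OF S(3)[OF that(1)] that(2)] mult_right_mono[of "cmod w" r "norm u"] that(1)
        by (simp add: S_def)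
      show "V w e \<in> \<P>" if "w \<in> S" for w by (rule V_in[OF S(3)[OF that] e])
    qed
    have inv_diff: "vec_differentiable (\<lambda>w. inv_fb w e) z" if e: "e \<in> ker_adj Q" for e
    proof (rule vec_differentiable_inverse[OF KQ S(1,2) _ _ _ _ _ M_diff e])
      fix w assume w: "w \<in> S"
      note fb = feedback_inv[OF S(3)[OF w], folded inv_fb_def, unfolded I_minus_Phi11_V_def]
      show "bounded_operator (ker_adj Q) (ker_adj Q) (inv_fb w)" by (rule fb(2))
      fix e assume e: "e \<in> ker_adj Q"
      have "norm (inv_fb w e) \<le> norm e / (1 - cmod w)"
        unfolding inv_fb_def by (rule norm_inv_I_minus_Phi11_V[OF S(3)[OF w] e])
      also have "\<dots> \<le> norm e / (1 - r)" using S(4)[OF w] r by (intro divide_left_mono) auto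
      finally show "norm (inv_fb w e) \<le> (1 / (1 - r)) * norm e" by simp
      show "Phi11 A T' R Q w (V w e) \<in> ker_adj Q"
        by (rule bounded_operatorD(1)[OF bounded_operator_Phi11_V[OF S(3)[OF w]] e])
      show "inv_fb w e - Phi11 A T' R Q w (V w (inv_fb w e)) = e" by (rule fb(4)[OF e])
      show "inv_fb w (e - Phi11 A T' R Q w (V w e)) = e" by (rule fb(5)[OF e])
    qed
    have Res_diff: "vec_differentiable (\<lambda>w. X1.Res w x) z" for x
      by (rule operator_analytic_vec_differentiable[OF X1.operator_analytic_Res z UNIV_I])
    have Phi12_diff: "vec_differentiable (\<lambda>w. Phi12 A R Q w h) z"
      by (rule vec_differentiable_cong[OF vec_differentiable_bounded_operator[OF bounded_operator_X3 Res_diff[of h]]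
            S(1,2)]) (simp add: Phi12_eq[OF S(3)])
    have e_diff: "vec_differentiable (\<lambda>w. inv_fb w (Phi12 A R Q w h)) z"
    proof (rule vec_differentiable_apply[OF KQ S(1,2) _ _ inv_diff Phi12_diff])
      fix w assume w: "w \<in> S"
      show "bounded_operator (ker_adj Q) (ker_adj Q) (inv_fb w)"
        unfolding inv_fb_def by (rule feedback_inv(2)[OF S(3)[OF w]])
      show "Phi12 A R Q w h \<in> ker_adj Q"
        by (rule bounded_operatorD(1)[OF bounded_operator_Phi12[OF S(3)[OF w]] UNIV_I])
      fix e assume e: "e \<in> ker_adj Q"
      have "norm (inv_fb w e) \<le> norm e / (1 - cmod w)"
        unfolding inv_fb_def by (rule norm_inv_I_minus_Phi11_V[OF S(3)[OF w] e])
      also have "\<dots> \<le> norm e / (1 - r)" using S(4)[OF w] r by (intro divide_left_mono) auto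
      finally show "norm (inv_fb w e) \<le> (1 / (1 - r)) * norm e" by simp
    qed
    define u where "u w = V w (inv_fb w (Phi12 A R Q w h))" for w
    have u_in: "u w \<in> \<P>" if "w \<in> S" for w
      unfolding u_def inv_fb_def by (intro V_in feedback_in S(3) that)
    have u_diff: "vec_differentiable u z"
      unfolding u_def
    proof (rule vec_differentiable_apply[OF KQ S(1,2) _ _ V_diff e_diff])
      fix w assume w: "w \<in> S"
      show "bounded_operator (ker_adj Q) \<P> (V w)" by (rule bounded_operator_V[OF S(3)[OF w]])
      show "inv_fb w (Phi12 A R Q w h) \<in> ker_adj Q"
        unfolding inv_fb_def by (rule feedback_in[OF S(3)[OF w]])
      show "norm (V w e) \<le> 1 * norm e" if "e \<in> ker_adj Q" for e
        using norm_V_le[OF S(3)[OF w] that] by simp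
    qed
    obtain c2 where c2: "\<And>u. u \<in> \<P> \<Longrightarrow> norm (x2 u) \<le> c2 * norm u"
      by (rule bounded_operator_bound[OF bounded_operator_X2]) blast
    have x2u_diff: "vec_differentiable (\<lambda>w. h + w *\<^sub>C x2 (u w)) z"
      by (intro vec_differentiable_add vec_differentiable_const vec_differentiable_ident_scaleC
          vec_differentiable_apply[where N = "\<lambda>_. x2", OF closed_\<P> S(1,2) bounded_operator_X2 c2
            vec_differentiable_const u_diff u_in])
    have state_diff: "vec_differentiable (\<lambda>w. state w h) z"
      unfolding state_def inv_fb_def[symmetric] u_def[symmetric]
    proof (rule vec_differentiable_apply[OF closed_csubspace_UNIV S(1,2) _ _ Res_diff x2u_diff])
      fix w assume w: "w \<in> S"
      show "bounded_operator UNIV UNIV (X1.Res w)" by (rule X1.bounded_operator_Res[OF S(3)[OF w]])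
      show "norm (X1.Res w x) \<le> \<bar>power_bound\<bar> / (1 - r) * norm x" for x
      proof -
        have "norm (X1.Res w x) \<le> power_bound / (1 - cmod w) * norm x"
          by (rule X1.norm_Res_le[OF S(3)[OF w]])
        also have "\<dots> \<le> \<bar>power_bound\<bar> / (1 - r) * norm x"
          using S(4)[OF w] r by (intro mult_right_mono frac_le) auto
        finally show ?thesis .
      qed
    qed simp
    obtain c5 where c5: "\<And>u. u \<in> \<P> \<Longrightarrow> norm (x5 u) \<le> c5 * norm u"
      by (rule bounded_operator_bound[OF bounded_operator_X5]) blast
    have "vec_differentiable (\<lambda>w. x4 (state w h) + x5 (u w)) z"
      by (intro vec_differentiable_add vec_differentiable_bounded_operator[OF bounded_operator_X4 state_diff]
          vec_differentiable_apply[where N = "\<lambda>_. x5", OF closed_\<P> S(1,2) bounded_operator_X5 c5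
            vec_differentiable_const u_diff u_in])
    moreover have "x4 (state w h) + x5 (u w) = gamma_value V w h" if "w \<in> S" for w
      using gamma_value_state[OF S(3)[OF that], of h]
        state_equation_unique(1)[OF S(3)[OF that] state_equation[OF S(3)[OF that]], of h]
      by (simp add: u_def inv_fb_def)
    ultimately have "vec_differentiable (\<lambda>w. gamma_value V w h) z"
      by (rule vec_differentiable_cong[OF _ S(1,2)])
    then show ?thesis using state_diff by blast
  qed
  then show ?state ?gamma by (simp_all add: vec_analytic_def)
qed

text \<open>
  On the circle of radius \<open>r\<close> the pointwise energy balance bounds \<open>r ^ 2 * norm (gamma_value V z h) ^ 2\<close>
  by a quantity which is affine in the state, so that its mean is its value at the origin.
\<close>

lemma gamma_value_hardy:
  obtains g where "\<And>z. z \<in> ball 0 1 \<Longrightarrow> hardy_fun g z = gamma_value V z h" "(norm g)\<^sup>2 \<le> (norm (D h))\<^sup>2"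
proof (rule hardy_from_circle_means[OF vec_analytic_gamma_value[of h]])
  fix r :: real assume r: "0 < r" "r < 1"
  let ?c = "circlepath 0 r"
  have Dstate: "vec_analytic (\<lambda>z. D (state z h))"
    using vec_analytic_state vec_differentiable_bounded_operator[OF D] by (simp add: vec_analytic_def)
  obtain c where c: "\<And>z. z \<in> ball 0 1 \<Longrightarrow> (\<lambda>n. z ^ n *\<^sub>C c n) sums D (state z h)"
    by (rule vec_analytic_power_series[OF Dstate]) blast
  have "((\<lambda>t. D (state (?c t) h) \<bullet> D h) has_integral (norm (D h))\<^sup>2) {0..1}"
    using circle_mean_inner_0[OF Dstate c r, of "D h"] by (simp add: state_0 power2_norm_eq_inner)
  then have up: "((\<lambda>t. 2 * (D (state (?c t) h) \<bullet> D h) - (norm (D h))\<^sup>2)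
      has_integral 2 * (norm (D h))\<^sup>2 - (norm (D h))\<^sup>2) {0..1}"
    using has_integral_const_real[of "(norm (D h))\<^sup>2" 0 1]
    by (intro has_integral_diff has_integral_mult_right) simp_all
  have "(\<lambda>t. (norm (gamma_value V (?c t) h))\<^sup>2) integrable_on {0..1}"
    by (intro integrable_continuous_interval continuous_intros
        continuous_on_circle_comp vec_analytic_continuous vec_analytic_gamma_value r)
  then have low: "((\<lambda>t. r\<^sup>2 * (norm (gamma_value V (?c t) h))\<^sup>2) has_integral
      r\<^sup>2 * integral {0..1} (\<lambda>t. (norm (gamma_value V (?c t) h))\<^sup>2)) {0..1}"
    by (intro has_integral_mult_right integrable_integral)
  have "r\<^sup>2 * (norm (gamma_value V (?c t) h))\<^sup>2 \<le> 2 * (D (state (?c t) h) \<bullet> D h) - (norm (D h))\<^sup>2" for t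
    using gamma_value_bound[OF circlepath_in_ball[OF r], of t h] r by (simp add: norm_circlepath_0)
  from has_integral_le[OF low up this]
  show "r\<^sup>2 * integral {0..1} (\<lambda>t. (norm (gamma_value V (?c t) h))\<^sup>2) \<le> (norm (D h))\<^sup>2" by simp
qed (rule that)

lemma gamma_formula_iff:
  "gamma_formula A T' R Q V \<Gamma> \<longleftrightarrow> (\<forall>h. \<forall>z\<in>ball 0 1. hardy_fun (\<Gamma> h) z = gamma_value V z h)"
  by (simp add: gamma_formula_def gamma_value_def)

text \<open>\<open>\<Gamma> h\<close> agrees on the disc with the Hardy function found from circle
  means, so the two coincide and share the norm bound.\<close>

lemma gamma_formula_norm_le:
  assumes "gamma_formula A T' R Q V \<Gamma>"
  shows "(norm (\<Gamma> h))\<^sup>2 \<le> (norm (D h))\<^sup>2"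
proof -
  obtain g where g: "\<And>z. z \<in> ball 0 1 \<Longrightarrow> hardy_fun g z = gamma_value V z h" "(norm g)\<^sup>2 \<le> (norm (D h))\<^sup>2"
    by (rule gamma_value_hardy) blast
  have "\<Gamma> h = g" using assms g(1) by (intro hardy_eqI) (simp add: gamma_formula_iff)
  then show ?thesis using g(2) by simp
qed

lemma ex_gamma_formula:
  "\<exists>\<Gamma>. bounded_operator UNIV (hardy_space (defect_space T')) \<Gamma> \<and> gamma_formula A T' R Q V \<Gamma>"
proof -
  have "\<exists>g. \<forall>z\<in>ball 0 1. hardy_fun g z = gamma_value V z h" for h
    by (rule gamma_value_hardy) blast
  then obtain \<Gamma> where \<Gamma>: "\<And>h z. z \<in> ball 0 1 \<Longrightarrow> hardy_fun (\<Gamma> h) z = gamma_value V z h" by metis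
  then have formula: "gamma_formula A T' R Q V \<Gamma>" by (simp add: gamma_formula_iff)
  note lin = bounded_operatorD(2,3)[OF bounded_operator_gamma_value, simplified]
  have "bounded_operator UNIV (hardy_space (defect_space T')) \<Gamma>"
  proof (rule bounded_operatorI[where c = 1])
    show "\<Gamma> h \<in> hardy_space (defect_space T')" for h
      by (simp add: hardy_space_def \<Gamma> gamma_value_in)
    show "\<Gamma> (x + y) = \<Gamma> x + \<Gamma> y" for x y
      by (rule hardy_eqI) (simp add: \<Gamma> hardy_fun_add lin)
    show "\<Gamma> (a *\<^sub>C x) = a *\<^sub>C \<Gamma> x" for a x
      by (rule hardy_eqI) (simp add: \<Gamma> hardy_fun_scaleC lin)
    show "norm (\<Gamma> h) \<le> 1 * norm h" for h
      using power2_le_imp_le[OF gamma_formula_norm_le[OF formula, of h]] norm_D_le[of h] by simp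
  qed
  then show ?thesis using formula by blast
qed

text \<open>If \<open>g\<close> is the state for the initial value \<open>R x\<close>, then \<open>Q x + z g\<close> is the state for \<open>Q x\<close>.\<close>

lemma gamma_value_Q:
  assumes z: "z \<in> ball 0 1"
  shows "gamma_value V z (Q x) = defect T' (A (R x)) + z *\<^sub>C gamma_value V z (R x)"
proof -
  define g where "g = state z (R x)"
  define e where "e = x3 g"
  define g' where "g' = Q x + z *\<^sub>C g"
  have e_in: "e \<in> ker_adj Q" unfolding e_def by (rule X3_in)
  have u_in: "V z e \<in> \<P>" by (rule V_in[OF z e_in])
  have g: "g = R x + z *\<^sub>C (x1 g + x2 (V z e))" unfolding g_def e_def by (rule state_equation[OF z])
  have e': "x3 g' = z *\<^sub>C e" by (simp add: g'_def X3_lin X3_Q e_def)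
  have u': "V z (x3 g') = z *\<^sub>C V z e"
    unfolding e' by (rule bounded_operatorD(3)[OF bounded_operator_V[OF z] e_in])
  have X1Q: "x1 (Q x) = R x" "x4 (Q x) = defect T' (A (R x))" by (simp_all add: X1_def X4_def Qplus_Q)
  have "x1 g' + x2 (V z (x3 g')) = R x + z *\<^sub>C (x1 g + x2 (V z e))"
    unfolding u' bounded_operatorD(3)[OF bounded_operator_X2 u_in]
    by (simp add: g'_def X1_lin X1Q scaleC_add_right)
  then have "x1 g' + x2 (V z (x3 g')) = g" using g by simp
  then have "g' = Q x + z *\<^sub>C (x1 g' + x2 (V z (x3 g')))" by (simp add: g'_def)
  from state_equation_unique(2)[OF z this] have "gamma_value V z (Q x) = x4 g' + x5 (V z (x3 g'))" .
  also have "\<dots> = defect T' (A (R x)) + z *\<^sub>C (x4 g + x5 (V z e))"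
    unfolding u' bounded_operatorD(3)[OF bounded_operator_X5 u_in]
    by (simp add: g'_def X4_lin X1Q scaleC_add_right)
  also have "x4 g + x5 (V z e) = gamma_value V z (R x)"
    unfolding g_def e_def by (rule gamma_value_state[OF z, symmetric])
  finally show ?thesis .
qed

end

end

section \<open>From an interpolant to a Schur class function\<close>

text \<open>The closure of the pairs \<open>(F x, S x)\<close> is the graph of an isometry on the
  closed range of \<open>F\<close>: its pairs have components of equal norm, which gives uniqueness,
  and completeness gives existence. Composing with the projection onto that range extends it by zero
  to a contraction.\<close>

lemma isometric_factor:
  fixes F :: "'a::chilbert_space \<Rightarrow> 'b::chilbert_space" and S :: "'a \<Rightarrow> 'c::chilbert_space"
  assumes F: "bounded_operator UNIV UNIV F" and S: "bounded_operator UNIV UNIV S"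
    and iso: "\<And>x. norm (S x) = norm (F x)"
  obtains W where "bounded_operator UNIV UNIV W" "\<And>x. norm (W x) \<le> norm x" "\<And>x. W (F x) = S x"
proof -
  define M where "M = closure (range F)"
  define Gr where "Gr = closure (range (\<lambda>x. (F x, S x)))"
  have M: "closed_csubspace M" unfolding M_def by (rule closed_csubspace_closure_range[OF F])
  have Gr: "closed_csubspace Gr"
    unfolding Gr_def by (rule closed_csubspace_closure_range[OF bounded_operator_Pair[OF F S]])
  have "Gr \<subseteq> {p. norm (fst p) = norm (snd p)}"
    unfolding Gr_def
    by (rule closure_minimal) (auto simp: iso intro!: closed_Collect_eq continuous_intros)
  then have norm_Gr: "norm w = norm x" if "(x, w) \<in> Gr" for x w using that by auto
  have unique: "w = w'" if w: "(x, w) \<in> Gr" "(x, w') \<in> Gr" for x w w'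
    using norm_Gr[of 0 "w - w'"] closed_csubspaceD(5)[OF Gr w] by simp
  have ex: "\<exists>w. (x, w) \<in> Gr" if x: "x \<in> M" for x
  proof -
    obtain s where s: "\<And>n. s n \<in> range F" "s \<longlonglongrightarrow> x"
      using x unfolding M_def closure_sequential by blast
    then have "\<forall>n. \<exists>y. s n = F y" by (simp add: image_iff)
    then obtain y where y: "\<And>n. s n = F (y n)" by metis
    have "Cauchy (\<lambda>n. S (y n))"
    proof -
      have "norm (S (y m) - S (y n)) = norm (s m - s n)" for m n
        using iso[of "y m - y n"] by (simp add: y bounded_operator_diff[OF F] bounded_operator_diff[OF S])
      then show ?thesis using LIMSEQ_imp_Cauchy[OF s(2)] by (simp add: Cauchy_iff)
    qed
    then obtain w where "(\<lambda>n. S (y n)) \<longlonglongrightarrow> w" using Cauchy_convergent convergentD by blast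
    then have "(\<lambda>n. (F (y n), S (y n))) \<longlonglongrightarrow> (x, w)"
      using s(2) unfolding y[symmetric] by (intro tendsto_Pair)
    then have "(x, w) \<in> Gr"
      unfolding Gr_def closure_sequential by (intro exI[of _ "\<lambda>n. (F (y n), S (y n))"] conjI) simp_all
    then show ?thesis ..
  qed
  define W0 where "W0 x = (SOME w. (x, w) \<in> Gr)" for x
  have W0: "(x, W0 x) \<in> Gr" if "x \<in> M" for x unfolding W0_def using someI_ex[OF ex[OF that]] .
  have W0_eq: "W0 x = w" if "(x, w) \<in> Gr" "x \<in> M" for x w using unique[OF W0[OF that(2)] that(1)] .
  have W0_bo: "bounded_operator M UNIV W0"
  proof (rule bounded_operatorI[where c = 1])
    show "W0 (x + y) = W0 x + W0 y" if "x \<in> M" "y \<in> M" for x y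
      using closed_csubspaceD(4)[OF Gr W0[OF that(1)] W0[OF that(2)]] closed_csubspaceD(4)[OF M that]
      by (intro W0_eq) simp_all
    show "W0 (a *\<^sub>C x) = a *\<^sub>C W0 x" if "x \<in> M" for a x
      using closed_csubspaceD(8)[OF Gr W0[OF that], of a] closed_csubspaceD(8)[OF M that]
      by (intro W0_eq) (simp_all add: scaleC_prod_def)
    show "norm (W0 x) \<le> 1 * norm x" if "x \<in> M" for x using norm_Gr[OF W0[OF that]] by simp
  qed simp
  show ?thesis
  proof (rule that)
    show "bounded_operator UNIV UNIV (\<lambda>x. W0 (orth_proj M x))"
      by (rule bounded_operator_comp[OF bounded_operator_orth_proj[OF M] W0_bo])
    show "norm (W0 (orth_proj M x)) \<le> norm x" for x
      using norm_Gr[OF W0[OF orth_proj_in[OF M]]] norm_orth_proj_le[OF M, of x] by simp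
    show "W0 (orth_proj M (F x)) = S x" for x
    proof -
      have x: "F x \<in> M" unfolding M_def by (rule subsetD[OF closure_subset rangeI])
      have "(F x, S x) \<in> Gr" unfolding Gr_def by (rule subsetD[OF closure_subset rangeI])
      then show ?thesis using x by (simp add: orth_proj_ident[OF M x] W0_eq)
    qed
  qed
qed

text \<open>Test the contraction on \<open>a + s *\<^sub>R b\<close>. The squares of
  \<open>norm a\<close> cancel and leave \<open>2 * s * c\<close> bounded by a multiple of
  \<open>s\<^sup>2\<close>, which is impossible for small \<open>s\<close> of the sign of
  \<open>c\<close> unless \<open>c = 0\<close>.\<close>

lemma contraction_orthogonal:
  fixes T :: "'a::real_inner \<Rightarrow> 'b::real_inner"
  assumes T: "bounded_linear T" and le: "\<And>x. norm (T x) \<le> norm x"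
    and iso: "norm (T a) = norm a" and orth: "a \<bullet> b = 0"
  shows "T a \<bullet> T b = 0"
proof -
  interpret T: bounded_linear T by (rule T)
  define c where "c = T a \<bullet> T b"
  \<comment> \<open>Proportional to \<open>c\<close>, so that \<open>s * c\<close> is a square up to
    a positive factor; the added one covers \<open>b = 0\<close>.\<close>
  define s where "s = c / ((norm b)\<^sup>2 + 1)"
  have pos: "(norm b)\<^sup>2 + 1 > 0" by (simp add: add_nonneg_pos)
  have "(norm (T (a + s *\<^sub>R b)))\<^sup>2 \<le> (norm (a + s *\<^sub>R b))\<^sup>2" by (intro power_mono le) simp
  moreover have "(norm (T (a + s *\<^sub>R b)))\<^sup>2 = (norm a)\<^sup>2 + 2 * s * c + s\<^sup>2 * (norm (T b))\<^sup>2"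
    unfolding iso[symmetric]
    by (simp add: T.add T.scaleR power2_norm_eq_inner inner_add_left inner_add_right
        inner_commute[of "T b" "T a"] c_def) (simp add: power2_eq_square algebra_simps)
  moreover have "(norm (a + s *\<^sub>R b))\<^sup>2 = (norm a)\<^sup>2 + s\<^sup>2 * (norm b)\<^sup>2"
    by (simp add: power2_norm_eq_inner inner_add_left inner_add_right inner_commute[of b a] orth)
      (simp add: power2_eq_square algebra_simps)
  ultimately have "2 * s * c \<le> s\<^sup>2 * (norm b)\<^sup>2"
    using mult_nonneg_nonneg[OF zero_le_power2[of s] zero_le_power2[of "norm (T b)"]] by linarith
  also have "\<dots> \<le> s\<^sup>2 * ((norm b)\<^sup>2 + 1)" by (intro mult_left_mono) auto
  also have "\<dots> = s * c" using pos by (simp add: s_def power2_eq_square)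
  finally have "s * c \<le> 0" by (simp add: mult.commute)
  then have "c\<^sup>2 / ((norm b)\<^sup>2 + 1) \<le> 0" by (simp add: s_def power2_eq_square)
  then have "c\<^sup>2 \<le> 0" using pos by (simp add: divide_le_0_iff)
  then show ?thesis by (simp add: c_def)
qed

lemma power_bounded_contraction:
  assumes "bounded_operator UNIV UNIV C" "\<And>x. norm (C x) \<le> norm x"
  shows "power_bounded_operator C 1"
proof
  show "norm ((C ^^ n) x) \<le> 1 * norm x" for n x
    by (induction n) (auto intro: order_trans[OF assms(2)])
qed (rule assms(1))

context lifting_problem
begin

text \<open>
  The state space \<open>H\<^sup>2 \<times> H\<close> carries the backward shift in the first component, and the contraction
  \<open>W\<close> with \<open>W (X (Q x)) = (D_circ x, X (R x))\<close> in the second. Removing the isometric copy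
  \<open>\<iota> h = (\<Gamma> h, X h)\<close> of \<open>H\<close> with the norm \<open>norm (D h)\<close> leaves a realisation of \<open>V\<close>.
\<close>

lemma ex_schur_parameter:
  fixes \<Gamma> :: "'h \<Rightarrow> 'k hardy"
  assumes B: "contraction UNIV UNIV (\<lambda>h. (A h, \<Gamma> h))"
    and \<Gamma>_in: "\<And>h. \<Gamma> h \<in> hardy_space (defect_space T')"
    and \<Gamma>_Q: "\<And>x z. z \<in> ball 0 1 \<Longrightarrow>
      hardy_fun (\<Gamma> (Q x)) z = defect T' (A (R x)) + z *\<^sub>C hardy_fun (\<Gamma> (R x)) z"
  shows "\<exists>V \<in> schur_class (ker_adj Q) \<P>. gamma_formula A T' R Q V \<Gamma>"
proof -
  note fst_bo = bounded_operator_fst[of UNIV UNIV, unfolded UNIV_Times_UNIV]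
  note snd_bo = bounded_operator_snd[of UNIV UNIV, unfolded UNIV_Times_UNIV]
  note DT = closed_csubspace_defect_space[OF T'] and DO = closed_csubspace_D_circ_space
  \<comment> \<open>The defect operator of the interpolant: \<open>(norm (X h))\<^sup>2\<close> is
    what \<open>(norm (\<Gamma> h))\<^sup>2\<close> lacks to reach
    \<open>(norm (D h))\<^sup>2\<close>.\<close>
  define X where "X = defect (\<lambda>h. (A h, \<Gamma> h))"
  have X: "bounded_operator UNIV UNIV X" unfolding X_def by (rule bounded_operator_defect[OF B])
  have \<Gamma>: "bounded_operator UNIV UNIV \<Gamma>"
    using bounded_operator_comp[OF contraction_bounded[OF B] snd_bo] by simp
  have norm_X: "(norm (X h))\<^sup>2 = (norm (D h))\<^sup>2 - (norm (\<Gamma> h))\<^sup>2" for h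
    unfolding X_def norm_defect[OF B] norm_defect[OF A] by (simp add: norm_Pair)
  have shift_Q: "backward_shift (\<Gamma> (Q x)) = \<Gamma> (R x)" "hardy_fun (\<Gamma> (Q x)) 0 = defect T' (A (R x))" for x
    using backward_shift_eqI[OF \<Gamma>_Q] by blast+
  have J_norm: "(norm (J x))\<^sup>2 = (norm (D_circ R Q x))\<^sup>2 + (norm (defect T' (A (R x))))\<^sup>2" for x
    by (simp add: J_op_def norm_Pair)
  \<comment> \<open>Subtract the balance of the backward shift at \<open>\<Gamma> (Q x)\<close> from
    \<open>norm_D_Q\<close>; the parts in the defect space of \<open>T'\<close> cancel.\<close>
  have "norm (D_circ R Q x, X (R x)) = norm (X (Q x))" for x
  proof -
    have "(norm (X (Q x)))\<^sup>2 = (norm (D_circ R Q x))\<^sup>2 + (norm (X (R x)))\<^sup>2"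
      using norm_backward_shift[of "\<Gamma> (Q x)"] by (simp add: norm_X norm_D_Q shift_Q J_norm)
    also have "\<dots> = (norm (D_circ R Q x, X (R x)))\<^sup>2" by (simp add: norm_Pair)
    finally show ?thesis by simp
  qed
  then obtain W where W: "bounded_operator UNIV UNIV W" "\<And>x. norm (W x) \<le> norm x"
      "\<And>x. W (X (Q x)) = (D_circ R Q x, X (R x))"
    by (rule isometric_factor[OF bounded_operator_comp[OF Q X]
        bounded_operator_Pair[OF bounded_operator_D_circ bounded_operator_comp[OF R X],
          unfolded UNIV_Times_UNIV]]) blast
  define \<iota> where "\<iota> h = (\<Gamma> h, X h)" for h
  have \<iota>: "bounded_operator UNIV UNIV \<iota>"
    using bounded_operator_Pair[OF \<Gamma> X] by (simp add: \<iota>_def[abs_def])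
  note \<iota>_lin = bounded_operatorD(2,3)[OF \<iota>, simplified] bounded_operator_diff[OF \<iota>, simplified]
  have norm_\<iota>: "(norm (\<iota> h))\<^sup>2 = (norm (D h))\<^sup>2" for h by (simp add: \<iota>_def norm_Pair norm_X)
  have inner_\<iota>: "\<iota> h \<bullet> \<iota> g = D h \<bullet> D g" for h g
    using norm_\<iota>[of "h + g"] norm_\<iota>[of h] norm_\<iota>[of g]
    by (simp add: \<iota>_lin D_lin power2_norm_eq_inner inner_add_left inner_add_right inner_commute)
  \<comment> \<open>The adjoint of \<open>\<iota>\<close> when \<open>H\<close> carries the weighted
    inner product. As \<open>\<iota>\<close> is isometric for it, \<open>\<eta>\<close> is a left
    inverse, \<open>\<iota> (\<eta> \<xi>)\<close> is the orthogonal projection onto the copy of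
    \<open>H\<close>, and \<open>P\<close> is the complementary projection.\<close>
  define \<eta> where "\<eta> \<xi> = iD2 (\<iota>\<^sup>\<dagger> \<xi>)" for \<xi>
  have \<eta>: "bounded_operator UNIV UNIV \<eta>"
    unfolding \<eta>_def by (rule bounded_operator_comp[OF bounded_operator_adj[OF \<iota>] iD2(1)])
  note \<eta>_lin = bounded_operatorD(2,3)[OF \<eta>, simplified] bounded_operator_diff[OF \<eta>, simplified]
  have D_\<eta>: "D (\<eta> \<xi>) \<bullet> D h = \<xi> \<bullet> \<iota> h" for \<xi> h
    by (simp add: \<eta>_def inner_D2[OF A, symmetric] iD2(2) inner_adj_left[OF \<iota>])
  have \<eta>_\<iota>: "\<eta> (\<iota> h) = h" for h
  proof -
    have "\<iota>\<^sup>\<dagger> (\<iota> h) = D2 A h"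
      by (rule vector_eq_rdot[THEN iffD1]) (simp add: inner_adj_left[OF \<iota>] inner_\<iota> inner_D2[OF A])
    then show ?thesis by (simp add: \<eta>_def iD2(3))
  qed
  define P where "P \<xi> = \<xi> - \<iota> (\<eta> \<xi>)" for \<xi>
  have P: "bounded_operator UNIV UNIV P"
    unfolding P_def by (intro bounded_operator_minus_op bounded_operator_id bounded_operator_comp[OF \<eta> \<iota>]) auto
  note P_lin = bounded_operatorD(2,3)[OF P, simplified] bounded_operator_diff[OF P, simplified]
  have P_orth: "P \<xi> \<bullet> \<iota> h = 0" for \<xi> h by (simp add: P_def inner_diff_left inner_\<iota> D_\<eta>)
  have P_\<iota>: "P (\<iota> h) = 0" for h by (simp add: P_def \<eta>_\<iota>)
  have norm_P: "(norm \<xi>)\<^sup>2 = (norm (D (\<eta> \<xi>)))\<^sup>2 + (norm (P \<xi>))\<^sup>2" for \<xi>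
  proof -
    have "(norm (\<iota> (\<eta> \<xi>) + P \<xi>))\<^sup>2 = (norm (\<iota> (\<eta> \<xi>)))\<^sup>2 + (norm (P \<xi>))\<^sup>2"
      using P_orth[of \<xi> "\<eta> \<xi>"]
      by (simp add: power2_norm_eq_inner inner_add_left inner_add_right inner_commute)
    then show ?thesis by (simp add: norm_\<iota>) (simp add: P_def)
  qed
  define shift where "shift \<xi> = (backward_shift (fst \<xi>), snd (W (snd \<xi>)))" for \<xi> :: "'k hardy \<times> 'h"
  \<comment> \<open>The projections put the output into \<open>\<D>\<close>. At
    \<open>\<iota> (Q x)\<close> they change nothing, so there \<open>out\<close> and
    \<open>shift\<close> reproduce \<open>J x\<close> and \<open>\<iota> (R x)\<close>.\<close>
  define out where "out \<xi> = (orth_proj (D_circ_space R Q) (fst (W (snd \<xi>))),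
    orth_proj (defect_space T') (hardy_fun (fst \<xi>) 0))" for \<xi> :: "'k hardy \<times> 'h"
  have shift: "bounded_operator UNIV UNIV shift"
    using bounded_operator_Pair[OF bounded_operator_comp[OF fst_bo bounded_operator_backward_shift]
        bounded_operator_comp[OF snd_bo bounded_operator_comp[OF W(1) snd_bo]]]
    by (simp add: shift_def[abs_def])
  have out: "bounded_operator UNIV \<D> out"
    unfolding out_def defect_sum_def
    by (rule bounded_operator_Pair[OF bounded_operator_comp[OF snd_bo bounded_operator_comp[OF W(1)
            bounded_operator_comp[OF fst_bo bounded_operator_orth_proj[OF DO]]]]
        bounded_operator_comp[OF fst_bo bounded_operator_comp[OF bounded_operator_hardy_fun_0
            bounded_operator_orth_proj[OF DT]]]])
  note shift_lin = bounded_operatorD(2,3)[OF shift, simplified] bounded_operator_diff[OF shift, simplified]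
  note out_lin = bounded_operatorD(2,3)[OF out, simplified] bounded_operator_diff[OF out, simplified]
  note out_in = bounded_operatorD(1)[OF out UNIV_I]
  have out_shift: "(norm (out \<xi>))\<^sup>2 + (norm (shift \<xi>))\<^sup>2 \<le> (norm \<xi>)\<^sup>2" for \<xi>
  proof -
    have "(norm (orth_proj (D_circ_space R Q) (fst (W (snd \<xi>)))))\<^sup>2 \<le> (norm (fst (W (snd \<xi>))))\<^sup>2"
      "(norm (orth_proj (defect_space T') (hardy_fun (fst \<xi>) 0)))\<^sup>2 \<le> (norm (hardy_fun (fst \<xi>) 0))\<^sup>2"
      by (intro power_mono norm_orth_proj_le DO DT norm_ge_zero)+
    moreover have "(norm (fst (W (snd \<xi>))))\<^sup>2 + (norm (snd (W (snd \<xi>))))\<^sup>2 = (norm (W (snd \<xi>)))\<^sup>2"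
      by (cases "W (snd \<xi>)") (simp add: norm_Pair)
    moreover have "(norm (W (snd \<xi>)))\<^sup>2 \<le> (norm (snd \<xi>))\<^sup>2" by (intro power_mono W(2)) simp
    moreover have "(norm \<xi>)\<^sup>2 = (norm (fst \<xi>))\<^sup>2 + (norm (snd \<xi>))\<^sup>2" by (cases \<xi>) (simp add: norm_Pair)
    moreover have "(norm (out \<xi>))\<^sup>2 = (norm (orth_proj (D_circ_space R Q) (fst (W (snd \<xi>)))))\<^sup>2
        + (norm (orth_proj (defect_space T') (hardy_fun (fst \<xi>) 0)))\<^sup>2"
      "(norm (shift \<xi>))\<^sup>2 = (norm (backward_shift (fst \<xi>)))\<^sup>2 + (norm (snd (W (snd \<xi>))))\<^sup>2"
      by (simp_all add: out_def shift_def norm_Pair)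
    ultimately show ?thesis using norm_backward_shift[of "fst \<xi>"] by linarith
  qed
  have out_Q: "out (\<iota> (Q x)) = J x" and shift_Q': "shift (\<iota> (Q x)) = \<iota> (R x)" for x
    by (simp_all add: out_def shift_def \<iota>_def W(3) shift_Q J_op_def orth_proj_ident[OF DO D_circ_in]
        orth_proj_ident[OF DT defect_in_defect_space[OF T']])
  \<comment> \<open>The contraction with components \<open>out\<close> and \<open>shift\<close> is
    isometric at \<open>\<iota> (Q x)\<close>, so it preserves orthogonality to that vector. The
    result is the hypothesis of \<open>E_inv\<close>.\<close>
  have orth: "J x \<bullet> out \<xi> + D (R x) \<bullet> D (\<eta> (shift \<xi>)) = 0" if "\<iota> (Q x) \<bullet> \<xi> = 0" for x \<xi>
  proof -
    have bl: "bounded_linear (\<lambda>\<xi>. (out \<xi>, shift \<xi>))"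
      by (rule bounded_operator_imp_bounded_linear[OF bounded_operator_Pair[OF out shift]])
    have le: "norm (out \<xi>, shift \<xi>) \<le> norm \<xi>" for \<xi>
      by (rule power2_le_imp_le) (use out_shift[of \<xi>] in \<open>simp_all add: norm_Pair\<close>)
    have "(norm (out (\<iota> (Q x)), shift (\<iota> (Q x))))\<^sup>2 = (norm (\<iota> (Q x)))\<^sup>2"
      by (simp add: out_Q shift_Q' norm_Pair norm_\<iota> norm_D_Q)
    then have "norm (out (\<iota> (Q x)), shift (\<iota> (Q x))) = norm (\<iota> (Q x))" by simp
    from contraction_orthogonal[OF bl le this that]
    have "J x \<bullet> out \<xi> + \<iota> (R x) \<bullet> shift \<xi> = 0" by (simp add: out_Q shift_Q')
    then show ?thesis by (simp add: inner_commute[of "D (R x)"] D_\<eta> inner_commute[of "\<iota> (R x)"])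
  qed
  have norm_shift: "norm (shift \<xi>) \<le> norm \<xi>" for \<xi>
  proof (rule power2_le_imp_le)
    show "(norm (shift \<xi>))\<^sup>2 \<le> (norm \<xi>)\<^sup>2"
      using out_shift[of \<xi>] zero_le_power2[of "norm (out \<xi>)"] by linarith
  qed simp
  interpret S: power_bounded_operator shift 1
    by (rule power_bounded_contraction[OF shift norm_shift])
  have norm_P_le: "norm (P \<xi>) \<le> norm \<xi>" for \<xi>
  proof (rule power2_le_imp_le)
    show "(norm (P \<xi>))\<^sup>2 \<le> (norm \<xi>)\<^sup>2"
      using norm_P[of \<xi>] zero_le_power2[of "norm (D (\<eta> \<xi>))"] by linarith
  qed simp
  have PS: "bounded_operator UNIV UNIV (\<lambda>\<xi>. P (shift \<xi>))" by (rule bounded_operator_comp[OF shift P])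
  interpret PS: power_bounded_operator "\<lambda>\<xi>. P (shift \<xi>)" 1
    by (rule power_bounded_contraction[OF PS order_trans[OF norm_P_le norm_shift]])

  \<comment> \<open>The input that the coupling needs in order to produce the given output and the
    component of the shifted vector along the copy of \<open>H\<close>.\<close>
  define readout where "readout \<xi> = E_inv (out \<xi>, \<eta> (shift \<xi>))" for \<xi>
  have readout: "bounded_operator UNIV \<P> readout"
    unfolding readout_def
    using bounded_operator_comp[OF bounded_operator_mono[OF bounded_operator_Pair[OF out
            bounded_operator_comp[OF shift \<eta>]] subset_refl subset_UNIV] bounded_operator_E_inv] .
  \<comment> \<open>Generating function of the motion started by the signal as
    \<open>\<iota> (G e)\<close>, in which \<open>P\<close> removes the component along the copy of
    \<open>H\<close> after every shift.\<close>
  define inner_state where "inner_state z e = PS.Res z (\<iota> (G e))" for z e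
  define V where "V z e = readout (inner_state z e)" for z e
  have inner_state: "inner_state z e = \<iota> (G e) + z *\<^sub>C P (shift (inner_state z e))" if "z \<in> ball 0 1" for z e
    unfolding inner_state_def by (rule PS.Res_eq[OF that])
  have E_V: "E1 (V z e) = out (inner_state z e)" "x2 (V z e) = \<eta> (shift (inner_state z e))"
    if z: "z \<in> ball 0 1" and e: "e \<in> ker_adj Q" for z e
  proof -
    \<comment> \<open>One summand lies in the range of \<open>P\<close>; for the other,
      \<open>\<iota> (G e)\<close>, use that \<open>Q\<close> and \<open>G\<close> have orthogonal
      ranges in the weighted inner product.\<close>
    have "\<iota> (Q x) \<bullet> inner_state z e = 0" for x
      using P_orth[of "z *\<^sub>C shift (inner_state z e)" "Q x"]
      by (subst inner_state[OF z])
        (simp add: inner_add_right inner_\<iota> D_Q_orth_D_G[OF e] P_lin inner_commute)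
    from orth[OF this] show "E1 (V z e) = out (inner_state z e)" "x2 (V z e) = \<eta> (shift (inner_state z e))"
      unfolding V_def readout_def by (intro E_inv out_in; simp)+
  qed
  have \<iota>G: "bounded_operator (ker_adj Q) UNIV (\<lambda>e. \<iota> (G e))"
    by (rule bounded_operator_comp[OF bounded_operator_G \<iota>])
  have V_bo: "bounded_operator (ker_adj Q) \<P> (V z)" if "z \<in> ball 0 1" for z
    unfolding V_def inner_state_def
    by (rule bounded_operator_comp[OF bounded_operator_comp[OF \<iota>G PS.bounded_operator_Res[OF that]] readout])
  have V_contraction: "norm (V z e) \<le> norm e" if z: "z \<in> ball 0 1" and e: "e \<in> ker_adj Q" for z e
  proof -
    let ?\<xi> = "inner_state z e"
    have u: "V z e \<in> \<P>" by (rule bounded_operatorD(1)[OF V_bo[OF z] e])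
    \<comment> \<open>Isometry of the input column turns the balance of \<open>out\<close> and
      \<open>shift\<close> into one for \<open>V z e\<close>. The term with \<open>P\<close> is then
      absorbed by the orthogonal expansion of \<open>norm ?\<xi>\<close>, as
      \<open>cmod z \<le> 1\<close>.\<close>
    have "(norm (V z e))\<^sup>2 + (norm (P (shift ?\<xi>)))\<^sup>2 \<le> (norm ?\<xi>)\<^sup>2"
      using norm_E[OF u] out_shift[of ?\<xi>] norm_P[of "shift ?\<xi>"] by (simp add: E_V[OF z e])
    also have "(norm ?\<xi>)\<^sup>2 = (norm (\<iota> (G e) + P (z *\<^sub>C shift ?\<xi>)))\<^sup>2"
      using inner_state[OF z, of e] by (simp add: P_lin)
    also have "\<dots> = (norm (\<iota> (G e)))\<^sup>2 + (norm (P (z *\<^sub>C shift ?\<xi>)))\<^sup>2"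
      using P_orth[of "z *\<^sub>C shift ?\<xi>" "G e"]
      by (simp add: power2_norm_eq_inner inner_add_left inner_add_right inner_commute)
    also have "\<dots> = (norm e)\<^sup>2 + (cmod z)\<^sup>2 * (norm (P (shift ?\<xi>)))\<^sup>2"
      by (simp add: norm_\<iota> norm_D_G[OF e] P_lin norm_scaleC power_mult_distrib)
    also have "\<dots> \<le> (norm e)\<^sup>2 + (norm (P (shift ?\<xi>)))\<^sup>2"
      using z by (intro add_left_mono mult_left_le_one_le) (auto simp: abs_square_le_1)
    finally have "(norm (V z e))\<^sup>2 \<le> (norm e)\<^sup>2" by simp
    then show ?thesis by (rule power2_le_imp_le) simp
  qed
  \<comment> \<open>One step of the resolvent equation brings \<open>V\<close> into the form of a
    transfer function.\<close>
  have "operator_analytic (ker_adj Q) \<P>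
      (\<lambda>z e. readout (\<iota> (G e)) + z *\<^sub>C readout (P (shift (PS.Res z (\<iota> (G e))))))"
    by (rule PS.operator_analytic_transfer[OF bounded_operator_comp[OF \<iota>G readout] \<iota>G
          bounded_operator_comp[OF PS readout] closed_\<P>])
  then have "operator_analytic (ker_adj Q) \<P> V"
  proof (rule operator_analytic_cong)
    fix z e assume z: "z \<in> ball (0::complex) 1"
    show "readout (\<iota> (G e)) + z *\<^sub>C readout (P (shift (PS.Res z (\<iota> (G e))))) = V z e"
      using arg_cong[OF inner_state[OF z, of e], of readout]
      by (simp add: V_def bounded_operatorD(2,3)[OF readout] flip: inner_state_def)
  qed
  then have V: "V \<in> schur_class (ker_adj Q) \<P>"
    by (simp add: schur_class_def contraction_def V_bo V_contraction)
  have "hardy_fun (\<Gamma> h) z = gamma_value V z h" if z: "z \<in> ball 0 1" for h z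
  proof -
    \<comment> \<open>Generating function of the shift motion from \<open>\<iota> h\<close>.
      Comparing \<open>fst \<zeta> = \<Gamma> h + z *\<^sub>C backward_shift (fst \<zeta>)\<close>
      at the point \<open>z\<close> with \<open>hardy_fun_backward_shift\<close> shows that
      \<open>fst \<zeta>\<close> takes at the origin the value of \<open>\<Gamma> h\<close> at
      \<open>z\<close>.\<close>
    define \<zeta> where "\<zeta> = S.Res z (\<iota> h)"
    have \<zeta>: "\<zeta> = \<iota> h + z *\<^sub>C shift \<zeta>" unfolding \<zeta>_def by (rule S.Res_eq[OF z])
    have "fst \<zeta> = \<Gamma> h + z *\<^sub>C backward_shift (fst \<zeta>)"
      using arg_cong[OF \<zeta>, of fst] by (simp add: \<iota>_def shift_def scaleC_prod_def)
    then have "hardy_fun (fst \<zeta>) z = hardy_fun (\<Gamma> h) z + z *\<^sub>C hardy_fun (backward_shift (fst \<zeta>)) z"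
      by (metis hardy_fun_add hardy_fun_scaleC)
    then have val: "hardy_fun (fst \<zeta>) 0 = hardy_fun (\<Gamma> h) z"
      using hardy_fun_backward_shift[OF z, of "fst \<zeta>"] by simp
    have out_\<zeta>: "snd (out \<zeta>) = hardy_fun (\<Gamma> h) z"
      by (simp add: out_def val orth_proj_ident[OF DT hardy_space_mem[OF \<Gamma>_in z]])
    \<comment> \<open>The component of \<open>\<zeta>\<close> along the copy of \<open>H\<close>,
      and the candidate for the closed-loop state. Removing \<open>\<iota> (Q x)\<close> with
      \<open>x = Qplus g\<close> leaves \<open>\<iota> (G e)\<close> and the part in the complement,
      which turn out to form the motion defining \<open>V z e\<close>.\<close>
    define g where "g = \<eta> \<zeta>"
    define x where "x = Qplus g"
    define e where "e = x3 g"
    define \<xi> where "\<xi> = \<zeta> - \<iota> (Q x)"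
    have e: "e \<in> ker_adj Q" unfolding e_def by (rule X3_in)
    have shift_\<zeta>: "shift \<zeta> = \<iota> (R x) + shift \<xi>" by (simp add: \<xi>_def shift_lin shift_Q')
    have \<iota>_g: "\<iota> g = \<iota> (Q x) + \<iota> (G e)"
      using arg_cong[OF decomposition[of g], of \<iota>] by (simp only: \<iota>_lin x_def e_def)
    have "P \<zeta> = P (\<iota> h) + z *\<^sub>C P (shift \<zeta>)"
      using arg_cong[OF \<zeta>, of P] by (simp only: P_lin)
    then have "P \<zeta> = z *\<^sub>C P (shift \<xi>)" by (simp add: P_\<iota> P_lin shift_\<zeta>)
    moreover have "\<zeta> = \<iota> g + P \<zeta>" by (simp add: P_def g_def)
    ultimately have "\<zeta> = \<iota> (Q x) + (\<iota> (G e) + z *\<^sub>C P (shift \<xi>))"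
      unfolding \<iota>_g by (metis add.assoc)
    then have "\<xi> = \<iota> (G e) + z *\<^sub>C P (shift \<xi>)"
      using add_diff_cancel_left' unfolding \<xi>_def by metis
    then have "\<xi> - z *\<^sub>C P (shift \<xi>) = \<iota> (G e)" unfolding diff_eq_eq .
    from PS.Res_eqI[OF z this] have \<xi>: "inner_state z e = \<xi>" by (simp add: inner_state_def)
    \<comment> \<open>\<open>\<eta>\<close> applied to the equation of \<open>\<zeta>\<close>. The
      shift of \<open>\<iota> (Q x)\<close> contributes \<open>x1 g\<close>, that of
      \<open>\<xi>\<close> the input term \<open>x2 (V z e)\<close>, so this is the loop
      equation.\<close>
    have "g = h + z *\<^sub>C \<eta> (shift \<zeta>)"
      using arg_cong[OF \<zeta>, of \<eta>] by (simp only: \<eta>_lin \<eta>_\<iota> g_def)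
    also have "\<eta> (shift \<zeta>) = x1 g + x2 (V z e)"
      by (simp add: shift_\<zeta> \<eta>_lin \<eta>_\<iota> E_V[OF z e] \<xi> X1_def x_def)
    finally have "g = h + z *\<^sub>C (x1 g + x2 (V z (x3 g)))" by (simp add: e_def)
    from state_equation_unique(2)[OF V z this]
    have "gamma_value V z h = x4 g + x5 (V z e)" by (simp add: e_def)
    also have "\<dots> = snd (J x) + snd (out \<xi>)"
      by (simp add: X4_def J_op_def x_def X5_eq E_V[OF z e] \<xi>)
    also have "\<dots> = snd (out \<zeta>)" by (simp add: \<xi>_def out_lin out_Q)
    finally show ?thesis by (simp add: out_\<zeta>)
  qed
  then have "gamma_formula A T' R Q V \<Gamma>" by (simp add: gamma_formula_iff[OF V])
  then show ?thesis using V by blast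
qed

end

section \<open>Passage to the Sz.-Nagy-Schaeffer lifting\<close>

lemma adjoint_sz_nagy_schaeffer_embedding:
  fixes T' :: "'k::chilbert_space \<Rightarrow> 'k"
  assumes T': "contraction UNIV UNIV T'" and p: "p \<in> sz_nagy_schaeffer_space T'"
  shows "adjoint_on UNIV (sz_nagy_schaeffer_space T') sz_nagy_schaeffer_embedding p = fst p"
proof (rule adjoint_on_eqI[OF closed_csubspace_UNIV _ _ p UNIV_I])
  note H = closed_csubspace_hardy_space[OF closed_csubspace_defect_space[OF T']]
  show "closed_csubspace (sz_nagy_schaeffer_space T')"
    unfolding sz_nagy_schaeffer_space_def by (rule closed_csubspace_Times[OF closed_csubspace_UNIV H])
  show "bounded_operator UNIV (sz_nagy_schaeffer_space T') sz_nagy_schaeffer_embedding"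
    unfolding sz_nagy_schaeffer_space_def sz_nagy_schaeffer_embedding_def
    by (rule bounded_operator_Pair[OF bounded_operator_id])
      (auto intro: bounded_operatorI[where c = 0] simp: closed_csubspaceD(3)[OF H])
  show "cinner (sz_nagy_schaeffer_embedding x) p = cinner x (fst p)" for x
    by (simp add: sz_nagy_schaeffer_embedding_def cinner_prod_def)
qed

text \<open>Eliminates the \<open>THE\<close>: the Hardy function exists by prepending a coefficient
  and is determined by its values on the disc.\<close>

lemma sz_nagy_schaeffer_eq_iff:
  "sz_nagy_schaeffer T' (h, f) = (h', g) \<longleftrightarrow>
    T' h = h' \<and> (\<forall>z\<in>ball 0 1. hardy_fun g z = defect T' h + z *\<^sub>C hardy_fun f z)"
proof -
  let ?P = "\<lambda>g. \<forall>z\<in>ball 0 1. hardy_fun g z = defect T' h + z *\<^sub>C hardy_fun f z"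
  have unique: "\<exists>!g. ?P g"
  proof (rule ex_ex1I)
    show "\<exists>g. ?P g" by (rule ex_hardy_shift)
    show "g = g'" if "?P g" "?P g'" for g g' using that by (intro hardy_eqI) simp
  qed
  have "(THE g. ?P g) = g \<longleftrightarrow> ?P g"
  proof
    show "?P g" if "(THE g. ?P g) = g" using theI'[OF unique] unfolding that .
    show "(THE g. ?P g) = g" if "?P g" by (rule the1_equality[OF unique that])
  qed
  then show ?thesis by (simp add: sz_nagy_schaeffer_def)
qed

context lifting_problem
begin

text \<open>The projection condition fixes the first component of \<open>B\<close>. In the second,
  the intertwining condition is the hypothesis of \<open>ex_schur_parameter\<close> in one direction
  and \<open>gamma_value_Q\<close> in the other; contractivity amounts to
  \<open>norm (\<Gamma> h) \<le> norm (D h)\<close>.\<close>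

lemma contractive_interpolant_iff:
  assumes B: "bounded_operator UNIV (sz_nagy_schaeffer_space T') B"
  shows "contractive_interpolant (sz_nagy_schaeffer_space T') sz_nagy_schaeffer_embedding A
      (sz_nagy_schaeffer T') R Q B \<longleftrightarrow>
    (\<exists>V \<Gamma>. V \<in> schur_class (ker_adj Q) \<P> \<and> bounded_operator UNIV (hardy_space (defect_space T')) \<Gamma> \<and>
      gamma_formula A T' R Q V \<Gamma> \<and> (\<forall>h. B h = (A h, \<Gamma> h)))" (is "?L \<longleftrightarrow> ?R")
proof
  note adj = adjoint_sz_nagy_schaeffer_embedding[OF T' bounded_operatorD(1)[OF B UNIV_I]]
  assume L: ?L
  define \<Gamma> where "\<Gamma> h = snd (B h)" for h
  have B_eq: "B h = (A h, \<Gamma> h)" for h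
    using L by (simp add: contractive_interpolant_def adj \<Gamma>_def prod_eq_iff)
  have \<Gamma>: "bounded_operator UNIV (hardy_space (defect_space T')) \<Gamma>"
    unfolding \<Gamma>_def by (rule bounded_operator_comp[OF B[unfolded sz_nagy_schaeffer_space_def] bounded_operator_snd])
  have contr: "contraction UNIV UNIV (\<lambda>h. (A h, \<Gamma> h))"
    using L bounded_operator_mono[OF B subset_refl subset_UNIV]
    by (simp add: contractive_interpolant_def contraction_def flip: B_eq)
  have shift: "hardy_fun (\<Gamma> (Q x)) z = defect T' (A (R x)) + z *\<^sub>C hardy_fun (\<Gamma> (R x)) z"
    if "z \<in> ball 0 1" for x z
  proof -
    have "sz_nagy_schaeffer T' (A (R x), \<Gamma> (R x)) = (A (Q x), \<Gamma> (Q x))"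
      using L by (simp add: contractive_interpolant_def B_eq)
    then show ?thesis using that by (simp add: sz_nagy_schaeffer_eq_iff)
  qed
  show ?R
    using ex_schur_parameter[OF contr bounded_operatorD(1)[OF \<Gamma> UNIV_I] shift] \<Gamma> B_eq by blast
next
  note adj = adjoint_sz_nagy_schaeffer_embedding[OF T' bounded_operatorD(1)[OF B UNIV_I]]
  assume ?R
  then obtain V \<Gamma> where V: "V \<in> schur_class (ker_adj Q) \<P>" and \<Gamma>: "gamma_formula A T' R Q V \<Gamma>"
    and B_eq: "\<And>h. B h = (A h, \<Gamma> h)" by blast
  have "norm (B h) \<le> norm h" for h
  proof -
    have "(norm (B h))\<^sup>2 = (norm (A h))\<^sup>2 + (norm (\<Gamma> h))\<^sup>2" by (simp add: B_eq norm_Pair)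
    also have "\<dots> \<le> (norm h)\<^sup>2"
      using gamma_formula_norm_le[OF V \<Gamma>, of h] by (simp add: norm_defect[OF A])
    finally show ?thesis by (rule power2_le_imp_le) simp
  qed
  moreover have "sz_nagy_schaeffer T' (B (R x)) = B (Q x)" for x
    using \<Gamma> gamma_value_Q[OF V]
    by (simp add: B_eq sz_nagy_schaeffer_eq_iff intertwine gamma_formula_iff[OF V])
  moreover have "adjoint_on UNIV (sz_nagy_schaeffer_space T') sz_nagy_schaeffer_embedding (B h) = A h" for h
    using adj[of h] B_eq[of h] by simp
  ultimately show ?L using B by (simp add: contractive_interpolant_def contraction_def)
qed

end

theorem theorem1p2:
  fixes A :: "'h::chilbert_space \<Rightarrow> 'k::chilbert_space"
    and T' :: "'k \<Rightarrow> 'k"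
    and R Q :: "'z::chilbert_space \<Rightarrow> 'h"
    and U' :: "'k \<times> 'k hardy \<Rightarrow> 'k \<times> 'k hardy"
  assumes "lifting_data_set (sz_nagy_schaeffer_space T') sz_nagy_schaeffer_embedding A T' U' R Q"
    and "U' = sz_nagy_schaeffer T'"
    and "onorm A < 1"
    and "\<exists>L. bounded_operator UNIV UNIV L \<and> (\<forall>x. L (R x) = x)"
  shows
    "positive_definite_on UNIV (defect A) \<and>
     positive_definite_on UNIV (D2_conj A R) \<and>
     positive_definite_on UNIV (D2_conj A Q) \<and>
     positive_definite_on (ker_adj Q) (Delta A Q) \<and>
     positive_definite_on (ker_adj R) (Delta A R) \<and>
     positive_definite_on (defect_sum T' R Q) (Delta_Omega A T' R Q) \<and>
     (\<forall>z\<in>ball 0 1. invertible_on UNIV (I_minus_zX1 A R Q z)) \<and>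
     Phi11 A T' R Q \<in> schur_class (parameter_space T' R Q) (ker_adj Q) \<and>
     Phi21 A T' R Q \<in> schur_class (parameter_space T' R Q) (defect_space T') \<and>
     Phi12 A R Q \<in> operator_hardy_class UNIV (ker_adj Q) \<and>
     Phi22 A T' R Q \<in> operator_hardy_class UNIV (defect_space T') \<and>
     (\<forall>B. bounded_operator UNIV (sz_nagy_schaeffer_space T') B \<longrightarrow>
       (contractive_interpolant (sz_nagy_schaeffer_space T') sz_nagy_schaeffer_embedding A U' R Q B
        \<longleftrightarrow>
        (\<exists>V \<Gamma>. V \<in> schur_class (ker_adj Q) (parameter_space T' R Q) \<and>
           bounded_operator UNIV (hardy_space (defect_space T')) \<Gamma> \<and>
           gamma_formula A T' R Q V \<Gamma> \<and>
           (\<forall>h. B h = (A h, \<Gamma> h))))) \<and>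
     (\<forall>V \<in> schur_class (ker_adj Q) (parameter_space T' R Q).
        (\<forall>z\<in>ball 0 1. invertible_on (ker_adj Q) (I_minus_Phi11_V A T' R Q V z)) \<and>
        (\<exists>\<Gamma>. bounded_operator UNIV (hardy_space (defect_space T')) \<Gamma> \<and>
           gamma_formula A T' R Q V \<Gamma>))"
proof -
  interpret lifting_problem A T' R Q
    using assms by unfold_locales (auto simp: lifting_data_set_def)
  show ?thesis
    unfolding assms(2)
    using positive_definite_D positive_definite_D2_conj_R positive_definite_D2_conj_Q Delta_Q(1)
      Delta_R(1) positive_definite_Delta_Omega invertible_I_minus_zX1 Phi11_schur Phi21_schur
      Phi12_hardy Phi22_hardy contractive_interpolant_iff invertible_I_minus_Phi11_V ex_gamma_formula
    by blast
qed

end
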